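(* Let $E$ be an $n$-dimensional real vector space, $n\ge2$, and let $g_0$ and $g$ be two distinct points in $\mathcal{M}_{n-1,1}$, the space of inner products of signature $(n-1,1)$ on $E$. Then there is the following alternative: either (i) $E$ splits as $E=E_{1,1}\oplus E_{n-2,0}$, where the sum is orthogonal for both $g_0$ and $g$, and both $g_0$ and $g$ have signature $(1,1)$ on $E_{1,1}$ and signature $(n-2,0)$ on $E_{n-2,0}$. Both $g_0$ and $g$ belong to the corresponding totally geodesic submanifold $\mathcal{M}_{1,1}\times\mathcal{M}_{n-2,0}\subset\mathcal{M}_{n-1,1}$. The issue of existence and uniqueness of geodesics connecting $g_0$ to $g$ is reduced to the same issue for the 2-dimensional Lorentzian inner products ${g_0}|_{E_{1,1}}$ and $g|_{E_{1,1}}$ in $\mathcal{M}_{1,1}$: there is a geodesic (respectively exactly one geodesic) in $\mathcal{M}_{n-1,1}$ connecting $g_0$ to $g$ if and only if there is one (respectively exactly one) in $\mathcal{M}_{1,1}$ connecting ${g_0}|_{E_{1,1}}$ to $g|_{E_{1,1}}$; writing $g|_{E_{1,1}}={g_0}|_{E_{1,1}}(B\cdot,\cdot)$ and $\hat B=B/\sqrt{\det B}$, one exists if and only if $\operatorname{tr}(\hat B)>-2$ or $\hat B=-\mathrm{id}$; or (ii) $E$ splits as $E=E_{2,1}\oplus E_{n-3,0}$, where the sum is orthogonal for both $g_0$ and $g$, and both $g_0$ and $g$ have signature $(2,1)$ on $E_{2,1}$ and signature $(n-3,0)$ on $E_{n-3,0}$. Both $g_0$ and $g$ belong to the corresponding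 totally geodesic submanifold $\mathcal{M}_{2,1}\times\mathcal{M}_{n-3,0}\subset\mathcal{M}_{n-1,1}$. The 3-dimensional Lorentzian inner products are related by $g|_{E_{2,1}}={g_0}|_{E_{2,1}}(B\cdot,\cdot)$, where $B$ is an automorphism of $E_{2,1}$ of the form $k(\mathrm{id}+x)$, with $k$ a positive real number and $x$ an endomorphism of $E_{2,1}$ satisfying $x^3=0$ but $x^2\neq0$. In this case $g_0$ and $g$ are connected by a unique geodesic, whose $E_{2,1}$-part is of the form $${g_t}|_{E_{2,1}}={g_0}|_{E_{2,1}}(B_t\cdot,\cdot),\qquad B_t=k^t\exp\!\big(t(x-\tfrac12x^2)\big)=k^t\Big(1+tx+\tfrac{t(t-1)}{2}x^2\Big).$$
   Context: For a real vector space $E$ of dimension $n=r+s$, $\mathcal{M}_{r,s}$ is the manifold of all inner products (nondegenerate symmetric bilinear forms) of signature $(r,s)$ on $E$. It equals $\mathrm{GL}^+(E)/\mathrm{SO}(g_0)=\mathbb{R}^+\times\mathrm{SL}(E)/\mathrm{SO}(g_0)$ and is a semi-Riemannian symmetric space, with the metric on the second factor induced by the Killing form of $\mathfrak{sl}(E)$. For $g_0,g\in\mathcal{M}_{n-1,1}$ there is a unique automorphism $A$ of $E$ with $g=g_0(A\cdot,\cdot)$. The geodesics from $g_0$ to $g$ are the curves $g_t=g_0(\exp(ta)\cdot,\cdot)$, $t\in[0,1]$, where $a$ is a $g_0$-symmetric endomorphism of $E$ with $\exp(a)=A$; $g_0$ and $g$ are connected by a geodesic iff such an $a$ exists. The same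 description holds for $\mathcal{M}_{1,1}$, etc. In (i) and (ii), $\mathcal{M}_{1,1}$, $\mathcal{M}_{2,1}$, $\mathcal{M}_{n-2,0}$, $\mathcal{M}_{n-3,0}$ denote the spaces of inner products of the indicated signature on $E_{1,1}$, $E_{2,1}$, $E_{n-2,0}$, $E_{n-3,0}$; a product of two such spaces is embedded in $\mathcal{M}_{n-1,1}$ by taking orthogonal direct sums of inner products. *)

theory Defs
  imports "HOL-Analysis.Analysis"
begin

text \<open>
  The vector space \<open>E\<close> is a type of class \<open>euclidean_space\<close>; the inner product of that class
  is never used, only its topology (which is the canonical one), to sum the exponential series.
  Since forms on subspaces of \<open>E\<close> are needed as well, everything is relative to a subspace \<open>S\<close>,
  and \<open>S = UNIV\<close> gives the forms on \<open>E\<close>.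
\<close>

type_synonym 'a form = "'a \<Rightarrow> 'a \<Rightarrow> real"

section \<open>Forms and endomorphisms of a subspace\<close>

text \<open>
  A form on \<open>S\<close> is extended by zero outside \<open>S \<times> S\<close>, so that equality of forms on \<open>S\<close> is
  equality of functions.
\<close>

definition sym_forms :: "'a::euclidean_space set \<Rightarrow> 'a form set" where
  "sym_forms S = {h.
     (\<forall>x\<in>S. \<forall>y\<in>S. h x y = h y x) \<and>
     (\<forall>x\<in>S. \<forall>y\<in>S. \<forall>z\<in>S. h (x + y) z = h x z + h y z) \<and>
     (\<forall>x\<in>S. \<forall>y\<in>S. \<forall>r. h (r *\<^sub>R x) y = r * h x y) \<and>
     (\<forall>x y. x \<notin> S \<or> y \<notin> S \<longrightarrow> h x y = 0)}"

definition restrict_form :: "'a form \<Rightarrow> 'a::euclidean_space set \<Rightarrow> 'a form" where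
  "restrict_form h S = (\<lambda>x y. if x \<in> S \<and> y \<in> S then h x y else 0)"

text \<open>\<open>inner_products r s S\<close> is the space \<open>M\<^bsub>r,s\<^esub>\<close> of inner products of signature \<open>(r,s)\<close> on \<open>S\<close>.\<close>

definition inner_products :: "nat \<Rightarrow> nat \<Rightarrow> 'a::euclidean_space set \<Rightarrow> 'a form set" where
  "inner_products r s S = {g \<in> sym_forms S. \<exists>P N.
     P \<inter> N = {} \<and> independent (P \<union> N) \<and> span (P \<union> N) = S \<and> card P = r \<and> card N = s \<and>
     (\<forall>x\<in>P. g x x = 1) \<and> (\<forall>x\<in>N. g x x = -1) \<and>
     (\<forall>x\<in>P \<union> N. \<forall>y\<in>P \<union> N. x \<noteq> y \<longrightarrow> g x y = 0)}"

definition endomorphism_on :: "'a::euclidean_space set \<Rightarrow> ('a \<Rightarrow> 'a) \<Rightarrow> bool" where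
  "endomorphism_on S f \<longleftrightarrow> f ` S \<subseteq> S \<and>
     (\<forall>x\<in>S. \<forall>y\<in>S. f (x + y) = f x + f y) \<and> (\<forall>x\<in>S. \<forall>r. f (r *\<^sub>R x) = r *\<^sub>R f x)"

definition automorphism_on :: "'a::euclidean_space set \<Rightarrow> ('a \<Rightarrow> 'a) \<Rightarrow> bool" where
  "automorphism_on S f \<longleftrightarrow> endomorphism_on S f \<and> bij_betw f S S"

definition some_basis :: "'a::euclidean_space set \<Rightarrow> 'a set" where
  "some_basis S = (SOME B. independent B \<and> span B = S)"

text \<open>Trace and determinant of an endomorphism of \<open>S\<close>; they do not depend on the chosen basis.\<close>

definition trace_on :: "'a::euclidean_space set \<Rightarrow> ('a \<Rightarrow> 'a) \<Rightarrow> real" where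
  "trace_on S f = (let B = some_basis S in \<Sum>b\<in>B. representation B (f b) b)"

definition det_on :: "'a::euclidean_space set \<Rightarrow> ('a \<Rightarrow> 'a) \<Rightarrow> real" where
  "det_on S f = (let B = some_basis S in
     \<Sum>p | p permutes B. of_int (sign p) * (\<Prod>b\<in>B. representation B (f b) (p b)))"

definition endo_exp :: "('a \<Rightarrow> 'a) \<Rightarrow> 'a \<Rightarrow> 'a::euclidean_space" where
  "endo_exp f v = (\<Sum>k. (1 / fact k) *\<^sub>R (f ^^ k) v)"

section \<open>The semi-Riemannian metric on the space of inner products\<close>

text \<open>
  For a nondegenerate \<open>g\<close> and a form \<open>h\<close> on \<open>S\<close>, this is the endomorphism \<open>X\<close> of \<open>S\<close> with
  \<open>h = 2 g(X _, _)\<close>. If \<open>h\<close> is symmetric then so is \<open>X\<close> with respect to \<open>g\<close>, and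
  \<open>h\<close> is the derivative at \<open>t = 0\<close> of \<open>g(exp(tX) _, exp(tX) _)\<close>: thus \<open>X\<close> is the element of
  \<open>gl(S)\<close>, in the complement of the isotropy algebra \<open>so(g)\<close>, which represents the tangent
  vector \<open>h\<close> at \<open>g\<close> in \<open>GL\<^sup>+(S)/SO(g)\<close>.
\<close>

definition generator :: "'a::euclidean_space set \<Rightarrow> 'a form \<Rightarrow> 'a form \<Rightarrow> 'a \<Rightarrow> 'a" where
  "generator S g h x = (1/2) *\<^sub>R (THE z. z \<in> S \<and> (\<forall>y\<in>S. g z y = h x y))"

definition traceless_part :: "'a::euclidean_space set \<Rightarrow> ('a \<Rightarrow> 'a) \<Rightarrow> 'a \<Rightarrow> 'a" where
  "traceless_part S X = (\<lambda>v. X v - (trace_on S X / real (dim S)) *\<^sub>R v)"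

text \<open>The Killing form of \<open>sl(S)\<close> is \<open>2n tr(XY)\<close>, where \<open>n = dim S\<close>.\<close>

definition killing_sl :: "'a::euclidean_space set \<Rightarrow> ('a \<Rightarrow> 'a) \<Rightarrow> ('a \<Rightarrow> 'a) \<Rightarrow> real" where
  "killing_sl S X Y = 2 * real (dim S) * trace_on S (X \<circ> Y)"

text \<open>
  The product metric on \<open>R\<^sup>+ \<times> SL(S)/SO(g)\<close>, at the point \<open>g\<close>: the first summand is the metric
  \<open>(d\<lambda>/\<lambda>)\<^sup>2\<close> on \<open>R\<^sup>+\<close>, the factor \<open>\<lambda>\<close> of an element of \<open>GL\<^sup>+(S)\<close> being the \<open>n\<close>-th root of its
  determinant; the second one is induced by the Killing form. Rescaling one of the two summands by a constant does
  not change the geodesics.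
\<close>

definition metric :: "'a::euclidean_space set \<Rightarrow> 'a form \<Rightarrow> 'a form \<Rightarrow> 'a form \<Rightarrow> real" where
  "metric S g h k = (let X = generator S g h; Y = generator S g k in
     (trace_on S X / real (dim S)) * (trace_on S Y / real (dim S)) +
     killing_sl S (traceless_part S X) (traceless_part S Y))"

text \<open>The derivative in direction \<open>w\<close> of \<open>p \<mapsto> metric S p h k\<close>, for constant \<open>h\<close> and \<open>k\<close>.\<close>

definition metric_deriv ::
    "'a::euclidean_space set \<Rightarrow> 'a form \<Rightarrow> 'a form \<Rightarrow> 'a form \<Rightarrow> 'a form \<Rightarrow> real" where
  "metric_deriv S p w h k = deriv (\<lambda>e. metric S (\<lambda>x y. p x y + e * w x y) h k) 0"

section \<open>Geodesics\<close>

definition form_curve_deriv :: "(real \<Rightarrow> 'a form) \<Rightarrow> (real \<Rightarrow> 'a form) \<Rightarrow> bool" where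
  "form_curve_deriv c v \<longleftrightarrow> (\<forall>t\<in>{0..1}. \<forall>x y.
     ((\<lambda>\<tau>. c \<tau> x y) has_real_derivative v t x y) (at t within {0..1}))"

text \<open>
  \<open>c\<close> is a geodesic of \<open>M\<^bsub>r,s\<^esub>\<close> defined on \<open>[0,1]\<close>, with velocity \<open>v\<close>. As \<open>M\<^bsub>r,s\<^esub>\<close> is open in the
  vector space \<open>sym_forms S\<close>, the geodesic equation of the Levi-Civita connection can be
  written in the linear coordinates of this space; below it is paired with an arbitrary vector \<open>w\<close>
  (Christoffel symbols of the first kind):
  \<open>G(c'', w) + (D\<^bsub>c'\<^esub> G)(c', w) - 1/2 (D\<^bsub>w\<^esub> G)(c', c') = 0\<close>.
\<close>

definition geodesic_with_velocity ::
    "nat \<Rightarrow> nat \<Rightarrow> 'a::euclidean_space set \<Rightarrow> (real \<Rightarrow> 'a form) \<Rightarrow> (real \<Rightarrow> 'a form) \<Rightarrow> bool" where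
  "geodesic_with_velocity r s S c v \<longleftrightarrow>
     (\<forall>t\<in>{0..1}. c t \<in> inner_products r s S) \<and> form_curve_deriv c v \<and>
     (\<exists>a. form_curve_deriv v a \<and> (\<forall>t\<in>{0..1}. \<forall>w\<in>sym_forms S.
        metric S (c t) (a t) w + metric_deriv S (c t) (v t) (v t) w
          - 1/2 * metric_deriv S (c t) w (v t) (v t) = 0))"

definition geodesic_from_to ::
    "nat \<Rightarrow> nat \<Rightarrow> 'a::euclidean_space set \<Rightarrow> 'a form \<Rightarrow> 'a form \<Rightarrow> (real \<Rightarrow> 'a form) \<Rightarrow> bool" where
  "geodesic_from_to r s S g0 g c \<longleftrightarrow>
     (\<exists>v. geodesic_with_velocity r s S c v) \<and> c 0 = g0 \<and> c 1 = g"

definition geodesic_exists ::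
    "nat \<Rightarrow> nat \<Rightarrow> 'a::euclidean_space set \<Rightarrow> 'a form \<Rightarrow> 'a form \<Rightarrow> bool" where
  "geodesic_exists r s S g0 g \<longleftrightarrow> (\<exists>c. geodesic_from_to r s S g0 g c)"

text \<open>\<open>c\<close> is the only geodesic; curves are compared on their domain \<open>[0,1]\<close>.\<close>

definition is_unique_geodesic ::
    "nat \<Rightarrow> nat \<Rightarrow> 'a::euclidean_space set \<Rightarrow> 'a form \<Rightarrow> 'a form \<Rightarrow> (real \<Rightarrow> 'a form) \<Rightarrow> bool" where
  "is_unique_geodesic r s S g0 g c \<longleftrightarrow> geodesic_from_to r s S g0 g c \<and>
     (\<forall>c'. geodesic_from_to r s S g0 g c' \<longrightarrow> (\<forall>t\<in>{0..1}. c' t = c t))"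

definition exactly_one_geodesic ::
    "nat \<Rightarrow> nat \<Rightarrow> 'a::euclidean_space set \<Rightarrow> 'a form \<Rightarrow> 'a form \<Rightarrow> bool" where
  "exactly_one_geodesic r s S g0 g \<longleftrightarrow> (\<exists>c. is_unique_geodesic r s S g0 g c)"

section \<open>Splittings and product submanifolds\<close>

definition direct_sum :: "'a::euclidean_space set \<Rightarrow> 'a set \<Rightarrow> bool" where
  "direct_sum S T \<longleftrightarrow> subspace S \<and> subspace T \<and> S \<inter> T = {0} \<and> {x + y | x y. x \<in> S \<and> y \<in> T} = UNIV"

text \<open>
  For \<open>E = S \<oplus> T\<close>: the image in the space of forms on \<open>E\<close> of the product of the spaces of inner
  products of signature \<open>(r,s)\<close> on \<open>S\<close> and of signature \<open>(p,q)\<close> on \<open>T\<close>, under the orthogonal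
  direct sum.
\<close>

definition product_submanifold ::
    "nat \<Rightarrow> nat \<Rightarrow> 'a::euclidean_space set \<Rightarrow> nat \<Rightarrow> nat \<Rightarrow> 'a set \<Rightarrow> 'a form set" where
  "product_submanifold r s S p q T = {h \<in> sym_forms UNIV.
     (\<forall>x\<in>S. \<forall>y\<in>T. h x y = 0) \<and>
     restrict_form h S \<in> inner_products r s S \<and> restrict_form h T \<in> inner_products p q T}"

definition form_subspace :: "'a::euclidean_space set \<Rightarrow> 'a form set \<Rightarrow> bool" where
  "form_subspace S L \<longleftrightarrow> L \<subseteq> sym_forms S \<and> (\<lambda>x y. 0) \<in> L \<and>
     (\<forall>h\<in>L. \<forall>k\<in>L. \<forall>r. (\<lambda>x y. r * h x y + k x y) \<in> L)"

text \<open>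
  \<open>N\<close> is a totally geodesic submanifold of \<open>M\<^bsub>r,s\<^esub>\<close>: a geodesic which starts at a point of \<open>N\<close>, with
  velocity tangent to \<open>N\<close>, stays in \<open>N\<close>. Only submanifolds \<open>N\<close> that are open in a linear subspace
  \<open>L\<close> of the space of forms are considered here, and \<open>L\<close> is then the tangent space of \<open>N\<close> at each
  of its points. Openness refers to pointwise convergence of forms, that is, to the usual
  topology of the finite-dimensional space \<open>sym_forms S\<close>.
\<close>

definition totally_geodesic ::
    "nat \<Rightarrow> nat \<Rightarrow> 'a::euclidean_space set \<Rightarrow> 'a form set \<Rightarrow> bool" where
  "totally_geodesic r s S N \<longleftrightarrow> N \<subseteq> inner_products r s S \<and>
     (\<exists>L. form_subspace S L \<and> openin (top_of_set L) N \<and>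
       (\<forall>c v. geodesic_with_velocity r s S c v \<and> c 0 \<in> N \<and> v 0 \<in> L \<longrightarrow> (\<forall>t\<in>{0..1}. c t \<in> N)))"

text \<open>
  \<open>E = S \<oplus> T\<close> is orthogonal for \<open>g0\<close> and for \<open>g\<close>, and both have signature \<open>(r,s)\<close> on \<open>S\<close> and
  \<open>(p,q)\<close> on \<open>T\<close>.
\<close>

definition common_splitting ::
    "'a form \<Rightarrow> 'a form \<Rightarrow> nat \<Rightarrow> nat \<Rightarrow> 'a::euclidean_space set \<Rightarrow> nat \<Rightarrow> nat \<Rightarrow> 'a set \<Rightarrow> bool" where
  "common_splitting g0 g r s S p q T \<longleftrightarrow> direct_sum S T \<and>
     (\<forall>h\<in>{g0, g}. (\<forall>x\<in>S. \<forall>y\<in>T. h x y = 0) \<and>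
        restrict_form h S \<in> inner_products r s S \<and> restrict_form h T \<in> inner_products p q T)"

text \<open>\<open>B\<close> is the automorphism of \<open>S\<close> with \<open>g = g0(B _, _)\<close> on \<open>S\<close>.\<close>

definition related_by :: "'a form \<Rightarrow> 'a form \<Rightarrow> 'a::euclidean_space set \<Rightarrow> ('a \<Rightarrow> 'a) \<Rightarrow> bool" where
  "related_by g0 g S B \<longleftrightarrow> automorphism_on S B \<and> (\<forall>u\<in>S. \<forall>w\<in>S. g u w = g0 (B u) w)"

text \<open>\<open>B\<close> is of the form \<open>k(id + x)\<close> on \<open>S\<close> with \<open>k > 0\<close>, \<open>x\<^sup>3 = 0\<close> and \<open>x\<^sup>2 \<noteq> 0\<close>.\<close>

definition scaled_three_step_unipotent ::
    "'a::euclidean_space set \<Rightarrow> ('a \<Rightarrow> 'a) \<Rightarrow> real \<Rightarrow> ('a \<Rightarrow> 'a) \<Rightarrow> bool" where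
  "scaled_three_step_unipotent S B k x \<longleftrightarrow> k > 0 \<and> endomorphism_on S x \<and>
     (\<forall>u\<in>S. B u = k *\<^sub>R (u + x u)) \<and>
     (\<forall>u\<in>S. x (x (x u)) = 0) \<and> (\<exists>u\<in>S. x (x u) \<noteq> 0)"

end

theory Submission
  imports Defs "HOL-Computational_Algebra.Fundamental_Theorem_Algebra"
begin

text \<open>
  Write \<open>g = g\<^sub>0(A _, _)\<close>, where the endomorphism \<open>A\<close> is symmetric with respect to both forms. Everything
  is read off from the structure of \<open>A\<close>.

  \<^emph>\<open>Geodesics.\<close> At a point \<open>p\<close> of the space of inner products a tangent vector \<open>v\<close> is represented by the
  endomorphism \<open>V = p\<^sup>-\<^sup>1 v\<close>, and the metric is a combination of \<open>tr(V W)\<close> and \<open>tr V tr W\<close>. Its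
  derivatives are computed from the derivative of the inverse, and the geodesic equation becomes
  \<open>c'' = c' c\<^sup>-\<^sup>1 c'\<close>. This says that \<open>c\<^sup>-\<^sup>1 c'\<close> is constant, so the geodesics from \<open>g\<^sub>0\<close> are the curves
  \<open>g\<^sub>0(exp(t X) _, _)\<close> with symmetric \<open>X\<close> (\<open>geodesic_is_exponential\<close>, \<open>exponential_is_geodesic\<close>). The
  geodesics from \<open>g\<^sub>0\<close> to \<open>g\<close> therefore correspond to the symmetric logarithms of \<open>A\<close>. It also follows
  that a product submanifold is totally geodesic: a velocity tangent to it is represented by an
  endomorphism which preserves the two summands.

  \<^emph>\<open>Normal form.\<close> A Lorentzian form does not admit two independent orthogonal vectors which are both not
  spacelike. So the timelike direction lies in an invariant subspace \<open>S\<close> of one of four kinds: a line, a plane on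
  which \<open>A\<close> has nonreal eigenvalues, or a Jordan block of size two or three
  (\<open>lorentzian_normal_form\<close>). On the complement of \<open>S\<close> the form is definite and \<open>A\<close> is diagonalizable.
  A block of size three leads to the second alternative. In the other cases \<open>S\<close> is a plane, or is completed to a plane
  by a further eigenvector. That \<open>g\<close> is Lorentzian as well decides the signs of the eigenvalues; in particular \<open>A\<close>
  is positive on the complement, where it has a logarithm. So the question is decided on \<open>S\<close>, provided that
  uniqueness on \<open>S\<close> implies uniqueness on the whole space.

  \<^emph>\<open>Uniqueness.\<close> If \<open>A\<close> is a rotation on the plane \<open>S\<close>, possibly by the angle \<open>0\<close> or \<open>\<pi>\<close>, and possibly stretched, then there are
  several logarithms. In all other cases \<open>A\<close> has a nonspacelike eigenvector \<open>e\<close> whose line is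
  preserved by everything symmetric that commutes with \<open>A\<close>: either its eigenvalue is simple, or \<open>e\<close> spans the
  intersection of the kernel and the image of \<open>A - \<kappa>\<close>. Hence \<open>e\<close> is an eigenvector of every symmetric logarithm \<open>X\<close>. So
  there is none if the eigenvalue of \<open>e\<close> is negative. Moreover, \<open>X\<close> cannot have nonreal eigenvalues, since these would
  use up the timelike direction (\<open>span_chain_vectors\<close>), and a logarithm with real eigenvalues is
  determined by its exponential (\<open>real_logarithm_unique\<close>).
\<close>

section \<open>The algebra of endomorphisms\<close>

text \<open>
  The power series of the exponential function lives in a Banach algebra. The endomorphisms of the
  space are given a type of their own, because the type of bounded linear maps has separate
  parameters for domain and codomain and multiplication needs the two to agree.
\<close>

typedef (overloaded) 'a endo = "UNIV :: ('a::euclidean_space \<Rightarrow>\<^sub>L 'a) set"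
  morphisms blin_of Endo by simp

instantiation endo :: (euclidean_space) real_normed_algebra_1
begin
definition "0 = Endo 0"
definition "1 = Endo id_blinfun"
definition "F + G = Endo (blin_of F + blin_of G)"
definition "F - G = Endo (blin_of F - blin_of G)"
definition "- F = Endo (- blin_of F)"
definition "F * G = Endo (blin_of F o\<^sub>L blin_of G)"
definition "r *\<^sub>R F = Endo (r *\<^sub>R blin_of F)"
definition "norm F = norm (blin_of F)"
definition "sgn (F::'a endo) = inverse (norm F) *\<^sub>R F"
definition "dist (F::'a endo) G = norm (F - G)"
definition "uniformity = (INF e\<in>{0<..}. principal {(F::'a endo, G). dist F G < e})"
definition "open (U :: 'a endo set) \<longleftrightarrow> (\<forall>F\<in>U. \<forall>\<^sub>F (F', G) in uniformity. F' = F \<longrightarrow> G \<in> U)"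

lemmas endo_defs = zero_endo_def one_endo_def plus_endo_def minus_endo_def uminus_endo_def
  times_endo_def scaleR_endo_def norm_endo_def

instance
proof
  fix F G H :: "'a endo" and r s :: real
  note simps = endo_defs Endo_inverse blin_of_inject[symmetric] blinfun.bilinear_simps
  show "F + G + H = F + (G + H)" "F + G = G + F" "0 + F = F" "- F + F = 0" "F - G = F + - G"
    by (simp_all add: simps algebra_simps)
  show "r *\<^sub>R (F + G) = r *\<^sub>R F + r *\<^sub>R G" "(r + s) *\<^sub>R F = r *\<^sub>R F + s *\<^sub>R F"
    "r *\<^sub>R s *\<^sub>R F = (r * s) *\<^sub>R F" "1 *\<^sub>R F = F"
    by (simp_all add: simps algebra_simps)
  show "F * G * H = F * (G * H)" "1 * F = F" "F * 1 = F"
    by (simp_all add: simps blinfun_eqI)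
  show "(F + G) * H = F * H + G * H" "F * (G + H) = F * G + F * H"
    "r *\<^sub>R F * G = r *\<^sub>R (F * G)" "F * r *\<^sub>R G = r *\<^sub>R (F * G)"
    by (simp_all add: simps blinfun_eqI)
  show "(0::'a endo) \<noteq> 1"
  proof
    assume "(0::'a endo) = 1"
    then have "(0 :: 'a \<Rightarrow>\<^sub>L 'a) = id_blinfun" by (simp add: simps)
    then show False using norm_blinfun_id[where 'a='a] by simp
  qed
  show "sgn F = inverse (norm F) *\<^sub>R F" "dist F G = norm (F - G)"
    by (simp_all add: sgn_endo_def dist_endo_def)
  show "uniformity = (INF e\<in>{0<..}. principal {(F::'a endo, G). dist F G < e})"
    by (simp add: uniformity_endo_def)
  show "open U \<longleftrightarrow> (\<forall>F\<in>U. \<forall>\<^sub>F (F', G) in uniformity. F' = F \<longrightarrow> G \<in> U)"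
    for U :: "'a endo set"
    by (simp add: open_endo_def)
  show "(norm F = 0) = (F = 0)" "norm (F + G) \<le> norm F + norm G" "norm (r *\<^sub>R F) = \<bar>r\<bar> * norm F"
    "norm (1::'a endo) = 1" "norm (F * G) \<le> norm F * norm G"
    by (simp_all add: simps norm_triangle_ineq norm_blinfun_compose)
qed
end

instance endo :: (euclidean_space) banach
proof
  fix X :: "nat \<Rightarrow> 'a endo" assume "Cauchy X"
  then have "Cauchy (\<lambda>n. blin_of (X n))"
    unfolding Cauchy_def dist_norm by (simp add: endo_defs Endo_inverse)
  then obtain L where "(\<lambda>n. blin_of (X n)) \<longlonglongrightarrow> L"
    using Cauchy_convergent convergent_def by blast
  then have "X \<longlonglongrightarrow> Endo L"
    unfolding lim_sequentially dist_norm by (simp add: endo_defs Endo_inverse)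
  then show "convergent X" by (auto simp: convergent_def)
qed

definition ap :: "'a::euclidean_space endo \<Rightarrow> 'a \<Rightarrow> 'a" where
  "ap F = blinfun_apply (blin_of F)"

definition endo_of :: "('a::euclidean_space \<Rightarrow> 'a) \<Rightarrow> 'a endo" where
  "endo_of f = Endo (Blinfun f)"

lemma ap_endo_of [simp]: "linear f \<Longrightarrow> ap (endo_of f) = f"
  by (simp add: ap_def endo_of_def Endo_inverse bounded_linear_Blinfun_apply linear_conv_bounded_linear)

lemma ap_simps [simp]:
  "ap 0 x = 0" "ap 1 x = x" "ap (F + G) x = ap F x + ap G x" "ap (F - G) x = ap F x - ap G x"
  "ap (- F) x = - ap F x" "ap (F * G) x = ap F (ap G x)" "ap (r *\<^sub>R F) x = r *\<^sub>R ap F x"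
  by (simp_all add: ap_def endo_defs Endo_inverse blinfun.bilinear_simps)

lemma endo_eqI: "(\<And>x. ap F x = ap G x) \<Longrightarrow> F = G"
  by (metis ap_def blin_of_inject blinfun_eqI)

lemma norm_ap: "norm (ap F x) \<le> norm F * norm x"
  by (simp add: ap_def norm_endo_def norm_blinfun)

lemma bounded_bilinear_ap: "bounded_bilinear ap"
proof
  show "\<exists>K. \<forall>F x. norm (ap F x :: 'a) \<le> norm F * norm x * K"
    by (rule exI[of _ 1]) (simp add: norm_ap)
qed (simp_all add: ap_def blinfun.bilinear_simps endo_defs Endo_inverse)

lemma linear_ap [simp]: "linear (ap F)"
  using bounded_bilinear.bounded_linear_right[OF bounded_bilinear_ap] by (rule bounded_linear.linear)

lemmas ap_linear_simps [simp] =
  linear_0[OF linear_ap] linear_add[OF linear_ap] linear_diff[OF linear_ap] linear_neg[OF linear_ap]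
  linear_cmul[OF linear_ap] linear_sum[OF linear_ap]

lemma ap_sum: "ap (\<Sum>i\<in>I. F i) x = (\<Sum>i\<in>I. ap (F i) x)"
  by (induction I rule: infinite_finite_induct) auto

lemma has_vector_derivative_ap:
  assumes "(F has_vector_derivative F') (at t within T)" "(w has_vector_derivative w') (at t within T)"
  shows "((\<lambda>t. ap (F t) (w t)) has_vector_derivative (ap (F t) w' + ap F' (w t))) (at t within T)"
  using bounded_bilinear.has_vector_derivative[OF bounded_bilinear_ap assms] .

text \<open>
  The algebra of endomorphisms is spanned by the finitely many matrix units, which bounds a linear
  function on it by its values there.
\<close>

lemma linear_endo_bounded:
  fixes f :: "'a::euclidean_space endo \<Rightarrow> 'b::real_normed_vector"
  assumes "linear f" shows "bounded_linear f"
proof -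
  define E where "E i j = endo_of (\<lambda>x::'a. (x \<bullet> i) *\<^sub>R j)" for i j
  have E: "ap (E i j) x = (x \<bullet> i) *\<^sub>R j" for i j x
    unfolding E_def by (subst ap_endo_of) (auto intro!: linearI simp: algebra_simps)
  have dec: "F = (\<Sum>i\<in>Basis. \<Sum>j\<in>Basis. (ap F i \<bullet> j) *\<^sub>R E i j)" for F
  proof (rule endo_eqI)
    fix x :: 'a
    have "ap F x = ap F (\<Sum>i\<in>Basis. (x \<bullet> i) *\<^sub>R i)" by (simp add: euclidean_representation)
    also have "\<dots> = (\<Sum>i\<in>Basis. (x \<bullet> i) *\<^sub>R ap F i)"
      by (simp only: ap_linear_simps)
    also have "\<dots> = (\<Sum>i\<in>Basis. (x \<bullet> i) *\<^sub>R (\<Sum>j\<in>Basis. (ap F i \<bullet> j) *\<^sub>R j))"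
      by (simp only: euclidean_representation)
    finally show "ap F x = ap (\<Sum>i\<in>Basis. \<Sum>j\<in>Basis. (ap F i \<bullet> j) *\<^sub>R E i j) x"
      by (simp add: ap_sum E scaleR_sum_right mult.commute)
  qed
  define K where "K = (\<Sum>i\<in>Basis. \<Sum>j\<in>Basis. norm (f (E i j)))"
  show ?thesis
  proof (rule bounded_linear_intro[where K = K])
    show "f (F + G) = f F + f G" "f (r *\<^sub>R F) = r *\<^sub>R f F" for F G r
      using assms by (simp_all add: linear_add linear_cmul)
    fix F
    have "norm (f F) = norm (\<Sum>i\<in>Basis. \<Sum>j\<in>Basis. (ap F i \<bullet> j) *\<^sub>R f (E i j))"
      by (subst dec) (simp add: linear_sum[OF assms] linear_cmul[OF assms])
    also have "\<dots> \<le> (\<Sum>i\<in>Basis. \<Sum>j\<in>Basis. norm F * norm (f (E i j)))"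
    proof (intro sum_norm_le)
      fix i j :: 'a assume ij: "i \<in> Basis" "j \<in> Basis"
      have "\<bar>ap F i \<bullet> j\<bar> \<le> norm (ap F i) * norm j" by (rule Cauchy_Schwarz_ineq2)
      also have "\<dots> \<le> norm F" using norm_ap[of F i] ij by simp
      finally show "norm ((ap F i \<bullet> j) *\<^sub>R f (E i j)) \<le> norm F * norm (f (E i j))"
        by (simp add: mult_right_mono)
    qed
    finally show "norm (f F) \<le> norm F * K" by (simp add: K_def sum_distrib_left)
  qed
qed

section \<open>Exponentials of endomorphisms\<close>

definition preserves :: "'a::euclidean_space endo \<Rightarrow> 'a set \<Rightarrow> bool" where
  "preserves F S \<longleftrightarrow> (\<forall>x\<in>S. ap F x \<in> S)"

lemma exp_ap_sums: "(\<lambda>n. (1 / fact n) *\<^sub>R ap (X ^ n) v) sums ap (exp X) v"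
proof -
  have "(\<lambda>n. X ^ n /\<^sub>R fact n) sums exp X" by (rule exp_converges)
  then have "(\<lambda>n. ap (X ^ n /\<^sub>R fact n) v) sums ap (exp X) v"
    by (rule bounded_linear.sums[OF bounded_bilinear.bounded_linear_left[OF bounded_bilinear_ap]])
  then show ?thesis by (simp add: inverse_eq_divide)
qed

lemma preserves_power: "preserves X S \<Longrightarrow> preserves (X ^ n) S"
  by (induction n) (auto simp: preserves_def)

lemma preserves_scaleR: "subspace S \<Longrightarrow> preserves X S \<Longrightarrow> preserves (r *\<^sub>R X) S"
  by (auto simp: preserves_def subspace_scale)

text \<open>
  The partial sums of the exponential series stay in \<open>S\<close>, and a subspace is closed.
\<close>

lemma preserves_exp:
  assumes "subspace S" "preserves X S" shows "preserves (exp X) S"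
  unfolding preserves_def
proof
  fix v assume v: "v \<in> S"
  have "(\<lambda>m. \<Sum>n<m. (1 / fact n) *\<^sub>R ap (X ^ n) v) \<longlonglongrightarrow> ap (exp X) v"
    using exp_ap_sums[of X v] by (simp add: sums_def)
  moreover have "closed S" using assms(1) by (rule closed_subspace)
  moreover have "(\<Sum>n<m. (1 / fact n) *\<^sub>R ap (X ^ n) v) \<in> S" for m
    using v assms preserves_power[OF assms(2)]
    by (intro subspace_sum subspace_scale) (auto simp: preserves_def)
  ultimately show "ap (exp X) v \<in> S"
    using closed_sequentially[of S "\<lambda>m. \<Sum>n<m. (1 / fact n) *\<^sub>R ap (X ^ n) v"] by blast
qed

lemma exp_ap_cong:
  assumes "preserves Y V" "\<And>x. x \<in> V \<Longrightarrow> ap X x = ap Y x" "v \<in> V"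
  shows "ap (exp X) v = ap (exp Y) v"
proof -
  have "ap (X ^ n) v = ap (Y ^ n) v" for n
  proof (induction n)
    case (Suc n)
    then show ?case
      using assms(2,3) preserves_power[OF assms(1), of n] by (simp add: preserves_def)
  qed simp
  then show ?thesis
    using exp_ap_sums[of X v] exp_ap_sums[of Y v] by (auto intro: sums_unique2)
qed

lemma exp_inverse_ap: "ap (exp X) (ap (exp (- X)) v) = v" "ap (exp (- X)) (ap (exp X) v) = v"
proof -
  have "exp X * exp (- X) = 1" "exp (- X) * exp X = 1"
    using exp_add_commuting[of X "- X"] exp_add_commuting[of "- X" X] by simp_all
  then show "ap (exp X) (ap (exp (- X)) v) = v" "ap (exp (- X)) (ap (exp X) v) = v"
    by (metis ap_simps(2,6))+
qed

lemma exp_commute_ap: "ap (exp X) (ap X v) = ap X (ap (exp X) v)"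
  using exp_times_scaleR_commute[of 1 X] by (metis ap_simps(6) scaleR_one)

text \<open>
  The curve \<open>exp (- t X) (w t)\<close> has derivative \<open>0\<close>. With this, an exponential is computed by
  checking that a guessed curve solves a linear differential equation.
\<close>

lemma flow_unique:
  assumes "\<And>t. (w has_vector_derivative ap X (w t)) (at t)"
  shows "w t = ap (exp (t *\<^sub>R X)) (w 0)"
proof -
  define h where "h t = ap (exp (t *\<^sub>R (- X))) (w t)" for t
  have "(h has_vector_derivative 0) (at t within UNIV)" for t
    unfolding h_def
    using has_vector_derivative_ap[OF exp_scaleR_has_vector_derivative_right[of "-X" t UNIV] assms[of t]]
    by simp
  then obtain c where "\<And>t. h t = c"
    using has_vector_derivative_zero_constant[of UNIV h] by auto
  then have "h t = h 0" by simp
  then have "ap (exp (- (t *\<^sub>R X))) (w t) = w 0" by (simp add: h_def)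
  then show ?thesis using exp_inverse_ap(1)[of "t *\<^sub>R X" "w t"] by simp
qed

lemma exp_on_jordan_chain:
  assumes N: "\<And>y. ap X y = \<mu> *\<^sub>R y + ap N y" and "ap N (ap N (ap N v)) = 0"
  shows "ap (exp (t *\<^sub>R X)) v
    = exp (t * \<mu>) *\<^sub>R (v + t *\<^sub>R ap N v + (t\<^sup>2 / 2) *\<^sub>R ap N (ap N v))"
proof -
  define w where "w t = exp (t * \<mu>) *\<^sub>R (v + t *\<^sub>R ap N v + (t\<^sup>2 / 2) *\<^sub>R ap N (ap N v))" for t
  have "(w has_vector_derivative ap X (w t)) (at t)" for t
    unfolding w_def
    by (auto intro!: derivative_eq_intros simp: N assms(2) scaleR_add_right scaleR_add_left mult_ac)
      (simp add: field_simps flip: scaleR_add_left)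
  from flow_unique[of w X t, OF this] show ?thesis by (simp add: w_def)
qed

text \<open>
  On the plane of \<open>v\<close> and \<open>u\<close>, the endomorphism acts as multiplication by the complex number
  \<open>\<alpha> + i \<beta>\<close>, with \<open>u\<close> in the role of \<open>i v\<close>.
\<close>

lemma exp_on_rotation:
  assumes X: "ap X v = \<alpha> *\<^sub>R v + \<beta> *\<^sub>R u" "ap X u = \<alpha> *\<^sub>R u - \<beta> *\<^sub>R v"
  shows "ap (exp (t *\<^sub>R X)) v = exp (t * \<alpha>) *\<^sub>R (cos (t * \<beta>) *\<^sub>R v + sin (t * \<beta>) *\<^sub>R u)"
proof -
  define w where "w t = exp (t * \<alpha>) *\<^sub>R (cos (t * \<beta>) *\<^sub>R v + sin (t * \<beta>) *\<^sub>R u)" for t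
  have "(w has_vector_derivative ap X (w t)) (at t)" for t
    unfolding w_def
    by (auto intro!: derivative_eq_intros simp: X algebra_simps)
  from flow_unique[of w X t, OF this] show ?thesis by (simp add: w_def)
qed

lemma exp_on_eigenvector:
  assumes "ap X v = \<mu> *\<^sub>R v" shows "ap (exp (t *\<^sub>R X)) v = exp (t * \<mu>) *\<^sub>R v"
proof -
  have "ap (exp (t *\<^sub>R X)) v = exp (t * \<mu>) *\<^sub>R (cos (t * 0) *\<^sub>R v + sin (t * 0) *\<^sub>R 0)"
    by (rule exp_on_rotation) (simp_all add: assms)
  then show ?thesis by simp
qed

section \<open>Symmetric forms and orthonormal bases\<close>

text \<open>
  A form on a subspace is always handled as the restriction of a form on the whole space. The
  linear algebra below can then be done with total functions, relative to a subspace.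
\<close>

locale symmetric_form =
  fixes q :: "'a::euclidean_space form"
  assumes form: "q \<in> sym_forms UNIV"
begin

lemma sym: "q x y = q y x" and add_left [simp]: "q (x + y) z = q x z + q y z"
  and scale_left [simp]: "q (r *\<^sub>R x) y = r * q x y"
  using form by (auto simp: sym_forms_def)

lemma add_right [simp]: "q z (x + y) = q z x + q z y"
  and scale_right [simp]: "q y (r *\<^sub>R x) = r * q y x"
  by (metis add_left sym) (metis scale_left sym)

lemma zero_left [simp]: "q 0 y = 0" and zero_right [simp]: "q y 0 = 0"
  using scale_left[of 0 0 y] scale_right[of y 0 0] by simp_all

lemma minus_left [simp]: "q (- x) y = - q x y" and minus_right [simp]: "q y (- x) = - q y x"
  using scale_left[of "-1" x y] scale_right[of y "-1" x] by simp_all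

lemma diff_left [simp]: "q (x - y) z = q x z - q y z" and diff_right [simp]: "q z (x - y) = q z x - q z y"
  using add_left[of x "- y" z] add_right[of z x "- y"] by simp_all

lemma sum_left: "q (\<Sum>i\<in>I. f i) y = (\<Sum>i\<in>I. q (f i) y)"
  by (induction I rule: infinite_finite_induct) auto

lemma sum_right: "q y (\<Sum>i\<in>I. f i) = (\<Sum>i\<in>I. q y (f i))"
  by (induction I rule: infinite_finite_induct) auto

lemma linear_right: "linear (q y)" and linear_left: "linear (\<lambda>x. q x y)"
  by (auto intro!: linearI)

lemma form_span_zero:
  assumes "\<And>b. b \<in> B \<Longrightarrow> q y b = 0" "x \<in> span B" shows "q y x = 0"
  using linear_eq_0_on_span[OF linear_right assms(1) assms(2)] .

lemma orthogonal_independent: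
  assumes orth: "\<And>x y. x \<in> B \<Longrightarrow> y \<in> B \<Longrightarrow> x \<noteq> y \<Longrightarrow> q x y = 0" and "\<And>x. x \<in> B \<Longrightarrow> q x x \<noteq> 0"
  shows "independent B"
proof
  assume "dependent B"
  then obtain a where a: "a \<in> B" "a \<in> span (B - {a})" by (auto simp: dependent_def)
  then have "q a a = 0" using form_span_zero[of "B - {a}" a a] orth by auto
  with assms(2) a show False by blast
qed

lemma subspace_orthogonal: "subspace V \<Longrightarrow> subspace {x\<in>V. q v x = 0}"
  by (auto simp: subspace_def)

lemma restrict_form_in_sym_forms: "subspace S \<Longrightarrow> restrict_form q S \<in> sym_forms S"
  by (auto simp: sym_forms_def restrict_form_def sym subspace_add subspace_scale)

definition orthonormal_basis :: "'a set \<Rightarrow> 'a set \<Rightarrow> 'a set \<Rightarrow> bool" where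
  "orthonormal_basis P N S \<longleftrightarrow> P \<inter> N = {} \<and> finite (P \<union> N) \<and> span (P \<union> N) = S \<and>
     (\<forall>x\<in>P. q x x = 1) \<and> (\<forall>x\<in>N. q x x = -1) \<and>
     (\<forall>x\<in>P \<union> N. \<forall>y\<in>P \<union> N. x \<noteq> y \<longrightarrow> q x y = 0)"

lemma orthonormal_basis_independent:
  assumes "orthonormal_basis P N S" shows "independent (P \<union> N)"
  using assms by (intro orthogonal_independent) (auto simp: orthonormal_basis_def)

lemma orthonormal_basis_subset: "orthonormal_basis P N S \<Longrightarrow> P \<union> N \<subseteq> S"
  using span_superset[of "P \<union> N"] by (simp add: orthonormal_basis_def)

lemma inner_products_iff:
  assumes "subspace S"
  shows "restrict_form q S \<in> inner_products r s S \<longleftrightarrow>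
    (\<exists>P N. orthonormal_basis P N S \<and> card P = r \<and> card N = s)" (is "?L \<longleftrightarrow> ?R")
proof
  assume ?L
  then obtain P N where B: "P \<inter> N = {}" "independent (P \<union> N)" "span (P \<union> N) = S" "card P = r" "card N = s"
    "\<forall>x\<in>P. restrict_form q S x x = 1" "\<forall>x\<in>N. restrict_form q S x x = -1"
    "\<forall>x\<in>P \<union> N. \<forall>y\<in>P \<union> N. x \<noteq> y \<longrightarrow> restrict_form q S x y = 0"
    unfolding inner_products_def by blast
  have "P \<union> N \<subseteq> S" using B(3) span_superset by blast
  then have "\<forall>x\<in>P \<union> N. \<forall>y\<in>P \<union> N. restrict_form q S x y = q x y"
    by (auto simp: restrict_form_def)
  with B have "orthonormal_basis P N S"
    unfolding orthonormal_basis_def using independent_imp_finite[OF B(2)] by simp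
  with B show ?R by blast
next
  assume ?R
  then obtain P N where B: "orthonormal_basis P N S" "card P = r" "card N = s" by blast
  have "P \<union> N \<subseteq> S" using orthonormal_basis_subset[OF B(1)] .
  then have "\<forall>x\<in>P \<union> N. \<forall>y\<in>P \<union> N. restrict_form q S x y = q x y"
    by (auto simp: restrict_form_def)
  then show ?L
    unfolding inner_products_def
    using B orthonormal_basis_independent[OF B(1)] restrict_form_in_sym_forms[OF assms]
    by (intro CollectI conjI exI[of _ P] exI[of _ N]) (auto simp: orthonormal_basis_def)
qed

lemma orthonormal_expansion:
  assumes "orthonormal_basis P N S" "v \<in> S"
  shows "v = (\<Sum>b\<in>P \<union> N. (q b b * q v b) *\<^sub>R b)"
    and "q v w = (\<Sum>b\<in>P \<union> N. q b b * q v b * q w b)"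
proof -
  have fin: "finite (P \<union> N)" and v: "v \<in> span (P \<union> N)"
    and orth: "\<And>x y. x \<in> P \<union> N \<Longrightarrow> y \<in> P \<union> N \<Longrightarrow> x \<noteq> y \<Longrightarrow> q x y = 0"
    and unit: "\<And>x. x \<in> P \<union> N \<Longrightarrow> q x x * q x x = 1"
    using assms by (auto simp: orthonormal_basis_def)
  obtain c where c: "v = (\<Sum>b\<in>P \<union> N. c b *\<^sub>R b)"
    using v fin by (auto simp: span_finite)
  have "q v b = c b * q b b" if b: "b \<in> P \<union> N" for b
  proof -
    have "q v b = (\<Sum>a\<in>P \<union> N. c a * q a b)" by (simp add: c sum_left)
    also have "\<dots> = (\<Sum>a\<in>P \<union> N. if a = b then c b * q b b else 0)"
      using orth b by (intro sum.cong) auto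
    finally show ?thesis using fin b by simp
  qed
  then have "q b b * q v b = c b" if "b \<in> P \<union> N" for b
    using unit[OF that] that by (simp add: mult_ac)
  then show *: "v = (\<Sum>b\<in>P \<union> N. (q b b * q v b) *\<^sub>R b)"
    by (subst c) (auto intro!: sum.cong)
  have "q v w = q (\<Sum>b\<in>P \<union> N. (q b b * q v b) *\<^sub>R b) w" using * by simp
  then show "q v w = (\<Sum>b\<in>P \<union> N. q b b * q v b * q w b)"
    by (simp add: sum_left sum_right sym)
qed

lemma nondegenerate_of_basis:
  assumes "orthonormal_basis P N S" "v \<in> S" "\<And>w. w \<in> S \<Longrightarrow> q v w = 0"
  shows "v = 0"
proof -
  have "P \<union> N \<subseteq> S" using orthonormal_basis_subset[OF assms(1)] .
  then have "(\<Sum>b\<in>P \<union> N. (q b b * q v b) *\<^sub>R b) = 0" using assms(3) by (intro sum.neutral) auto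
  then show ?thesis using orthonormal_expansion(1)[OF assms(1,2)] by simp
qed

lemma inner_products_orthogonal_sum:
  assumes "subspace S" "subspace T" "subspace V"
    and "\<And>x y. x \<in> S \<Longrightarrow> y \<in> T \<Longrightarrow> q x y = 0" and "V = {x + y |x y. x \<in> S \<and> y \<in> T}"
    and "restrict_form q S \<in> inner_products r s S" "restrict_form q T \<in> inner_products r' s' T"
  shows "restrict_form q V \<in> inner_products (r + r') (s + s') V"
proof -
  obtain P N where B: "orthonormal_basis P N S" "card P = r" "card N = s"
    using inner_products_iff[OF assms(1)] assms(6) by blast
  obtain P' N' where B': "orthonormal_basis P' N' T" "card P' = r'" "card N' = s'"
    using inner_products_iff[OF assms(2)] assms(7) by blast
  have sub: "P \<union> N \<subseteq> S" "P' \<union> N' \<subseteq> T"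
    using orthonormal_basis_subset[OF B(1)] orthonormal_basis_subset[OF B'(1)] .
  have fin: "finite P" "finite N" "finite P'" "finite N'"
    using B B' by (auto simp: orthonormal_basis_def)
  have cross: "q x y = 0" if "x \<in> P \<union> N" "y \<in> P' \<union> N'" for x y
    using that sub assms(4) by blast
  have self: "q x x \<noteq> 0" if "x \<in> P \<union> N \<union> (P' \<union> N')" for x
    using that B B' by (auto simp: orthonormal_basis_def)
  have disj: "(P \<union> N) \<inter> (P' \<union> N') = {}" using cross self by blast
  have "span (P \<union> P' \<union> (N \<union> N')) = span ((P \<union> N) \<union> (P' \<union> N'))"
    by (rule arg_cong[where f = span]) blast
  also have "\<dots> = V"
    using B(1) B'(1) unfolding assms(5) orthonormal_basis_def
    by (simp only: span_Un[of "P \<union> N" "P' \<union> N'"])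
  finally have "orthonormal_basis (P \<union> P') (N \<union> N') V"
    unfolding orthonormal_basis_def
  proof (intro conjI)
    have "q x y = 0" if "x \<in> P \<union> N" "y \<in> P \<union> N" "x \<noteq> y" for x y
      using B that by (auto simp: orthonormal_basis_def)
    moreover have "q x y = 0" if "x \<in> P' \<union> N'" "y \<in> P' \<union> N'" "x \<noteq> y" for x y
      using B' that by (auto simp: orthonormal_basis_def)
    moreover have "q y x = 0" if "x \<in> P \<union> N" "y \<in> P' \<union> N'" for x y
      using cross[OF that] sym by simp
    moreover note cross
    ultimately show "\<forall>x\<in>P \<union> P' \<union> (N \<union> N'). \<forall>y\<in>P \<union> P' \<union> (N \<union> N'). x \<noteq> y \<longrightarrow> q x y = 0"
      by blast
  qed (use B B' disj in \<open>auto simp: orthonormal_basis_def\<close>)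
  moreover have "P \<inter> P' = {}" "N \<inter> N' = {}" using disj by auto
  then have "card (P \<union> P') = r + r'" "card (N \<union> N') = s + s'"
    using B B' fin by (auto simp: card_Un_disjoint)
  ultimately show ?thesis using inner_products_iff[OF assms(3)] by blast
qed

text \<open>
  An isometry carries an orthonormal basis to an orthonormal basis.
\<close>

lemma inner_products_pullback:
  assumes S: "subspace S" and F: "preserves F S" and G: "preserves G S"
    and inv: "\<And>x. x \<in> S \<Longrightarrow> ap F (ap G x) = x" "\<And>x. x \<in> S \<Longrightarrow> ap G (ap F x) = x"
    and q: "restrict_form q S \<in> inner_products r s S"
  shows "restrict_form (\<lambda>x y. q (ap F x) (ap F y)) S \<in> inner_products r s S"
proof -
  interpret p: symmetric_form "\<lambda>x y. q (ap F x) (ap F y)"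
    by unfold_locales (auto simp: sym_forms_def sym)
  obtain P N where B: "orthonormal_basis P N S" "card P = r" "card N = s"
    using inner_products_iff[OF S] q by blast
  have sub: "P \<union> N \<subseteq> S" using orthonormal_basis_subset[OF B(1)] .
  then have inv': "\<And>x. x \<in> P \<union> N \<Longrightarrow> ap F (ap G x) = x" using inv by blast
  have inj: "inj_on (ap G) (P \<union> N)" by (rule inj_on_inverseI[of _ "ap F"]) (rule inv')
  have "ap G ` span (P \<union> N) = S"
  proof -
    have "ap G ` S = S"
    proof
      show "ap G ` S \<subseteq> S" using G by (auto simp: preserves_def)
      show "S \<subseteq> ap G ` S" using inv F by (metis image_eqI preserves_def subsetI)
    qed
    then show ?thesis using B by (simp add: orthonormal_basis_def)
  qed
  then have sp: "span (ap G ` P \<union> ap G ` N) = S"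
    using linear_span_image[OF linear_ap, of G "P \<union> N"] by (simp add: image_Un)
  have "p.orthonormal_basis (ap G ` P) (ap G ` N) S"
    unfolding p.orthonormal_basis_def
  proof (intro conjI)
    show "ap G ` P \<inter> ap G ` N = {}"
      using inj B unfolding orthonormal_basis_def by (metis image_empty inj_on_image_Int Un_upper1 Un_upper2)
    have "q x y = 0" if "x \<in> P \<union> N" "y \<in> P \<union> N" "x \<noteq> y" for x y
      using B that by (auto simp: orthonormal_basis_def)
    then show "\<forall>x\<in>ap G ` P \<union> ap G ` N. \<forall>y\<in>ap G ` P \<union> ap G ` N.
        x \<noteq> y \<longrightarrow> q (ap F x) (ap F y) = 0"
      unfolding image_Un[symmetric] by (metis (no_types, lifting) imageE inv')
  qed (use B sp inv' in \<open>auto simp: orthonormal_basis_def\<close>)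
  moreover have "card (ap G ` P) = r" "card (ap G ` N) = s"
    using B inj by (auto simp: card_image inj_on_Un)
  ultimately show ?thesis using p.inner_products_iff[OF S] by blast
qed

section \<open>Definite and Lorentzian subspaces\<close>

definition posdef :: "'a set \<Rightarrow> bool" where
  "posdef V \<longleftrightarrow> (\<forall>v\<in>V. v \<noteq> 0 \<longrightarrow> q v v > 0)"

text \<open>
  This is signature \<open>(m - 1, 1)\<close>, expressed by a single negative direction \<open>e\<close> instead of an
  orthonormal basis. The choice of \<open>e\<close> is immaterial, by \<open>posdef_timelike_complement\<close> below.
\<close>

definition lorentzian :: "'a set \<Rightarrow> bool" where
  "lorentzian V \<longleftrightarrow> (\<exists>e\<in>V. q e e < 0 \<and> posdef {v\<in>V. q e v = 0})"

lemma posdef_nonneg: "posdef V \<Longrightarrow> v \<in> V \<Longrightarrow> q v v \<ge> 0"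
  by (cases "v = 0") (auto simp: posdef_def less_imp_le)

text \<open>
  This is the feature of Lorentzian signature on which the whole proof rests. A suitable combination
  \<open>z\<close> of \<open>u\<close> and \<open>w\<close> is orthogonal to the timelike vector \<open>e\<close>, so it is spacelike unless it vanishes;
  but as a combination of orthogonal nonspacelike vectors it cannot be spacelike.
\<close>

lemma nonspacelike_orthogonal_dependent:
  assumes V: "subspace V" "lorentzian V" and uw: "u \<in> V" "w \<in> V" "q u u \<le> 0" "q w w \<le> 0" "q u w = 0"
    and "u \<noteq> 0"
  obtains c where "w = c *\<^sub>R u"
proof -
  obtain e where e: "e \<in> V" "q e e < 0" and pos: "posdef {v\<in>V. q e v = 0}"
    using V(2) by (auto simp: lorentzian_def)
  have ne: "q e u \<noteq> 0" using pos uw \<open>u \<noteq> 0\<close> by (force simp: posdef_def)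
  define z where "z = w - (q e w / q e u) *\<^sub>R u"
  have "z \<in> V" using V(1) uw by (auto simp: z_def subspace_diff subspace_scale)
  moreover have "q e z = 0" using ne by (simp add: z_def)
  moreover have "q z z = q w w + (q e w / q e u)\<^sup>2 * q u u"
    using uw(5) by (simp add: z_def sym[of w u] power2_eq_square)
  then have "q z z \<le> 0" using uw(3,4) by (simp add: add_nonpos_nonpos mult_nonneg_nonpos)
  ultimately have "z = 0" using pos by (force simp: posdef_def)
  then show ?thesis using that by (simp add: z_def)
qed

lemma posdef_timelike_complement:
  assumes "subspace V" "lorentzian V" "u \<in> V" "q u u < 0"
  shows "posdef {v\<in>V. q u v = 0}"
  unfolding posdef_def
proof (intro ballI impI)
  fix v assume v: "v \<in> {v\<in>V. q u v = 0}" "v \<noteq> 0"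
  show "q v v > 0"
  proof (rule ccontr)
    assume "\<not> q v v > 0"
    moreover have "u \<noteq> 0" using assms(4) by auto
    ultimately obtain c where "v = c *\<^sub>R u"
      using nonspacelike_orthogonal_dependent[OF assms(1,2,3), of v] assms(4) v
      by (auto simp: not_less)
    then show False using v assms(4) by auto
  qed
qed

lemma lorentzian_subspace:
  assumes "subspace V" "lorentzian V" "S \<subseteq> V" "u \<in> S" "q u u < 0"
  shows "lorentzian S"
  using posdef_timelike_complement[OF assms(1,2), of u] assms(3-5)
  by (auto simp: lorentzian_def posdef_def)

lemma lorentzian_nondegenerate:
  assumes "lorentzian V" "v \<in> V" "\<And>w. w \<in> V \<Longrightarrow> q v w = 0" shows "v = 0"
  using assms by (force simp: lorentzian_def posdef_def sym)

lemma split_along: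
  assumes "subspace V" "e \<in> V" "q e e \<noteq> 0"
  shows "V = {x + y |x y. x \<in> span {e} \<and> y \<in> {v\<in>V. q e v = 0}}" (is "V = ?W")
proof
  show "?W \<subseteq> V" using assms by (auto simp: span_singleton subspace_add subspace_scale)
  show "V \<subseteq> ?W"
  proof
    fix v assume "v \<in> V"
    then have "v - (q e v / q e e) *\<^sub>R e \<in> {v\<in>V. q e v = 0}"
      using assms by (auto simp: subspace_diff subspace_scale)
    moreover have "v = (q e v / q e e) *\<^sub>R e + (v - (q e v / q e e) *\<^sub>R e)" by simp
    moreover have "(q e v / q e e) *\<^sub>R e \<in> span {e}" by (auto simp: span_singleton)
    ultimately show "v \<in> ?W" by blast
  qed
qed

lemma inner_products_line:
  assumes "q e e > 0" shows "restrict_form q (span {e}) \<in> inner_products 1 0 (span {e})"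
proof -
  define u where "u = (1 / sqrt (q e e)) *\<^sub>R e"
  have "q u u = 1" using assms by (simp add: u_def real_sqrt_mult_self)
  moreover have "span {u} = span {e}"
  proof (intro subset_antisym span_minimal subspace_span)
    show "{u} \<subseteq> span {e}" by (simp add: u_def span_scale span_base)
    have "sqrt (q e e) *\<^sub>R u \<in> span {u}" by (simp add: span_scale span_base)
    then show "{e} \<subseteq> span {u}" using assms by (simp add: u_def)
  qed
  ultimately have "orthonormal_basis {u} {} (span {e})" by (auto simp: orthonormal_basis_def)
  then show ?thesis using inner_products_iff[OF subspace_span] by fastforce
qed

end

section \<open>Invariant lines and planes\<close>

definition poly_endo :: "'a::euclidean_space endo \<Rightarrow> real poly \<Rightarrow> 'a endo" where
  "poly_endo X p = fold_coeffs (\<lambda>a F. a *\<^sub>R 1 + X * F) p 0"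

lemma poly_endo_0 [simp]: "poly_endo X 0 = 0"
  by (simp add: poly_endo_def)

lemma poly_endo_pCons [simp]: "poly_endo X (pCons a p) = a *\<^sub>R 1 + X * poly_endo X p"
  by (cases "p = 0 \<and> a = 0") (auto simp: poly_endo_def)

lemma poly_endo_add: "poly_endo X (p + r) = poly_endo X p + poly_endo X r"
proof (induction p arbitrary: r)
  case (pCons a p)
  show ?case
    by (cases r) (simp add: pCons.IH distrib_left scaleR_add_left)
qed simp

lemma poly_endo_smult: "poly_endo X (smult c p) = c *\<^sub>R poly_endo X p"
  by (induction p) (auto simp: algebra_simps)

lemma poly_endo_mult: "poly_endo X (p * r) = poly_endo X p * poly_endo X r"
  by (induction p) (auto simp: poly_endo_add poly_endo_smult distrib_right mult.assoc)

lemma poly_endo_sum: "poly_endo X (\<Sum>i\<in>I. p i) = (\<Sum>i\<in>I. poly_endo X (p i))"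
  by (induction I rule: infinite_finite_induct) (auto simp: poly_endo_add)

lemma poly_endo_monom: "poly_endo X (monom c i) = c *\<^sub>R X ^ i"
  by (induction i) (auto simp: monom_0 monom_Suc)

lemma preserves_poly_endo: "subspace W \<Longrightarrow> preserves X W \<Longrightarrow> preserves (poly_endo X p) W"
  by (induction p) (auto simp: preserves_def subspace_0 subspace_add subspace_scale)

text \<open>
  The vectors \<open>v, X v, ..., X\<^sup>n v\<close>, with \<open>n\<close> the dimension of the space, are too many to be
  independent.
\<close>

lemma annihilating_poly:
  fixes v :: "'a::euclidean_space"
  obtains p where "p \<noteq> 0" "ap (poly_endo X p) v = 0"
proof (rule ccontr)
  assume "\<not> thesis"
  with that have nz: "\<And>p. p \<noteq> 0 \<Longrightarrow> ap (poly_endo X p) v \<noteq> 0" by blast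
  define f where "f i = ap (X ^ i) v" for i
  have comb: "ap (poly_endo X (\<Sum>i\<in>I. monom (g i) i)) v = (\<Sum>i\<in>I. g i *\<^sub>R f i)" for g I
    by (simp add: poly_endo_sum poly_endo_monom ap_sum f_def)
  have inj: "inj f"
  proof (rule injI, rule ccontr)
    fix i j assume "f i = f j" "i \<noteq> j"
    then have "ap (poly_endo X (monom 1 i + monom (-1) j)) v = 0"
      by (simp add: poly_endo_add poly_endo_monom f_def)
    moreover have "coeff (monom 1 i + monom (-1) j) i \<noteq> (0::real)" using \<open>i \<noteq> j\<close> by simp
    then have "monom 1 i + monom (-1) j \<noteq> (0::real poly)" by (metis coeff_0)
    ultimately show False using nz by blast
  qed
  define A where "A = f ` {..DIM('a)}"
  have "independent A"
  proof (rule independent_if_scalars_zero)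
    show "finite A" by (simp add: A_def)
    fix g x assume g: "(\<Sum>x\<in>A. g x *\<^sub>R x) = 0" and x: "x \<in> A"
    define p where "p = (\<Sum>i\<le>DIM('a). monom (g (f i)) i)"
    have "ap (poly_endo X p) v = (\<Sum>x\<in>A. g x *\<^sub>R x)"
      unfolding p_def comb A_def using inj by (simp add: sum.reindex inj_on_subset)
    with g nz have "p = 0" by metis
    obtain i where i: "i \<le> DIM('a)" "x = f i" using x by (auto simp: A_def)
    have "coeff p i = g x" using i by (simp add: p_def coeff_sum)
    with \<open>p = 0\<close> show "g x = 0" by simp
  qed
  then have "card A \<le> DIM('a)" by (simp add: independent_bound)
  moreover have "card A = Suc DIM('a)" using inj by (simp add: A_def card_image inj_on_subset)
  ultimately show False by simp
qed

lemma map_poly_of_real_simps [simp]: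
  fixes p r :: "real poly" and z :: complex
  shows "map_poly complex_of_real (pCons a p) = pCons (of_real a) (map_poly of_real p)"
    and "poly (map_poly complex_of_real (p + r)) z = poly (map_poly of_real p) z + poly (map_poly of_real r) z"
    and "poly (map_poly complex_of_real (smult a p)) z = of_real a * poly (map_poly of_real p) z"
    and "poly (map_poly complex_of_real (p * r)) z = poly (map_poly of_real p) z * poly (map_poly of_real r) z"
    and "poly (map_poly complex_of_real p) (of_real x) = of_real (poly p x)"
proof -
  show pC [simp]: "map_poly complex_of_real (pCons a p) = pCons (of_real a) (map_poly of_real p)" for a p
    by (simp add: map_poly_pCons)
  show add [simp]: "poly (map_poly complex_of_real (p + r)) z = poly (map_poly of_real p) z + poly (map_poly of_real r) z" for p r
  proof (induction p arbitrary: r)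
    case (pCons a p)
    show ?case
      by (cases r) (simp add: pCons.IH distrib_left)
  qed simp
  show [simp]: "poly (map_poly complex_of_real (smult a p)) z = of_real a * poly (map_poly of_real p) z" for a p
    by (induction p) (auto simp: algebra_simps)
  show "poly (map_poly complex_of_real (p * r)) z = poly (map_poly of_real p) z * poly (map_poly of_real r) z"
    by (induction p) (auto simp: algebra_simps)
  show "poly (map_poly complex_of_real p) (of_real x) = of_real (poly p x)"
    by (induction p) auto
qed

text \<open>
  The remainder of \<open>p\<close> modulo the quadratic is a real polynomial of degree at most one with a
  nonreal root.
\<close>

lemma nonreal_root_quadratic_dvd:
  fixes p :: "real poly"
  assumes "poly (map_poly of_real p) (z::complex) = 0" "Im z \<noteq> 0"
  shows "[:(Re z)\<^sup>2 + (Im z)\<^sup>2, - 2 * Re z, 1:] dvd p"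
proof -
  define m where "m = [:(Re z)\<^sup>2 + (Im z)\<^sup>2, - 2 * Re z, 1:]"
  have m: "poly (map_poly of_real m) z = 0"
    by (simp add: m_def complex_eq_iff power2_eq_square algebra_simps)
  have deg: "degree (p mod m) < 2" using degree_mod_less[of m p] by (auto simp: m_def)
  define a b where "a = coeff (p mod m) 0" and "b = coeff (p mod m) 1"
  have ab: "p mod m = [:a, b:]"
    using deg by (auto intro!: poly_eqI simp: a_def b_def coeff_pCons coeff_eq_0 split: nat.split)
  have "poly (map_poly complex_of_real (p div m * m + p mod m)) z = 0" using assms(1) by simp
  then have "complex_of_real a + z * complex_of_real b = 0"
    unfolding map_poly_of_real_simps(2,4) m ab by simp
  with assms(2) have "a = 0 \<and> b = 0" by (auto simp: complex_eq_iff)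
  then have "p mod m = 0" using ab by simp
  then have "m dvd p" by (simp add: mod_eq_0_iff_dvd)
  then show ?thesis by (simp only: m_def)
qed

text \<open>
  The quotient \<open>W / U\<close> contains an \<open>X\<close>-invariant line or plane. Among the nonzero real polynomials \<open>p\<close>
  such that \<open>p(X)\<close> maps some vector \<open>w\<close> of \<open>W\<close> outside \<open>U\<close> into \<open>U\<close>, one of least degree is chosen. It
  has a complex root, hence a real factor of degree one or an irreducible factor of degree two; by
  minimality, the cofactor sends \<open>w\<close> to a vector that is still outside \<open>U\<close>, and only the small factor
  remains.
\<close>

lemma relative_eigenvector:
  fixes X :: "'a::euclidean_space endo"
  assumes U: "subspace U" "preserves X U" and W: "subspace W" "preserves X W" and UW: "U \<subseteq> W" "U \<noteq> W"
  obtains (eigen) w \<mu> where "w \<in> W" "w \<notin> U" "ap X w - \<mu> *\<^sub>R w \<in> U"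
  | (quadratic) w \<alpha> \<beta> where "w \<in> W" "w \<notin> U" "\<beta> \<noteq> 0"
      "ap X (ap X w) - (2 * \<alpha>) *\<^sub>R ap X w + (\<alpha>\<^sup>2 + \<beta>\<^sup>2) *\<^sub>R w \<in> U"
proof -
  define good where "good p \<longleftrightarrow> p \<noteq> 0 \<and> (\<exists>w\<in>W - U. ap (poly_endo X p) w \<in> U)" for p
  obtain v where v: "v \<in> W" "v \<notin> U" using UW by blast
  obtain p0 where "p0 \<noteq> 0" "ap (poly_endo X p0) v = 0" using annihilating_poly .
  then have "good p0" using v subspace_0[OF U(1)] by (auto simp: good_def intro!: bexI[of _ v])
  then obtain p where p: "good p" and min: "\<And>s. good s \<Longrightarrow> degree p \<le> degree s"
    using ex_has_least_nat[of good p0 degree] by blast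
  obtain w where w: "w \<in> W" "w \<notin> U" "ap (poly_endo X p) w \<in> U" using p by (auto simp: good_def)
  have step: "ap (poly_endo X s) w \<in> W" "ap (poly_endo X s) w \<notin> U" if "s \<noteq> 0" "degree s < degree p" for s
    using that min[of s] w preserves_poly_endo[OF W, of s] by (auto simp: good_def preserves_def)
  have "degree p \<noteq> 0"
  proof
    assume "degree p = 0"
    then obtain c where c: "p = [:c:]" by (metis degree_eq_zeroE)
    with p have "c \<noteq> 0" by (auto simp: good_def)
    have "c *\<^sub>R w \<in> U" using w(3) c by simp
    then have "(1 / c) *\<^sub>R (c *\<^sub>R w) \<in> U" using subspace_scale[OF U(1)] by blast
    with \<open>c \<noteq> 0\<close> w(2) show False by simp
  qed
  then have "\<not> constant (poly (map_poly complex_of_real p))"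
    by (simp add: constant_degree degree_map_poly)
  then obtain z where z: "poly (map_poly complex_of_real p) z = 0"
    using fundamental_theorem_of_algebra by blast
  show thesis
  proof (cases "Im z = 0")
    case True
    then have "complex_of_real (poly p (Re z)) = 0"
      using z map_poly_of_real_simps(5)[of p "Re z"] by (simp add: complex_is_Real_iff)
    then obtain s where s: "p = [:- Re z, 1:] * s"
      by (auto simp: poly_eq_0_iff_dvd)
    with p have "s \<noteq> 0" by (auto simp: good_def)
    then have "degree p = Suc (degree s)" unfolding s using \<open>s \<noteq> 0\<close> by (subst degree_mult_eq) auto
    with step[OF \<open>s \<noteq> 0\<close>] show thesis
      using w(3) by (intro eigen[of "ap (poly_endo X s) w" "Re z"])
        (auto simp: s poly_endo_mult add.commute simp del: mult_pCons_left)
  next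
    case False
    then obtain s where s: "p = [:(Re z)\<^sup>2 + (Im z)\<^sup>2, - 2 * Re z, 1:] * s"
      using nonreal_root_quadratic_dvd[OF z] by (auto elim: dvdE)
    with p have "s \<noteq> 0" by (auto simp: good_def)
    then have "degree p = Suc (Suc (degree s))" unfolding s using \<open>s \<noteq> 0\<close> by (subst degree_mult_eq) auto
    with step[OF \<open>s \<noteq> 0\<close>] have y: "ap (poly_endo X s) w \<in> W - U" by simp
    have "ap (poly_endo X p) w = ap X (ap X (ap (poly_endo X s) w)) - (2 * Re z) *\<^sub>R ap X (ap (poly_endo X s) w)
        + ((Re z)\<^sup>2 + (Im z)\<^sup>2) *\<^sub>R ap (poly_endo X s) w"
      unfolding s poly_endo_mult by (simp add: algebra_simps)
    with y w(3) False show thesis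
      by (intro quadratic[of "ap (poly_endo X s) w" "Im z" "Re z"]) auto
  qed
qed

context symmetric_form
begin

section \<open>Signatures of definite and Lorentzian subspaces\<close>

lemma dim_complement:
  assumes "subspace V" "e \<in> V" "q e e \<noteq> 0"
  shows "dim V = Suc (dim {v\<in>V. q e v = 0})"
proof -
  have "span {e} \<inter> {v\<in>V. q e v = 0} = {0}"
    using assms subspace_0[OF assms(1)] by (auto simp: span_singleton)
  moreover have "e \<noteq> 0" using assms(3) by auto
  then have "dim (span {e}) = 1" by simp
  ultimately show ?thesis
    using dim_sums_Int[of "span {e}" "{v\<in>V. q e v = 0}"] subspace_orthogonal[OF assms(1), of e]
      split_along[OF assms] by (simp flip: span_singleton)
qed

lemma dim_inner_products:
  assumes "subspace S" "restrict_form q S \<in> inner_products r s S" shows "dim S = r + s"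
proof -
  obtain P N where B: "orthonormal_basis P N S" "card P = r" "card N = s"
    using inner_products_iff[OF assms(1)] assms(2) by blast
  have "dim S = card (P \<union> N)"
    using orthonormal_basis_independent[OF B(1)] B(1)
    by (metis dim_span_eq_card_independent orthonormal_basis_def)
  then show ?thesis using B by (simp add: orthonormal_basis_def card_Un_disjoint)
qed

text \<open>
  Gram-Schmidt orthogonalization, one vector at a time.
\<close>

lemma posdef_inner_products:
  assumes "subspace T" "posdef T"
  shows "restrict_form q T \<in> inner_products (dim T) 0 T"
  using assms
proof (induction "dim T" arbitrary: T rule: less_induct)
  case less
  show ?case
  proof (cases "T = {0}")
    case True
    then show ?thesis
      using inner_products_iff[OF less.prems(1), of "dim T" 0]
      by (auto intro!: exI[of _ "{}"] simp: orthonormal_basis_def)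
  next
    case False
    then obtain e where e: "e \<in> T" "e \<noteq> 0" using subspace_0[OF less.prems(1)] by blast
    then have pos: "q e e > 0" using less.prems by (auto simp: posdef_def)
    let ?W = "{v\<in>T. q e v = 0}"
    have d: "dim T = Suc (dim ?W)" using dim_complement[OF less.prems(1) e(1)] pos by simp
    have "restrict_form q ?W \<in> inner_products (dim ?W) 0 ?W"
      using less.prems subspace_orthogonal[OF less.prems(1), of e] d
      by (intro less.hyps) (auto simp: posdef_def)
    then have "restrict_form q T \<in> inner_products (1 + dim ?W) (0 + 0) T"
      using pos e(1) less.prems subspace_orthogonal[OF less.prems(1), of e]
      by (intro inner_products_orthogonal_sum[of "span {e}" ?W] inner_products_line split_along subspace_span)
        (auto simp: span_singleton)
    then show ?thesis using d by simp
  qed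
qed

lemma lorentzian_inner_products:
  assumes V: "subspace V" "lorentzian V"
  shows "restrict_form q V \<in> inner_products (dim V - 1) 1 V"
proof -
  obtain e where e: "e \<in> V" "q e e < 0" and pos: "posdef {v\<in>V. q e v = 0}"
    using V by (auto simp: lorentzian_def)
  let ?W = "{v\<in>V. q e v = 0}"
  define u where "u = (1 / sqrt (- q e e)) *\<^sub>R e"
  have "q u u = - 1" using e(2) by (simp add: u_def field_simps real_sqrt_mult_self)
  moreover have "span {u} = span {e}"
  proof (intro subset_antisym span_minimal subspace_span)
    show "{u} \<subseteq> span {e}" by (simp add: u_def span_scale span_base)
    have "sqrt (- q e e) *\<^sub>R u \<in> span {u}" by (simp add: span_scale span_base)
    then show "{e} \<subseteq> span {u}" using e by (simp add: u_def)
  qed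
  ultimately have "orthonormal_basis {} {u} (span {e})" by (auto simp: orthonormal_basis_def)
  then have "restrict_form q (span {e}) \<in> inner_products 0 1 (span {e})"
    using inner_products_iff[OF subspace_span] by fastforce
  then have "restrict_form q V \<in> inner_products (0 + dim ?W) (1 + 0) V"
    using e V subspace_orthogonal[OF V(1), of e] pos
    by (intro inner_products_orthogonal_sum[of "span {e}" ?W] split_along posdef_inner_products subspace_span)
      (auto simp: span_singleton)
  then show ?thesis using dim_complement[OF V(1) e(1)] e(2) by simp
qed

lemma posdef_of_inner_products:
  assumes "subspace T" "restrict_form q T \<in> inner_products r 0 T"
  shows "posdef T"
  unfolding posdef_def
proof (intro ballI impI)
  fix v assume v: "v \<in> T" "v \<noteq> 0"
  obtain P where B: "orthonormal_basis P {} T"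
    using assms inner_products_iff[OF assms(1), of r 0]
    by (auto simp: orthonormal_basis_def)
  have fin: "finite P" and unit: "\<And>b. b \<in> P \<Longrightarrow> q b b = 1" using B by (auto simp: orthonormal_basis_def)
  have "\<exists>b\<in>P. q v b \<noteq> 0"
  proof (rule ccontr)
    assume "\<not> (\<exists>b\<in>P. q v b \<noteq> 0)"
    then have "v = 0" using orthonormal_expansion(1)[OF B v(1)] by simp
    with v show False by simp
  qed
  moreover have "q v v = (\<Sum>b\<in>P. (q v b)\<^sup>2)"
    using orthonormal_expansion(2)[OF B v(1), of v] unit by (simp add: power2_eq_square)
  ultimately show "q v v > 0" using fin by (auto intro!: sum_pos2)
qed

lemma lorentzian_of_inner_products:
  assumes V: "subspace V" "restrict_form q V \<in> inner_products r 1 V"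
  shows "lorentzian V"
proof -
  obtain P N where B: "orthonormal_basis P N V" and "card N = 1"
    using assms inner_products_iff[OF assms(1), of r 1] by auto
  then obtain e where N: "N = {e}" by (auto simp: card_1_singleton_iff)
  have e: "e \<in> V" "q e e = -1" "e \<notin> P" "finite P"
    using B orthonormal_basis_subset[OF B] by (auto simp: orthonormal_basis_def N)
  have sub: "span P \<subseteq> V" using orthonormal_basis_subset[OF B] V(1) by (meson Un_subset_iff span_minimal)
  have "orthonormal_basis P {} (span P)" using B by (auto simp: orthonormal_basis_def)
  then have "restrict_form q (span P) \<in> inner_products (card P) 0 (span P)"
    using inner_products_iff[OF subspace_span] by fastforce
  then have pos: "posdef (span P)" by (rule posdef_of_inner_products[OF subspace_span])
  have "v \<in> span P" if v: "v \<in> V" "q e v = 0" for v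
  proof -
    have "v = (\<Sum>b\<in>insert e P. (q b b * q v b) *\<^sub>R b)"
      using orthonormal_expansion(1)[OF B v(1)] by (simp add: N)
    also have "\<dots> = (\<Sum>b\<in>P. (q b b * q v b) *\<^sub>R b)" using e v sym by simp
    also have "\<dots> \<in> span P" by (intro span_sum span_scale span_base)
    finally show ?thesis .
  qed
  then show ?thesis
    using e pos unfolding lorentzian_def posdef_def by (intro bexI[of _ e]) auto
qed

section \<open>Symmetric endomorphisms\<close>

definition symmetric_on :: "'a endo \<Rightarrow> 'a set \<Rightarrow> bool" where
  "symmetric_on X V \<longleftrightarrow> (\<forall>x\<in>V. \<forall>y\<in>V. q (ap X x) y = q x (ap X y))"

lemma symmetric_on_power:
  assumes "preserves X V" "symmetric_on X V" shows "symmetric_on (X ^ n) V"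
proof (induction n)
  case (Suc n)
  show ?case unfolding symmetric_on_def
  proof (intro ballI)
    fix x y assume xy: "x \<in> V" "y \<in> V"
    then have "ap X y \<in> V" "ap (X ^ n) x \<in> V"
      using assms(1) preserves_power[OF assms(1)] by (auto simp: preserves_def)
    then have "q (ap (X ^ Suc n) x) y = q x (ap (X ^ n) (ap X y))"
      using assms(2) Suc.IH xy by (simp add: symmetric_on_def)
    then show "q (ap (X ^ Suc n) x) y = q x (ap (X ^ Suc n) y)"
      by (simp only: power_Suc2 ap_simps)
  qed
qed (simp add: symmetric_on_def)

lemma symmetric_on_exp:
  assumes "preserves X V" "symmetric_on X V" shows "symmetric_on (exp X) V"
  unfolding symmetric_on_def
proof (intro ballI)
  fix x y assume xy: "x \<in> V" "y \<in> V"
  have "(\<lambda>n. q ((1 / fact n) *\<^sub>R ap (X ^ n) x) y) sums q (ap (exp X) x) y"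
    by (intro bounded_linear.sums[where f="\<lambda>x. q x y"] exp_ap_sums)
      (simp add: linear_left flip: linear_conv_bounded_linear)
  moreover have "(\<lambda>n. q x ((1 / fact n) *\<^sub>R ap (X ^ n) y)) sums q x (ap (exp X) y)"
    by (intro bounded_linear.sums[where f="q x"] exp_ap_sums)
      (simp add: linear_right flip: linear_conv_bounded_linear)
  moreover have "q ((1 / fact n) *\<^sub>R ap (X ^ n) x) y = q x ((1 / fact n) *\<^sub>R ap (X ^ n) y)" for n
    using symmetric_on_power[OF assms] xy by (simp add: symmetric_on_def)
  ultimately show "q (ap (exp X) x) y = q x (ap (exp X) y)"
    using sums_unique2 by fastforce
qed

text \<open>
  With \<open>Y = X / 2\<close> one has \<open>q(exp(X) x, y) = q(exp(Y) x, exp(Y) y)\<close>, a form isometric to \<open>q\<close>. This is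
  why the exponential curves never leave the space of inner products.
\<close>

lemma inner_products_exp:
  assumes V: "subspace V" and X: "preserves X V" "symmetric_on X V"
    and q: "restrict_form q V \<in> inner_products r s V"
  shows "restrict_form (\<lambda>x y. q (ap (exp X) x) y) V \<in> inner_products r s V"
proof -
  define Y where "Y = (1/2) *\<^sub>R X"
  have Y: "preserves Y V" "preserves (- Y) V"
    using X(1) V by (auto simp: Y_def preserves_def subspace_scale subspace_neg)
  have "symmetric_on Y V" using X(2) by (simp add: Y_def symmetric_on_def)
  then have E: "symmetric_on (exp Y) V" "preserves (exp Y) V" "preserves (exp (- Y)) V"
    using symmetric_on_exp[OF Y(1)] preserves_exp[OF V Y(1)] preserves_exp[OF V Y(2)] by auto
  have "exp X = exp Y * exp Y"
    using exp_add_commuting[of Y Y] by (simp add: Y_def flip: scaleR_add_left)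
  then have "q (ap (exp X) x) y = q (ap (exp Y) x) (ap (exp Y) y)" if "x \<in> V" "y \<in> V" for x y
    using E that by (simp add: symmetric_on_def preserves_def)
  then have "restrict_form (\<lambda>x y. q (ap (exp X) x) y) V
      = restrict_form (\<lambda>x y. q (ap (exp Y) x) (ap (exp Y) y)) V"
    by (auto simp: restrict_form_def fun_eq_iff)
  then show ?thesis
    using inner_products_pullback[OF V E(2,3) exp_inverse_ap q] by simp
qed

lemma preserves_orthogonal:
  assumes "preserves X V" "symmetric_on X V" "e \<in> V" "ap X e = \<mu> *\<^sub>R e"
  shows "preserves X {v\<in>V. q e v = 0}"
  using assms unfolding preserves_def symmetric_on_def
  by (auto simp: sym[of e])

lemma symmetric_on_subset: "symmetric_on X V \<Longrightarrow> S \<subseteq> V \<Longrightarrow> symmetric_on X S"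
  by (auto simp: symmetric_on_def)

text \<open>
  The pairing of \<open>((X - \<alpha>)\<^sup>2 + \<beta>\<^sup>2) v\<close> with \<open>v\<close> equals
  \<open>q((X - \<alpha>) v, (X - \<alpha>) v) + \<beta>\<^sup>2 q(v, v)\<close>, because \<open>X\<close> is symmetric.
\<close>

lemma no_nonreal_eigenvalue:
  assumes "symmetric_on X V" "preserves X V" "v \<in> V" "\<beta> \<noteq> 0"
    and "q (ap X (ap X v) - (2 * \<alpha>) *\<^sub>R ap X v + (\<alpha>\<^sup>2 + \<beta>\<^sup>2) *\<^sub>R v) v = 0"
    and "q (ap X v - \<alpha> *\<^sub>R v) (ap X v - \<alpha> *\<^sub>R v) \<ge> 0"
  shows "q v v \<le> 0"
proof -
  have "ap X v \<in> V" using assms by (auto simp: preserves_def)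
  then have "q (ap X (ap X v)) v = q (ap X v) (ap X v)"
    using assms by (simp add: symmetric_on_def)
  then have "\<beta>\<^sup>2 * q v v = - q (ap X v - \<alpha> *\<^sub>R v) (ap X v - \<alpha> *\<^sub>R v)"
    using assms(5) by (simp add: sym[of v "ap X v"] algebra_simps power2_eq_square)
  then have "\<beta>\<^sup>2 * q v v \<le> 0" using assms(6) by simp
  then show ?thesis using \<open>\<beta> \<noteq> 0\<close> by (simp add: mult_le_0_iff)
qed

lemma posdef_eigenvector:
  assumes T: "subspace T" "posdef T" and X: "preserves X T" "symmetric_on X T" and "T \<noteq> {0}"
  obtains f \<mu> where "f \<in> T" "f \<noteq> 0" "ap X f = \<mu> *\<^sub>R f"
proof (rule relative_eigenvector[of "{0}" X T])
  show "subspace {0}" "preserves X {0}" "subspace T" "preserves X T" "{0} \<subseteq> T" "{0} \<noteq> T"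
    using assms subspace_0[OF T(1)] by (auto simp: preserves_def)
next
  fix w \<mu> assume "w \<in> T" "w \<notin> {0}" "ap X w - \<mu> *\<^sub>R w \<in> {0}"
  then show ?thesis using that[of w \<mu>] by simp
next
  fix w \<alpha> \<beta> assume w: "w \<in> T" "w \<notin> {0}" "\<beta> \<noteq> 0"
    "ap X (ap X w) - (2 * \<alpha>) *\<^sub>R ap X w + (\<alpha>\<^sup>2 + \<beta>\<^sup>2) *\<^sub>R w \<in> {0}"
  have nonneg: "ap X w - \<alpha> *\<^sub>R w \<in> T"
    using w X T by (auto simp: preserves_def subspace_diff subspace_scale)
  have "q (ap X (ap X w) - (2 * \<alpha>) *\<^sub>R ap X w + (\<alpha>\<^sup>2 + \<beta>\<^sup>2) *\<^sub>R w) w = 0"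
    using w(4) zero_left by (metis singletonD)
  from no_nonreal_eigenvalue[OF X(2,1) w(1,3) this posdef_nonneg[OF T(2) nonneg]]
  have "q w w \<le> 0" .
  with w T(2) show ?thesis by (force simp: posdef_def)
qed

text \<open>
  The spectral theorem, by induction: the complement of an eigenvector is again invariant.
\<close>

lemma posdef_eigenbasis:
  assumes "subspace T" "posdef T" "preserves X T" "symmetric_on X T"
  obtains F where "finite F" "span F = T" "0 \<notin> F"
    "\<And>f g. f \<in> F \<Longrightarrow> g \<in> F \<Longrightarrow> f \<noteq> g \<Longrightarrow> q f g = 0" "\<And>f. f \<in> F \<Longrightarrow> \<exists>\<mu>. ap X f = \<mu> *\<^sub>R f"
proof -
  have "\<exists>F. finite F \<and> span F = T \<and> 0 \<notin> F \<and> (\<forall>f\<in>F. \<forall>g\<in>F. f \<noteq> g \<longrightarrow> q f g = 0) \<and>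
     (\<forall>f\<in>F. \<exists>\<mu>. ap X f = \<mu> *\<^sub>R f)"
    using assms
  proof (induction "dim T" arbitrary: T rule: less_induct)
    case less
    show ?case
    proof (cases "T = {0}")
      case True
      then show ?thesis by (intro exI[of _ "{}"]) auto
    next
      case False
      obtain e \<mu> where e: "e \<in> T" "e \<noteq> 0" "ap X e = \<mu> *\<^sub>R e"
        using posdef_eigenvector[OF less.prems False] .
      then have pos: "q e e > 0" using less.prems by (auto simp: posdef_def)
      let ?W = "{v\<in>T. q e v = 0}"
      have "dim ?W < dim T" using dim_complement[OF less.prems(1) e(1)] pos by simp
      then obtain F where F: "finite F" "span F = ?W" "0 \<notin> F" "\<forall>f\<in>F. \<forall>g\<in>F. f \<noteq> g \<longrightarrow> q f g = 0"
        "\<forall>f\<in>F. \<exists>\<mu>. ap X f = \<mu> *\<^sub>R f"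
        using less.hyps[of ?W] less.prems subspace_orthogonal[OF less.prems(1)]
          preserves_orthogonal[OF less.prems(3,4) e(1,3)] symmetric_on_subset[OF less.prems(4), of ?W]
        by (auto simp: posdef_def)
      have "F \<subseteq> ?W" using F(2) span_superset by blast
      then have "\<forall>f\<in>F. q e f = 0 \<and> q f e = 0" using sym by auto
      moreover have "span (insert e F) = T"
        using split_along[OF less.prems(1) e(1)] pos F(2) span_Un[of "{e}" F] by simp
      ultimately show ?thesis
        using F e by (intro exI[of _ "insert e F"]) auto
    qed
  qed
  then show ?thesis using that by blast
qed

end

section \<open>Normal form of a symmetric endomorphism of a Lorentzian space\<close>

lemma preserves_span:
  assumes "\<And>b. b \<in> B \<Longrightarrow> ap X b \<in> span B" shows "preserves X (span B)"
  unfolding preserves_def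
proof
  fix x assume "x \<in> span B"
  then have "ap X x \<in> span (ap X ` B)" using linear_span_image[OF linear_ap, of X B] by blast
  moreover have "span (ap X ` B) \<subseteq> span B" using assms by (intro span_minimal) auto
  ultimately show "ap X x \<in> span B" by blast
qed

lemma preserves_span_pair:
  assumes "ap X a \<in> span {a, b}" "ap X b \<in> span {a, b}" shows "preserves X (span {a, b})"
  using assms by (intro preserves_span) auto

lemma in_span_pair: "a \<in> span {a, b}" "b \<in> span {a, b}" "r *\<^sub>R a + s *\<^sub>R b \<in> span {a, b}"
  by (rule span_base, simp, rule span_base, simp) (intro span_add span_scale span_base; simp)

lemma in_span_pairE:
  assumes "x \<in> span {a, b}" obtains r s where "x = r *\<^sub>R a + s *\<^sub>R b"
proof -
  obtain r where "x - r *\<^sub>R a \<in> span {b}" using assms span_breakdown_eq[of x a "{b}"] by blast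
  then obtain s where "x - r *\<^sub>R a = s *\<^sub>R b" by (auto simp: span_singleton)
  then show ?thesis using that[of r s] by (simp add: algebra_simps)
qed

context symmetric_form
begin

lemma null_complement_positive:
  assumes "subspace V" "lorentzian V" "e \<in> V" "e \<noteq> 0" "q e e = 0" "v \<in> V" "q e v = 0" "v \<notin> span {e}"
  shows "q v v > 0"
proof (rule ccontr)
  assume "\<not> q v v > 0"
  then obtain c where "v = c *\<^sub>R e"
    using nonspacelike_orthogonal_dependent[OF assms(1-3), of v] assms(4-7) by (auto simp: not_less)
  then show False using assms(8) by (auto simp: span_singleton)
qed

text \<open>
  The endomorphism \<open>J = (X - \<alpha>) / \<beta>\<close> is symmetric with square \<open>-1\<close> on the plane, so that
  \<open>q(J w, J w) = - q(w, w)\<close>: one of \<open>w\<close> and \<open>u = J w\<close> is timelike, unless both are null. In the latter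
  case they cannot be orthogonal, and \<open>w - q(w, u) u\<close> is timelike.
\<close>

lemma timelike_in_complex_plane:
  assumes V: "subspace V" "lorentzian V" and X: "symmetric_on X V" and wu: "w \<in> V" "u \<in> V" "w \<noteq> 0" "\<beta> \<noteq> 0"
    and Xw: "ap X w = \<alpha> *\<^sub>R w + \<beta> *\<^sub>R u" and Xu: "ap X u = \<alpha> *\<^sub>R u - \<beta> *\<^sub>R w"
  shows "\<exists>t\<in>span {w, u}. q t t < 0"
proof -
  have "q (ap X w) u = q w (ap X u)" using X wu by (simp add: symmetric_on_def)
  then have "\<beta> * (q u u + q w w) = 0" by (simp add: Xw Xu algebra_simps)
  then have uu: "q u u = - q w w" using \<open>\<beta> \<noteq> 0\<close> by simp
  consider "q w w < 0" | "q w w > 0" | "q w w = 0" by linarith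
  then show ?thesis
  proof cases
    case 1
    then show ?thesis using in_span_pair(1)[of w u] by blast
  next
    case 2
    then have "q u u < 0" using uu by simp
    then show ?thesis using in_span_pair(2)[of u w] by blast
  next
    case 3
    have "q w u \<noteq> 0"
    proof
      assume "q w u = 0"
      then obtain c where u: "u = c *\<^sub>R w"
        using nonspacelike_orthogonal_dependent[OF V wu(1,2)] 3 uu wu(3) by auto
      have "\<alpha> *\<^sub>R u - \<beta> *\<^sub>R w = c *\<^sub>R (\<alpha> *\<^sub>R w + \<beta> *\<^sub>R u)" using Xu Xw u by simp
      then have "(\<beta> * (c\<^sup>2 + 1)) *\<^sub>R w = 0" by (simp add: u algebra_simps power2_eq_square)
      moreover have "c\<^sup>2 + 1 \<noteq> 0" using zero_le_power2[of c] by linarith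
      ultimately show False using wu by auto
    qed
    moreover have "q (w - q w u *\<^sub>R u) (w - q w u *\<^sub>R u) = - 2 * (q w u)\<^sup>2"
      using 3 uu by (simp add: sym[of u w] power2_eq_square algebra_simps)
    ultimately have "q (w - q w u *\<^sub>R u) (w - q w u *\<^sub>R u) < 0" by simp
    moreover have "w - q w u *\<^sub>R u \<in> span {w, u}"
      using in_span_pair(3)[where r=1 and s="- q w u" and a=w and b=u] by simp
    ultimately show ?thesis by blast
  qed
qed

text \<open>
  Let \<open>S\<close> be an invariant subspace of least dimension among those which contain a timelike vector.
  It has no spacelike eigenvector \<open>w\<close>, since the complement of \<open>w\<close> in \<open>S\<close> would be smaller. If \<open>S\<close>
  contains an invariant plane without real eigenvalue, or a timelike eigenvector, this is one of the
  first two cases. Otherwise \<open>S\<close> has a null eigenvector \<open>e\<close>, of eigenvalue \<open>\<kappa>\<close>. The complement \<open>W\<close>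
  of \<open>e\<close> in \<open>S\<close> is positive semidefinite with radical spanned by \<open>e\<close>, and \<open>S\<close> is spanned by \<open>W\<close> and
  one more vector \<open>f\<close>. An eigenvector of \<open>W\<close> modulo \<open>e\<close> could be corrected by a multiple of \<open>e\<close> to a
  spacelike eigenvector, unless its eigenvalue is \<open>\<kappa>\<close> and \<open>X - \<kappa>\<close> maps it to a nonzero multiple of
  \<open>e\<close>; and there is room for one such direction only. So \<open>W\<close> has dimension one or two, and \<open>S\<close> is a
  single Jordan block of size two or three.
\<close>

lemma lorentzian_normal_form:
  assumes V: "subspace V" "lorentzian V" and X: "preserves X V" "symmetric_on X V"
  obtains (timelike) e \<mu> where "e \<in> V" "q e e < 0" "ap X e = \<mu> *\<^sub>R e"
  | (complex) w u \<alpha> \<beta> t where "w \<in> V" "u \<in> V" "\<beta> \<noteq> 0" "ap X w = \<alpha> *\<^sub>R w + \<beta> *\<^sub>R u"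
      "ap X u = \<alpha> *\<^sub>R u - \<beta> *\<^sub>R w" "t \<in> span {w, u}" "q t t < 0"
  | (two_step) e f \<kappa> t where "e \<in> V" "f \<in> V" "e \<noteq> 0" "ap X e = \<kappa> *\<^sub>R e" "ap X f = \<kappa> *\<^sub>R f + e"
      "t \<in> span {e, f}" "q t t < 0"
  | (three_step) e w f \<kappa> t where "e \<in> V" "w \<in> V" "f \<in> V" "e \<noteq> 0" "ap X e = \<kappa> *\<^sub>R e"
      "ap X w = \<kappa> *\<^sub>R w + e" "ap X f = \<kappa> *\<^sub>R f + w" "t \<in> span {e, w, f}" "q t t < 0"
proof -
  define good where "good S \<longleftrightarrow> subspace S \<and> S \<subseteq> V \<and> preserves X S \<and> (\<exists>t\<in>S. q t t < 0)" for S
  have "good V" using V X by (auto simp: good_def lorentzian_def)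
  then obtain S where S: "good S" and min: "\<And>S'. good S' \<Longrightarrow> dim S \<le> dim S'"
    using ex_has_least_nat[of good V dim] by blast
  have sub: "subspace S" "S \<subseteq> V" "preserves X S" using S by (auto simp: good_def)
  obtain t where t: "t \<in> S" "q t t < 0" using S by (auto simp: good_def)
  have SL: "lorentzian S" using lorentzian_subspace[OF V sub(2) t] .
  have XS: "symmetric_on X S" using symmetric_on_subset[OF X(2) sub(2)] .
  \<comment> \<open>The complement of a spacelike eigenvector still contains a timelike vector, the projection \<open>t'\<close>.\<close>
  have no_spacelike: "q w w \<le> 0" if w: "w \<in> S" "ap X w = \<mu> *\<^sub>R w" for w \<mu>
  proof (rule ccontr)
    assume pos: "\<not> q w w \<le> 0"
    define t' where "t' = t - (q w t / q w w) *\<^sub>R w"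
    have "q t' t' = q t t - (q w t)\<^sup>2 / q w w"
      using pos by (simp add: t'_def sym[of t w] power2_eq_square)
    moreover have "(q w t)\<^sup>2 / q w w \<ge> 0" using pos by simp
    ultimately have "q t' t' < 0" using t(2) by linarith
    moreover have "t' \<in> {v\<in>S. q w v = 0}"
      using pos t w sub by (auto simp: t'_def subspace_diff subspace_scale)
    ultimately have "good {v\<in>S. q w v = 0}"
      using preserves_orthogonal[OF sub(3) XS w] subspace_orthogonal[OF sub(1)] sub(2)
      by (auto simp: good_def)
    then show False using min dim_complement[OF sub(1) w(1)] pos by fastforce
  qed
  consider (eigen) w \<mu> where "w \<in> S" "w \<noteq> 0" "ap X w = \<mu> *\<^sub>R w"
    | (quadratic) w \<alpha> \<beta> where "w \<in> S" "w \<noteq> 0" "\<beta> \<noteq> 0"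
        "ap X (ap X w) - (2 * \<alpha>) *\<^sub>R ap X w + (\<alpha>\<^sup>2 + \<beta>\<^sup>2) *\<^sub>R w = 0"
  proof (rule relative_eigenvector[of "{0}" X S])
    show "{0} \<noteq> S" using t by auto
  qed (use sub subspace_0[OF sub(1)] in \<open>auto simp: preserves_def\<close>)
  then show thesis
  proof cases
    case quadratic
    define u where "u = (1 / \<beta>) *\<^sub>R (ap X w - \<alpha> *\<^sub>R w)"
    have u: "u \<in> S" using quadratic sub by (auto simp: u_def preserves_def subspace_diff subspace_scale)
    have Xw: "ap X w = \<alpha> *\<^sub>R w + \<beta> *\<^sub>R u" using quadratic by (simp add: u_def)
    have bu: "\<beta> *\<^sub>R u = ap X w - \<alpha> *\<^sub>R w" using quadratic by (simp add: u_def)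
    have "\<beta> *\<^sub>R ap X u = ap X (\<beta> *\<^sub>R u)" by simp
    also have "\<dots> = ap X (ap X w) - \<alpha> *\<^sub>R ap X w" unfolding bu by simp
    also have "\<dots> = \<alpha> *\<^sub>R (\<beta> *\<^sub>R u) - \<beta>\<^sup>2 *\<^sub>R w"
      using quadratic(4) unfolding bu by (simp add: algebra_simps power2_eq_square) (simp flip: scaleR_add_left)
    finally have "\<beta> *\<^sub>R ap X u = \<beta> *\<^sub>R (\<alpha> *\<^sub>R u - \<beta> *\<^sub>R w)"
      by (simp add: algebra_simps power2_eq_square)
    then have Xu: "ap X u = \<alpha> *\<^sub>R u - \<beta> *\<^sub>R w" using \<open>\<beta> \<noteq> 0\<close> by simp
    obtain t where "t \<in> span {w, u}" "q t t < 0"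
      using timelike_in_complex_plane[OF sub(1) SL XS quadratic(1) u quadratic(2,3) Xw Xu] by blast
    then show thesis using complex[of w u \<beta> \<alpha> t] quadratic u Xw Xu sub(2) by auto
  next
    case (eigen e \<kappa>)
    show thesis
    proof (cases "q e e = 0")
      case False
      then have "q e e < 0" using no_spacelike[OF eigen(1,3)] by simp
      then show thesis using timelike eigen sub(2) by blast
    next
      case null: True
      define W where "W = {v\<in>S. q e v = 0}"
      have W: "subspace W" "preserves X W"
        unfolding W_def using subspace_orthogonal[OF sub(1)] preserves_orthogonal[OF sub(3) XS eigen(1,3)] by auto
      have WS: "W \<subseteq> S" by (auto simp: W_def)
      have pos: "q v v > 0" if "v \<in> W" "v \<notin> span {e}" for v
        using null_complement_positive[OF sub(1) SL eigen(1,2) null] that by (auto simp: W_def)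
      have nonneg: "q v v \<ge> 0" if "v \<in> W" for v
        using pos[OF that] null by (cases "v \<in> span {e}") (auto simp: span_singleton)
      have eU: "span {e} \<subseteq> W" using eigen null sub(1) by (auto simp: W_def span_singleton subspace_scale)
      obtain f where f: "f \<in> S" "q e f \<noteq> 0"
        using lorentzian_nondegenerate[OF SL eigen(1)] eigen(2) by blast
      have decomp: "v - (q e v / q e f) *\<^sub>R f \<in> W" if "v \<in> S" for v
        using that f sub by (auto simp: W_def subspace_diff subspace_scale)
      define n where "n = ap X f - \<kappa> *\<^sub>R f"
      have "q (ap X e) f = q e (ap X f)" using XS eigen(1) f by (simp add: symmetric_on_def)
      then have "q e (ap X f) = \<kappa> * q e f" by (simp add: eigen(3))
      then have nW: "n \<in> W"
        using f sub by (auto simp: n_def W_def preserves_def subspace_diff subspace_scale)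
      have Xf: "ap X f = \<kappa> *\<^sub>R f + n" by (simp add: n_def)
      have no_eigen: False if "v \<in> W" "v \<notin> span {e}" "ap X v = \<mu> *\<^sub>R v" for v \<mu>
        using pos[OF that(1,2)] no_spacelike[of v \<mu>] that WS by auto
      \<comment> \<open>Modulo \<open>e\<close> the form is definite on \<open>W\<close>, which excludes nonreal eigenvalues there.\<close>
      have no_quad: False
        if "v \<in> W" "v \<notin> span {e}" "\<beta> \<noteq> 0"
          "q (ap X (ap X v) - (2 * \<alpha>) *\<^sub>R ap X v + (\<alpha>\<^sup>2 + \<beta>\<^sup>2) *\<^sub>R v) v = 0" for v \<alpha> \<beta>
      proof -
        have "ap X v - \<alpha> *\<^sub>R v \<in> W"
          using that W by (auto simp: preserves_def subspace_diff subspace_scale)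
        then have "q v v \<le> 0"
          using no_nonreal_eigenvalue[OF XS sub(3) _ that(3,4)] that(1) WS nonneg by blast
        then show False using pos[OF that(1,2)] by simp
      qed
      show thesis
      proof (cases "W = span {e}")
        case True
        then obtain c where c: "n = c *\<^sub>R e" using nW by (auto simp: span_singleton)
        have tW: "t - (q e t / q e f) *\<^sub>R f \<in> span {e}" using decomp[OF t(1)] True by simp
        then obtain d where "t - (q e t / q e f) *\<^sub>R f = d *\<^sub>R e" by (auto simp: span_singleton)
        then have td: "t = d *\<^sub>R e + (q e t / q e f) *\<^sub>R f" by (simp add: algebra_simps)
        show thesis
        proof (cases "c = 0")
          case True
          have "ap X t = \<kappa> *\<^sub>R t"
            by (subst td, subst (2) td) (simp add: eigen(3) Xf c True algebra_simps)
          then show thesis using timelike t sub(2) by blast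
        next
          case False
          have "t = (d / c) *\<^sub>R (c *\<^sub>R e) + (q e t / q e f) *\<^sub>R f" using td False by simp
          then have "t \<in> span {c *\<^sub>R e, f}" by (metis in_span_pair(3))
          moreover have "c *\<^sub>R e \<in> V" "f \<in> V" using eigen(1) f(1) sub(2) V(1) by (auto simp: subspace_scale)
          ultimately show thesis
            using two_step[of "c *\<^sub>R e" f \<kappa> t] eigen(2,3) t(2) False Xf c by (auto simp: mult.commute)
        qed
      next
        case False
        obtain w c where w: "w \<in> W" "w \<notin> span {e}" "ap X w = \<kappa> *\<^sub>R w + c *\<^sub>R e" "c \<noteq> 0"
        proof (rule relative_eigenvector[of "span {e}" X W])
          show "preserves X (span {e})"
            using eigen by (auto simp: preserves_def span_singleton)
          show "span {e} \<noteq> W" using False by simp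
        next
          fix w \<mu> assume w: "w \<in> W" "w \<notin> span {e}" "ap X w - \<mu> *\<^sub>R w \<in> span {e}"
          then obtain c where "ap X w - \<mu> *\<^sub>R w = c *\<^sub>R e" by (auto simp: span_singleton)
          then have c: "ap X w = \<mu> *\<^sub>R w + c *\<^sub>R e" by (simp add: algebra_simps)
          show ?thesis
          proof (cases "\<mu> = \<kappa>")
            case True
            moreover have "c \<noteq> 0" using no_eigen[OF w(1,2), of \<mu>] c by auto
            ultimately show ?thesis using that w c by blast
          next
            case False
            \<comment> \<open>This \<open>s\<close> makes \<open>w + s e\<close> an eigenvector.\<close>
            define s where "s = c / (\<mu> - \<kappa>)"
            have s: "c + s * \<kappa> = \<mu> * s" using False by (simp add: s_def field_simps)
            have "ap X (w + s *\<^sub>R e) = \<mu> *\<^sub>R w + (c + s * \<kappa>) *\<^sub>R e"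
              by (simp add: c eigen(3) algebra_simps)
            also have "\<dots> = \<mu> *\<^sub>R (w + s *\<^sub>R e)" unfolding s by (simp add: scaleR_add_right)
            finally have "ap X (w + s *\<^sub>R e) = \<mu> *\<^sub>R (w + s *\<^sub>R e)" .
            moreover have "s *\<^sub>R e \<in> span {e}" by (auto simp: span_singleton)
            then have "w + s *\<^sub>R e \<in> W" "w + s *\<^sub>R e \<notin> span {e}"
              using w eU W(1) by (auto simp: subspace_add span_add_eq2 span_add_eq)
            ultimately show ?thesis using no_eigen by blast
          qed
        next
          fix w \<alpha> \<beta> assume w: "w \<in> W" "w \<notin> span {e}" "\<beta> \<noteq> 0"
            "ap X (ap X w) - (2 * \<alpha>) *\<^sub>R ap X w + (\<alpha>\<^sup>2 + \<beta>\<^sup>2) *\<^sub>R w \<in> span {e}"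
          then have "q (ap X (ap X w) - (2 * \<alpha>) *\<^sub>R ap X w + (\<alpha>\<^sup>2 + \<beta>\<^sup>2) *\<^sub>R w) w = 0"
            unfolding span_singleton by (auto simp: W_def simp del: diff_left add_left)
          with w no_quad show ?thesis by blast
        qed (use W eU in auto)
        have ww: "q w w > 0" using pos w by blast
        have ew: "q e w = 0" "w \<in> S" using w(1) by (auto simp: W_def)
        define U where "U = span {e, w}"
        have U: "subspace U" "U \<subseteq> W" "span {e} \<subseteq> U" "e \<in> U" "w \<in> U"
        proof -
          have "e \<in> W" using eU span_base[of e "{e}"] by blast
          then show "U \<subseteq> W" unfolding U_def using w(1) W(1) by (intro span_minimal) auto
          show "e \<in> U" "w \<in> U" unfolding U_def by (auto intro: span_base)
        qed (auto simp: U_def intro: span_mono[THEN subsetD])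
        have XU: "preserves X U"
          unfolding U_def by (rule preserves_span_pair)
            (use eigen(3) w(3) in_span_pair(3)[of c e \<kappa> w] in_span_pair(3)[of \<kappa> e 0 w] in \<open>auto simp: add.commute\<close>)
        \<comment> \<open>A further direction in \<open>W\<close> can be chosen orthogonal to \<open>w\<close>; corrected by a combination of \<open>e\<close>
            and \<open>w\<close>, it becomes a spacelike eigenvector.\<close>
        have "W = U"
        proof (rule ccontr)
          assume "W \<noteq> U"
          have orthogonalize: "\<exists>v'\<in>W. v' \<notin> U \<and> q v' w = 0 \<and> q v' e = 0 \<and> v - v' \<in> U"
            if "v \<in> W" "v \<notin> U" for v
          proof (intro bexI conjI)
            let ?v = "v - (q v w / q w w) *\<^sub>R w"
            have sw: "(q v w / q w w) *\<^sub>R w \<in> U" using U by (simp add: subspace_scale)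
            then show "?v \<in> W" using that U W by (auto simp: subspace_diff)
            show "?v \<notin> U" using that sw U(1) by (metis diff_add_cancel subspace_add)
            show "q ?v w = 0" using ww by simp
            show "q ?v e = 0" using that(1) ew by (simp add: W_def sym[of v e] sym[of w e])
            show "v - ?v \<in> U" using sw by simp
          qed
          show False
          proof (rule relative_eigenvector[of U X W])
            fix v \<mu> assume v: "v \<in> W" "v \<notin> U" "ap X v - \<mu> *\<^sub>R v \<in> U"
            obtain v' where v': "v' \<in> W" "v' \<notin> U" "q v' w = 0" "q v' e = 0" "v - v' \<in> U"
              using orthogonalize[OF v(1,2)] by blast
            have "ap X (v - v') - \<mu> *\<^sub>R (v - v') \<in> U"
              using v'(5) XU U(1) by (simp add: preserves_def subspace_diff subspace_scale del: ap_linear_simps)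
            from subspace_diff[OF U(1) v(3) this] have "ap X v' - \<mu> *\<^sub>R v' \<in> U"
              by (simp add: algebra_simps)
            then obtain b a where "ap X v' - \<mu> *\<^sub>R v' = b *\<^sub>R e + a *\<^sub>R w"
              unfolding U_def by (rule in_span_pairE)
            then have Xv: "ap X v' = \<mu> *\<^sub>R v' + b *\<^sub>R e + a *\<^sub>R w" by (simp add: algebra_simps)
            obtain r s where "ap X (v' + r *\<^sub>R e + s *\<^sub>R w) = \<mu> *\<^sub>R (v' + r *\<^sub>R e + s *\<^sub>R w)"
            proof (cases "\<mu> = \<kappa>")
              case True
              have "q (ap X v') w = q v' (ap X w)"
                using XS v'(1) ew WS by (auto simp: symmetric_on_def)
              then have "a * q w w = 0" using v' ew by (simp add: Xv w(3) True)
              then have "a = 0" using ww by simp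
              then have "ap X (v' + 0 *\<^sub>R e + (- b / c) *\<^sub>R w) = \<mu> *\<^sub>R (v' + 0 *\<^sub>R e + (- b / c) *\<^sub>R w)"
                using w(4) by (simp add: Xv w(3) True algebra_simps)
              then show ?thesis by (rule that)
            next
              case False
              define s where "s = a / (\<mu> - \<kappa>)"
              define r where "r = (b + s * c) / (\<mu> - \<kappa>)"
              have sr: "a + s * \<kappa> = \<mu> * s" "b + s * c + r * \<kappa> = \<mu> * r"
              proof -
                have "s * (\<mu> - \<kappa>) = a" "r * (\<mu> - \<kappa>) = b + s * c"
                  using False by (simp_all add: s_def r_def)
                then show "a + s * \<kappa> = \<mu> * s" "b + s * c + r * \<kappa> = \<mu> * r"
                  by (simp_all add: algebra_simps)
              qed
              have "ap X (v' + r *\<^sub>R e + s *\<^sub>R w) = \<mu> *\<^sub>R v' + (b + s * c + r * \<kappa>) *\<^sub>R e + (a + s * \<kappa>) *\<^sub>R w"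
                by (simp add: Xv w(3) eigen(3) algebra_simps)
              then have "ap X (v' + r *\<^sub>R e + s *\<^sub>R w) = \<mu> *\<^sub>R (v' + r *\<^sub>R e + s *\<^sub>R w)"
                unfolding sr by (simp add: algebra_simps)
              then show ?thesis by (rule that)
            qed
            moreover have rs: "r *\<^sub>R e + s *\<^sub>R w \<in> U" using U by (simp add: subspace_add subspace_scale)
            then have "v' + (r *\<^sub>R e + s *\<^sub>R w) \<in> W" "v' + (r *\<^sub>R e + s *\<^sub>R w) \<notin> U"
              using v' U(1,2) W(1) by (auto simp: subspace_add) (metis add_diff_cancel_right' subspace_diff)
            ultimately show False using no_eigen[of "v' + (r *\<^sub>R e + s *\<^sub>R w)" \<mu>] U(3) by (auto simp: add.assoc)
          next
            fix v \<alpha> \<beta> assume v: "v \<in> W" "v \<notin> U" "\<beta> \<noteq> 0"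
              "ap X (ap X v) - (2 * \<alpha>) *\<^sub>R ap X v + (\<alpha>\<^sup>2 + \<beta>\<^sup>2) *\<^sub>R v \<in> U"
            obtain v' where v': "v' \<in> W" "v' \<notin> U" "q v' w = 0" "q v' e = 0" "v - v' \<in> U"
              using orthogonalize[OF v(1,2)] by blast
            have "ap X (v - v') \<in> U" using v'(5) XU by (simp add: preserves_def del: ap_linear_simps)
            then have "ap X (ap X (v - v')) - (2 * \<alpha>) *\<^sub>R ap X (v - v') + (\<alpha>\<^sup>2 + \<beta>\<^sup>2) *\<^sub>R (v - v') \<in> U"
              using v'(5) XU U(1)
              by (simp add: preserves_def subspace_diff subspace_add subspace_scale del: ap_linear_simps)
            from subspace_diff[OF U(1) v(4) this]
            have "ap X (ap X v') - (2 * \<alpha>) *\<^sub>R ap X v' + (\<alpha>\<^sup>2 + \<beta>\<^sup>2) *\<^sub>R v' \<in> U"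
              by (simp add: algebra_simps)
            then obtain b a where y: "ap X (ap X v') - (2 * \<alpha>) *\<^sub>R ap X v' + (\<alpha>\<^sup>2 + \<beta>\<^sup>2) *\<^sub>R v' = b *\<^sub>R e + a *\<^sub>R w"
              unfolding U_def by (rule in_span_pairE)
            have "q (b *\<^sub>R e + a *\<^sub>R w) v' = 0" using v' by (simp add: sym[of e v'] sym[of w v'])
            then show False using no_quad[of v' \<beta> \<alpha>] v' v(3) U(3) unfolding y by blast
          qed (use W U XU \<open>W \<noteq> U\<close> in auto)
        qed
        then obtain b a where n: "n = b *\<^sub>R e + a *\<^sub>R w" using nW unfolding U_def by (auto elim: in_span_pairE)
        have "q (ap X f) w = q f (ap X w)" using XS f ew by (simp add: symmetric_on_def)
        then have "a * q w w = c * q e f" using ew by (simp add: Xf n w(3) sym[of f e])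
        then have a: "a \<noteq> 0" using w(4) f(2) by auto
        have Xn: "ap X n = \<kappa> *\<^sub>R n + (a * c) *\<^sub>R e" by (simp add: n w(3) eigen(3) algebra_simps)
        have sp: "e \<in> span {(a * c) *\<^sub>R e, n, f}" "n \<in> span {(a * c) *\<^sub>R e, n, f}" "f \<in> span {(a * c) *\<^sub>R e, n, f}"
        proof -
          have "(1 / (a * c)) *\<^sub>R ((a * c) *\<^sub>R e) \<in> span {(a * c) *\<^sub>R e, n, f}"
            by (intro span_scale span_base) simp
          then show "e \<in> span {(a * c) *\<^sub>R e, n, f}" using a w(4) by simp
        qed (auto intro: span_base)
        have "(1 / a) *\<^sub>R (n - b *\<^sub>R e) \<in> span {(a * c) *\<^sub>R e, n, f}"
          using sp by (intro span_scale span_diff)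
        then have w_sp: "w \<in> span {(a * c) *\<^sub>R e, n, f}" using a by (simp add: n)
        have "t - (q e t / q e f) *\<^sub>R f \<in> span {e, w}" using decomp[OF t(1)] \<open>W = U\<close> by (simp add: U_def)
        then have "t - (q e t / q e f) *\<^sub>R f \<in> span {(a * c) *\<^sub>R e, n, f}"
          using span_minimal[of "{e, w}" "span {(a * c) *\<^sub>R e, n, f}"] sp w_sp by auto
        then have "t - (q e t / q e f) *\<^sub>R f + (q e t / q e f) *\<^sub>R f \<in> span {(a * c) *\<^sub>R e, n, f}"
          using sp by (intro span_add span_scale)
        then have "t \<in> span {(a * c) *\<^sub>R e, n, f}" by simp
        moreover have "(a * c) *\<^sub>R e \<in> V" "n \<in> V" "f \<in> V"
          using eigen(1) f nW WS sub(2) V(1) by (auto simp: subspace_scale)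
        ultimately show thesis
          using three_step[of "(a * c) *\<^sub>R e" n f \<kappa> t] eigen a w(4) t(2) Xf Xn
          by (auto simp: mult.commute)
      qed
    qed
  qed
qed

end

context symmetric_form
begin

definition complement :: "'a set \<Rightarrow> 'a set \<Rightarrow> 'a set" where
  "complement S V = {v\<in>V. \<forall>s\<in>S. q s v = 0}"

lemma subspace_complement: "subspace V \<Longrightarrow> subspace (complement S V)"
  by (auto simp: complement_def subspace_def)

lemma complement_split:
  assumes S: "subspace S" "S \<subseteq> V" and V: "subspace V" and q: "restrict_form q S \<in> inner_products r s S"
  shows "V = {x + y |x y. x \<in> S \<and> y \<in> complement S V}" and "S \<inter> complement S V = {0}"
proof -
  obtain P N where B: "orthonormal_basis P N S"
    using inner_products_iff[OF S(1)] q by blast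
  show "V = {x + y |x y. x \<in> S \<and> y \<in> complement S V}" (is "V = ?R")
  proof
    show "?R \<subseteq> V" using S V by (auto simp: complement_def subspace_add)
    show "V \<subseteq> ?R"
    proof
      fix v assume v: "v \<in> V"
      define s where "s = (\<Sum>b\<in>P \<union> N. (q b b * q v b) *\<^sub>R b)"
      have s: "s \<in> S"
        unfolding s_def using orthonormal_basis_subset[OF B] S(1)
        by (intro subspace_sum subspace_scale) auto
      have "q x s = q x v" if "x \<in> S" for x
        using orthonormal_expansion(2)[OF B that, of v] by (simp add: s_def sum_right mult_ac)
      then have "v - s \<in> complement S V" using v s S V by (auto simp: complement_def subspace_diff)
      moreover have "v = s + (v - s)" by simp
      ultimately show "v \<in> ?R" using s by blast
    qed
  qed
  show "S \<inter> complement S V = {0}"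
    using nondegenerate_of_basis[OF B] sym subspace_0[OF S(1)] subspace_0[OF V]
    by (fastforce simp: complement_def)
qed

lemma preserves_complement:
  assumes "preserves X V" "symmetric_on X V" "preserves X S" "S \<subseteq> V"
  shows "preserves X (complement S V)"
  unfolding preserves_def complement_def
proof (intro ballI CollectI conjI)
  fix x s assume x: "x \<in> {v \<in> V. \<forall>s\<in>S. q s v = 0}"
  then show "ap X x \<in> V" using assms(1) by (simp add: preserves_def)
  assume s: "s \<in> S"
  then have "q s (ap X x) = q (ap X s) x" using assms(2,4) x by (auto simp: symmetric_on_def)
  then show "q s (ap X x) = 0" using assms(3) s x by (simp add: preserves_def)
qed

lemma posdef_complement:
  assumes "subspace V" "lorentzian V" "S \<subseteq> V" "t \<in> S" "q t t < 0"
  shows "posdef (complement S V)"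
  using posdef_timelike_complement[OF assms(1,2), of t] assms(3-5)
  by (auto simp: posdef_def complement_def)

section \<open>Endomorphisms with real eigenvalues\<close>

text \<open>
  Jordan chains of length at most three, the longest that occur in a Lorentzian space. If these
  vectors span, then all eigenvalues are real.
\<close>

definition chain_vectors :: "'a endo \<Rightarrow> 'a set \<Rightarrow> 'a set" where
  "chain_vectors X V = {v\<in>V. \<exists>\<mu>. ap ((X - \<mu> *\<^sub>R 1) ^ 3) v = 0}"

lemma chain_vectorsI:
  assumes "v \<in> V" "ap X v = \<mu> *\<^sub>R v + u" "ap X u = \<mu> *\<^sub>R u + w" "ap X w = \<mu> *\<^sub>R w"
  shows "v \<in> chain_vectors X V"
  unfolding chain_vectors_def
  by (intro CollectI conjI exI[of _ \<mu>] assms(1)) (simp add: power3_eq_cube assms algebra_simps)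

lemma complex_plane_no_real_eigenvector:
  assumes "\<beta> \<noteq> 0" "ap X w = \<alpha> *\<^sub>R w + \<beta> *\<^sub>R u" "ap X u = \<alpha> *\<^sub>R u - \<beta> *\<^sub>R w"
    and "s \<in> span {w, u}" "ap X s = x *\<^sub>R s"
  shows "s = 0"
proof -
  obtain a b where s: "s = a *\<^sub>R w + b *\<^sub>R u" using assms(4) by (rule in_span_pairE)
  define D where "D = X - \<alpha> *\<^sub>R 1"
  have "ap D (ap D s) = - (\<beta>\<^sup>2) *\<^sub>R s"
    by (simp add: D_def s assms(2,3) algebra_simps power2_eq_square)
  moreover have "ap D s = (x - \<alpha>) *\<^sub>R s" using assms(5) by (simp add: D_def algebra_simps)
  then have "ap D (ap D s) = (x - \<alpha>)\<^sup>2 *\<^sub>R s" by (simp add: power2_eq_square)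
  ultimately have "((x - \<alpha>)\<^sup>2 + \<beta>\<^sup>2) *\<^sub>R s = 0" by (simp add: scaleR_add_left)
  moreover have "(x - \<alpha>)\<^sup>2 + \<beta>\<^sup>2 \<noteq> 0" using assms(1) by (simp add: sum_power2_eq_zero_iff)
  ultimately show ?thesis by (metis scaleR_eq_0_iff)
qed

text \<open>
  A complex plane \<open>S\<close> in the normal form would carry the timelike direction, leaving \<open>e\<close>, whose
  component in \<open>S\<close> is a real eigenvector and hence zero, in the definite complement of \<open>S\<close>. In the other
  cases \<open>S\<close> consists of Jordan chains, and its complement is definite, hence diagonalizable.
\<close>

lemma span_chain_vectors:
  assumes V: "subspace V" "lorentzian V" and X: "preserves X V" "symmetric_on X V"
    and e: "e \<in> V" "e \<noteq> 0" "q e e \<le> 0" "ap X e = x *\<^sub>R e"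
  shows "V \<subseteq> span (chain_vectors X V)"
proof -
  have reduce: "V \<subseteq> span (chain_vectors X V)"
    if S: "G \<subseteq> V" "preserves X (span G)" and t: "t \<in> span G" "q t t < 0" and G: "G \<subseteq> chain_vectors X V" for G t
  proof -
    have sub: "span G \<subseteq> V" using S V by (intro span_minimal)
    have L: "lorentzian (span G)" using lorentzian_subspace[OF V sub t] .
    note T = subspace_complement[OF V(1), of "span G"] posdef_complement[OF V sub t]
      preserves_complement[OF X S(2) sub]
    have "complement (span G) V \<subseteq> V" by (auto simp: complement_def)
    then obtain F where F: "span F = complement (span G) V" "\<And>f. f \<in> F \<Longrightarrow> \<exists>\<mu>. ap X f = \<mu> *\<^sub>R f"
      using posdef_eigenbasis[OF T symmetric_on_subset[OF X(2)]] by metis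
    have "F \<subseteq> chain_vectors X V"
    proof
      fix f assume f: "f \<in> F"
      then have "f \<in> V" using F(1) span_base[OF f] by (auto simp: complement_def)
      moreover obtain \<mu> where "ap X f = \<mu> *\<^sub>R f" using F(2) f by blast
      ultimately show "f \<in> chain_vectors X V" by (intro chain_vectorsI[of f V X \<mu> 0 0]) auto
    qed
    then have "span F \<subseteq> span (chain_vectors X V)" by (rule span_mono)
    moreover have "span G \<subseteq> span (chain_vectors X V)" using G by (rule span_mono)
    ultimately show ?thesis
    proof (intro subsetI)
      fix v assume "v \<in> V"
      then obtain a b where "v = a + b" "a \<in> span G" "b \<in> span F"
        using complement_split(1)[OF subspace_span sub V(1) lorentzian_inner_products[OF subspace_span L]]
        unfolding F(1) by blast
      moreover assume "span F \<subseteq> span (chain_vectors X V)" "span G \<subseteq> span (chain_vectors X V)"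
      ultimately show "v \<in> span (chain_vectors X V)" by (auto intro: span_add)
    qed
  qed
  show ?thesis
    using V X
  proof (cases rule: lorentzian_normal_form)
    case (timelike e \<mu>)
    show ?thesis
    proof (rule reduce[of "{e}" e])
      show "preserves X (span {e})" using timelike by (auto simp: preserves_def span_singleton)
      show "{e} \<subseteq> chain_vectors X V" using timelike chain_vectorsI[of e V X \<mu> 0 0] by auto
    qed (use timelike in \<open>auto intro: span_base\<close>)
  next
    case (complex w u \<alpha> \<beta> t)
    have pres: "preserves X (span {w, u})"
      using complex(4,5) in_span_pair(3)[of \<alpha> w \<beta> u] in_span_pair(3)[of "- \<beta>" w \<alpha> u]
      by (intro preserves_span_pair) auto
    have sub: "span {w, u} \<subseteq> V" using complex V by (intro span_minimal) auto
    have L: "lorentzian (span {w, u})" using lorentzian_subspace[OF V sub complex(6,7)] .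
    note split = complement_split[OF subspace_span sub V(1) lorentzian_inner_products[OF subspace_span L]]
    obtain s y where sy: "e = s + y" "s \<in> span {w, u}" "y \<in> complement (span {w, u}) V"
      using split(1) e(1) by blast
    have "ap X s - x *\<^sub>R s \<in> span {w, u}"
      using sy(2) pres by (auto simp: preserves_def intro: span_diff span_scale)
    moreover have "ap X s - x *\<^sub>R s = - (ap X y - x *\<^sub>R y)"
      using e(4) by (simp add: sy(1) algebra_simps)
    moreover have "- (ap X y - x *\<^sub>R y) \<in> complement (span {w, u}) V"
      using sy(3) preserves_complement[OF X pres sub] subspace_complement[OF V(1)]
      by (auto simp: preserves_def intro!: subspace_neg subspace_diff subspace_scale simp del: minus_diff_eq)
    ultimately have "ap X s - x *\<^sub>R s \<in> span {w, u} \<inter> complement (span {w, u}) V"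
      by (simp only: Int_iff)
    then have "ap X s - x *\<^sub>R s = 0" unfolding split(2) by simp
    then have "s = 0" using complex_plane_no_real_eigenvector[OF complex(3-5) sy(2), of x] by simp
    then have "e \<in> complement (span {w, u}) V" using sy by simp
    then have "q e e > 0" using posdef_complement[OF V sub complex(6,7)] e(2) by (auto simp: posdef_def)
    with e(3) show ?thesis by simp
  next
    case (two_step e f \<kappa> t)
    show ?thesis
    proof (rule reduce[of "{e, f}" t])
      show "preserves X (span {e, f})"
        using two_step in_span_pair(3)[of \<kappa> e 0 f] in_span_pair(3)[of 1 e \<kappa> f]
        by (intro preserves_span_pair) (auto simp: add.commute)
      show "{e, f} \<subseteq> chain_vectors X V"
        using two_step chain_vectorsI[of e V X \<kappa> 0 0] chain_vectorsI[of f V X \<kappa> e 0] by auto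
    qed (use two_step in auto)
  next
    case (three_step e w f \<kappa> t)
    show ?thesis
    proof (rule reduce[of "{e, w, f}" t])
      show "preserves X (span {e, w, f})"
        using three_step by (intro preserves_span) (auto intro!: span_add span_scale intro: span_base)
      show "{e, w, f} \<subseteq> chain_vectors X V"
        using three_step chain_vectorsI[of e V X \<kappa> 0 0] chain_vectorsI[of w V X \<kappa> e 0]
          chain_vectorsI[of f V X \<kappa> w e] by auto
    qed (use three_step in auto)
  qed
qed

text \<open>
  On a Jordan chain of length at most three, \<open>X - \<mu>\<close> is nilpotent of order three, and the logarithm
  of the unipotent endomorphism \<open>exp(-\<mu>) exp(X)\<close> is a quadratic polynomial in it.
\<close>

lemma log_on_chain_vector:
  assumes "ap ((X - \<mu> *\<^sub>R 1) ^ 3) v = 0"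
  defines "U \<equiv> exp (- \<mu>) *\<^sub>R exp X - 1"
  shows "ap X v = \<mu> *\<^sub>R v + ap U v - (1/2) *\<^sub>R ap U (ap U v)" and "ap (U ^ 3) v = 0"
proof -
  define N where "N = X - \<mu> *\<^sub>R 1"
  have N3: "ap N (ap N (ap N v)) = 0" using assms(1) by (simp add: N_def power3_eq_cube)
  have X: "ap X y = \<mu> *\<^sub>R y + ap N y" for y by (simp add: N_def)
  have E: "ap (exp X) y = exp \<mu> *\<^sub>R (y + ap N y + (1/2) *\<^sub>R ap N (ap N y))"
    if "ap N (ap N (ap N y)) = 0" for y
    using exp_on_jordan_chain[OF X that, of 1] by simp
  have U: "ap U y = ap N y + (1/2) *\<^sub>R ap N (ap N y)" if "ap N (ap N (ap N y)) = 0" for y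
    unfolding U_def by (simp add: E[OF that] scaleR_add_right exp_minus)
  have U1: "ap U v = ap N v + (1/2) *\<^sub>R ap N (ap N v)" using U N3 by blast
  have UN: "ap U (ap N v) = ap N (ap N v)" "ap U (ap N (ap N v)) = 0"
    using U[of "ap N v"] U[of "ap N (ap N v)"] by (simp_all add: N3)
  have U2: "ap U (ap U v) = ap N (ap N v)" by (simp add: U1 UN)
  show "ap X v = \<mu> *\<^sub>R v + ap U v - (1/2) *\<^sub>R ap U (ap U v)"
    unfolding U2 unfolding U1 by (simp add: X)
  show "ap (U ^ 3) v = 0" using U2 UN by (simp add: power3_eq_cube)
qed

text \<open>
  For generalized eigenvectors \<open>v\<close> and \<open>w\<close>, symmetry of \<open>C\<close> relates the numbers \<open>q(D\<^sup>i v, E\<^sup>j w)\<close> with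
  \<open>i + j = k\<close> to those with \<open>i + j = k + 1\<close>. They vanish for large \<open>k\<close>, hence by downward induction for all.
\<close>

lemma chains_orthogonal:
  assumes C: "preserves C V" "symmetric_on C V" and V: "subspace V" and vw: "v \<in> V" "w \<in> V" and "a \<noteq> b"
    and v: "ap ((C - a *\<^sub>R 1) ^ 3) v = 0" and w: "ap ((C - b *\<^sub>R 1) ^ 3) w = 0"
  shows "q v w = 0"
proof -
  define D E where "D = C - a *\<^sub>R 1" and "E = C - b *\<^sub>R 1"
  have mem: "ap (D ^ i) v \<in> V" "ap (E ^ i) w \<in> V" for i
  proof -
    have "preserves D V" "preserves E V"
      using C(1) V by (auto simp: preserves_def D_def E_def subspace_diff subspace_scale)
    then show "ap (D ^ i) v \<in> V" "ap (E ^ i) w \<in> V"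
      using preserves_power[of _ V i] vw by (auto simp: preserves_def)
  qed
  have rec: "(b - a) * q (ap (D ^ i) v) (ap (E ^ j) w)
      = q (ap (D ^ Suc i) v) (ap (E ^ j) w) - q (ap (D ^ i) v) (ap (E ^ Suc j) w)" for i j
  proof -
    have "q (ap C (ap (D ^ i) v)) (ap (E ^ j) w) = q (ap (D ^ i) v) (ap C (ap (E ^ j) w))"
      using C(2) mem by (simp add: symmetric_on_def)
    then show ?thesis by (simp add: algebra_simps) (simp add: D_def E_def algebra_simps)
  qed
  have "q (ap (D ^ i) v) (ap (E ^ j) w) = 0" if "i + j = k" for i j k
    using that
  proof (induction "6 - k" arbitrary: i j k rule: less_induct)
    case less
    show ?case
    proof (cases "i \<ge> 3 \<or> j \<ge> 3")
      case True
      then have "ap (D ^ i) v = 0 \<or> ap (E ^ j) w = 0"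
      proof
        assume "i \<ge> 3"
        then have "D ^ i = D ^ (i - 3) * D ^ 3" by (simp flip: power_add)
        then show ?thesis using v by (simp add: D_def)
      next
        assume "j \<ge> 3"
        then have "E ^ j = E ^ (j - 3) * E ^ 3" by (simp flip: power_add)
        then show ?thesis using w by (simp add: E_def)
      qed
      then show ?thesis by auto
    next
      case False
      then have "6 - Suc k < 6 - k" using less.prems by linarith
      then have "q (ap (D ^ Suc i) v) (ap (E ^ j) w) = 0" "q (ap (D ^ i) v) (ap (E ^ Suc j) w) = 0"
        using less.hyps[of "Suc k" "Suc i" j] less.hyps[of "Suc k" i "Suc j"] less.prems by simp_all
      then show ?thesis using rec[of i j] \<open>a \<noteq> b\<close> by simp
    qed
  qed
  from this[of 0 0 0] show ?thesis by simp
qed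

text \<open>
  It suffices to show \<open>q(X x, y) = q(x, Y y)\<close> for Jordan chain vectors \<open>x\<close> of \<open>X\<close> and \<open>y\<close> of \<open>Y\<close>, as these
  span. If they belong to the same eigenvalue, then \<open>X x\<close> and \<open>Y y\<close> are obtained from \<open>x\<close> and \<open>y\<close> by the
  same polynomial in the symmetric endomorphism \<open>exp X = exp Y\<close>. Otherwise they are generalized
  eigenvectors of \<open>exp X\<close> for different eigenvalues, and both sides vanish.
\<close>

lemma real_logarithm_unique:
  assumes V: "subspace V" "lorentzian V"
    and X: "preserves X V" "symmetric_on X V" "V \<subseteq> span (chain_vectors X V)"
    and Y: "preserves Y V" "symmetric_on Y V" "V \<subseteq> span (chain_vectors Y V)"
    and eq: "\<And>v. v \<in> V \<Longrightarrow> ap (exp X) v = ap (exp Y) v" and v: "v \<in> V"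
  shows "ap X v = ap Y v"
proof -
  let ?U = "\<lambda>\<mu> Z. exp (- \<mu>) *\<^sub>R exp Z - 1"
  have P: "preserves (exp X) V" "symmetric_on (exp X) V"
    using preserves_exp symmetric_on_exp V X by auto
  have chain: "q (ap X x) y = q x (ap Y y)"
    if x: "x \<in> V" "ap ((X - \<mu> *\<^sub>R 1) ^ 3) x = 0" and y: "y \<in> V" "ap ((Y - \<nu> *\<^sub>R 1) ^ 3) y = 0" for x y \<mu> \<nu>
  proof (cases "\<mu> = \<nu>")
    case True
    define U where "U = ?U \<mu> X"
    have U: "preserves U V" "symmetric_on U V"
      using P V by (auto simp: U_def preserves_def symmetric_on_def subspace_diff subspace_scale)
    have UY: "ap (?U \<mu> Y) z = ap U z" if "z \<in> V" for z using eq[OF that] by (simp add: U_def)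
    have "ap U y \<in> V" using U(1) y(1) by (simp add: preserves_def)
    then have "ap Y y = \<mu> *\<^sub>R y + ap U y - (1/2) *\<^sub>R ap U (ap U y)"
      using log_on_chain_vector(1)[OF y(2)] unfolding True[symmetric] UY[OF y(1)] by (simp only: UY)
    moreover have "ap X x = \<mu> *\<^sub>R x + ap U x - (1/2) *\<^sub>R ap U (ap U x)"
      using log_on_chain_vector(1)[OF x(2)] by (simp add: U_def)
    moreover have "q (ap U x) y = q x (ap U y)" "q (ap U (ap U x)) y = q x (ap U (ap U y))"
      using U x(1) y(1) by (auto simp: symmetric_on_def preserves_def)
    ultimately show ?thesis by simp
  next
    case False
    have exp_chain: "ap ((exp X - exp \<mu> *\<^sub>R 1) ^ 3) z = 0" if "ap ((X - \<mu> *\<^sub>R 1) ^ 3) z = 0" for z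
    proof -
      have "exp X - exp \<mu> *\<^sub>R 1 = exp \<mu> *\<^sub>R ?U \<mu> X" by (simp add: scaleR_diff_right exp_minus)
      then show ?thesis using log_on_chain_vector(2)[OF that] by (simp add: scaleR_power)
    qed
    have exp_chain': "ap ((exp X - exp \<nu> *\<^sub>R 1) ^ 3) z = 0" if "z \<in> V" "ap ((Y - \<nu> *\<^sub>R 1) ^ 3) z = 0" for z
    proof -
      have D: "ap (exp X - exp \<nu> *\<^sub>R 1) z' = ap (exp \<nu> *\<^sub>R ?U \<nu> Y) z'" if "z' \<in> V" for z'
        using eq[OF that] by (simp add: scaleR_diff_right exp_minus)
      have "preserves (exp \<nu> *\<^sub>R ?U \<nu> Y) V"
        using preserves_exp[OF V(1) Y(1)] V(1) by (auto simp: preserves_def subspace_diff subspace_scale)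
      then have "ap ((exp X - exp \<nu> *\<^sub>R 1) ^ 3) z = ap ((exp \<nu> *\<^sub>R ?U \<nu> Y) ^ 3) z"
        using D \<open>z \<in> V\<close> unfolding preserves_def power3_eq_cube ap_simps(6) by metis
      then show ?thesis using log_on_chain_vector(2)[OF that(2)] by (simp add: scaleR_power)
    qed
    have orth: "q x' y' = 0" if "x' \<in> V" "ap ((X - \<mu> *\<^sub>R 1) ^ 3) x' = 0" "y' \<in> V" "ap ((Y - \<nu> *\<^sub>R 1) ^ 3) y' = 0" for x' y'
      using chains_orthogonal[OF P V(1) that(1,3) _ exp_chain[OF that(2)] exp_chain'[OF that(3,4)]] False
      by simp
    have "ap ((X - \<mu> *\<^sub>R 1) ^ 3) (ap X x) = ap X (ap ((X - \<mu> *\<^sub>R 1) ^ 3) x)"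
      "ap ((Y - \<nu> *\<^sub>R 1) ^ 3) (ap Y y) = ap Y (ap ((Y - \<nu> *\<^sub>R 1) ^ 3) y)"
      by (simp_all add: power3_eq_cube)
    then have "q (ap X x) y = 0" "q x (ap Y y) = 0"
      using x y X(1) Y(1) by (auto intro!: orth simp: preserves_def)
    then show ?thesis by simp
  qed
  have right: "q (ap X x) y = q x (ap Y y)" if x: "x \<in> chain_vectors X V" and y: "y \<in> V" for x y
  proof -
    have "linear (\<lambda>y. q (ap X x) y)" "linear (\<lambda>y. q x (ap Y y))"
      using linear_compose[OF linear_ap linear_right] by (auto simp: linear_right comp_def)
    from linear_eq_on_span[OF this, of "chain_vectors Y V" y]
    show ?thesis using chain x y Y(3) unfolding chain_vectors_def by blast
  qed
  have both: "q (ap X x) y = q x (ap Y y)" if x: "x \<in> V" and y: "y \<in> V" for x y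
  proof -
    have "linear (\<lambda>x. q (ap X x) y)" "linear (\<lambda>x. q x (ap Y y))"
      using linear_compose[OF linear_ap linear_left] by (auto simp: linear_left comp_def)
    from linear_eq_on_span[OF this, of "chain_vectors X V" x]
    show ?thesis using right x y X(3) by blast
  qed
  have "q (ap X v - ap Y v) w = 0" if "w \<in> V" for w
    using both[OF v that] Y(2) v that by (simp add: symmetric_on_def)
  moreover have "ap X v - ap Y v \<in> V"
    using v X(1) Y(1) V(1) by (auto simp: preserves_def subspace_diff)
  ultimately have "ap X v - ap Y v = 0" using lorentzian_nondegenerate[OF V(2)] by blast
  then show ?thesis by simp
qed

section \<open>Symmetric logarithms\<close>

definition log_on :: "'a endo \<Rightarrow> 'a endo \<Rightarrow> 'a set \<Rightarrow> bool" where
  "log_on X A V \<longleftrightarrow> preserves X V \<and> symmetric_on X V \<and> (\<forall>v\<in>V. ap (exp X) v = ap A v)"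

text \<open>
  Every symmetric logarithm of \<open>A\<close> commutes with \<open>A\<close>. When all symmetric endomorphisms which do so share
  the eigenvector \<open>e\<close>, an eigenvector that is not spacelike, then \<open>A\<close> has at most one logarithm.
\<close>

definition rigid :: "'a \<Rightarrow> 'a endo \<Rightarrow> 'a set \<Rightarrow> bool" where
  "rigid e A V \<longleftrightarrow> (\<forall>X. preserves X V \<and> symmetric_on X V \<and> (\<forall>v\<in>V. ap X (ap A v) = ap A (ap X v)) \<longrightarrow>
     (\<exists>x. ap X e = x *\<^sub>R e))"

lemma rigid_simple:
  assumes "e \<in> V" "ap A e = \<kappa> *\<^sub>R e" "\<And>v. v \<in> V \<Longrightarrow> ap A v = \<kappa> *\<^sub>R v \<Longrightarrow> v \<in> span {e}"
  shows "rigid e A V"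
  unfolding rigid_def
proof (intro allI impI, elim conjE)
  fix X assume X: "preserves X V" "\<forall>v\<in>V. ap X (ap A v) = ap A (ap X v)"
  then have "ap A (ap X e) = \<kappa> *\<^sub>R ap X e" using assms(1,2) by (metis ap_linear_simps(5))
  then have "ap X e \<in> span {e}" using assms(1,3) X(1) by (auto simp: preserves_def)
  then show "\<exists>x. ap X e = x *\<^sub>R e" by (auto simp: span_singleton)
qed

text \<open>
  The vectors that lie in both the kernel and the image of \<open>A - \<kappa>\<close> form a totally isotropic subspace, which in Lorentzian
  signature is a line. It is invariant under everything that commutes with \<open>A\<close>.
\<close>

lemma rigid_chain:
  assumes V: "subspace V" "lorentzian V" and A: "symmetric_on A V"
    and e: "e \<in> V" "e \<noteq> 0" "ap A e = \<kappa> *\<^sub>R e" and f: "f \<in> V" "ap A f = \<kappa> *\<^sub>R f + e"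
  shows "rigid e A V"
  unfolding rigid_def
proof (intro allI impI, elim conjE)
  fix X assume X: "preserves X V" "symmetric_on X V" "\<forall>v\<in>V. ap X (ap A v) = ap A (ap X v)"
  have mem: "ap X e \<in> V" "ap X f \<in> V" using X(1) e f by (auto simp: preserves_def)
  have Xe: "ap A (ap X e) = \<kappa> *\<^sub>R ap X e" using X(3) e(1,3) by (metis ap_linear_simps(5))
  have Xf: "ap A (ap X f) = \<kappa> *\<^sub>R ap X f + ap X e" using X(3) f by (metis ap_linear_simps(2,5))
  have isotropic: "q b c = 0" if "a \<in> V" "b \<in> V" "c \<in> V" "ap A a = \<kappa> *\<^sub>R a + b" "ap A c = \<kappa> *\<^sub>R c" for a b c
  proof -
    have "q (ap A a) c = q a (ap A c)" using A that(1,3) by (auto simp: symmetric_on_def)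
    then show ?thesis using that by simp
  qed
  have "q e e = 0" "q e (ap X e) = 0" "q (ap X e) (ap X e) = 0"
    using isotropic[OF f(1) e(1) e(1) f(2) e(3)] isotropic[OF f(1) e(1) mem(1) f(2) Xe]
      isotropic[OF mem(2,1,1) Xf Xe] by auto
  then show "\<exists>x. ap X e = x *\<^sub>R e"
    using nonspacelike_orthogonal_dependent[OF V e(1) mem(1)] e(2) by auto
qed

lemma rigid_log:
  assumes "rigid e A V" "log_on X A V" "e \<in> V" "e \<noteq> 0" "ap A e = \<kappa> *\<^sub>R e"
  obtains x where "ap X e = x *\<^sub>R e" "\<kappa> > 0"
proof -
  have X: "preserves X V" "symmetric_on X V" "\<And>v. v \<in> V \<Longrightarrow> ap (exp X) v = ap A v"
    using assms(2) by (auto simp: log_on_def)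
  have "ap X (ap A v) = ap A (ap X v)" if "v \<in> V" for v
    using X(3)[OF that] X(3)[of "ap X v"] that X(1) exp_commute_ap[of X v] by (simp add: preserves_def)
  then obtain x where x: "ap X e = x *\<^sub>R e" using assms(1) X(1,2) unfolding rigid_def by blast
  have "exp x *\<^sub>R e = \<kappa> *\<^sub>R e"
    using exp_on_eigenvector[OF x, of 1] X(3)[OF assms(3)] assms(5) by auto
  then have "\<kappa> = exp x" using assms(4) by simp
  then show ?thesis using that[OF x] by simp
qed

text \<open>
  A logarithm with the nonspacelike eigenvector \<open>e\<close> has only real eigenvalues, and those are unique.
\<close>

lemma rigid_log_unique:
  assumes V: "subspace V" "lorentzian V" and e: "rigid e A V" "e \<in> V" "e \<noteq> 0" "q e e \<le> 0" "ap A e = \<kappa> *\<^sub>R e"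
    and X: "log_on X A V" and Y: "log_on Y A V" and v: "v \<in> V"
  shows "ap X v = ap Y v"
proof -
  obtain x where x: "ap X e = x *\<^sub>R e" by (rule rigid_log[OF e(1) X e(2,3,5)])
  obtain y where y: "ap Y e = y *\<^sub>R e" by (rule rigid_log[OF e(1) Y e(2,3,5)])
  have X': "preserves X V" "symmetric_on X V" and Y': "preserves Y V" "symmetric_on Y V"
    using X Y by (auto simp: log_on_def)
  have "ap (exp X) z = ap (exp Y) z" if "z \<in> V" for z
    using X Y that by (simp add: log_on_def)
  from real_logarithm_unique[OF V X' span_chain_vectors[OF V X' e(2-4) x]
      Y' span_chain_vectors[OF V Y' e(2-4) y] this v]
  show ?thesis by simp
qed

end

section \<open>Differentiating an inverse\<close>

text \<open>
  The resolvent identity \<open>R s - R t = - R s (M s - M t) R t\<close> first bounds \<open>R s\<close> near \<open>t\<close>, then shows that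
  \<open>R\<close> is continuous, and finally that it is differentiable.
\<close>

lemma has_vector_derivative_inverse_of:
  fixes M R :: "real \<Rightarrow> 'b::real_normed_algebra_1"
  assumes M: "(M has_vector_derivative M') (at t within T)" and t: "t \<in> T"
    and inv: "\<And>s. s \<in> T \<Longrightarrow> R s * M s = 1" "\<And>s. s \<in> T \<Longrightarrow> M s * R s = 1"
  shows "(R has_vector_derivative - (R t * M' * R t)) (at t within T)"
proof -
  let ?F = "at t within T"
  have in_T: "\<forall>\<^sub>F s in ?F. s \<in> T" by (simp add: eventually_at_filter)
  have diff: "R s - R t = - (R s * (M s - M t) * R t)" if "s \<in> T" for s
    using inv(1)[OF that] inv(2)[OF t] by (simp add: algebra_simps mult.assoc)
  have contM: "(M \<longlongrightarrow> M t) ?F"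
    using has_vector_derivative_continuous[OF M] by (simp add: continuous_within)
  have "((\<lambda>s. norm (M s - M t) * norm (R t)) \<longlongrightarrow> norm (M t - M t) * norm (R t)) ?F"
    by (intro tendsto_intros contM)
  then have "\<forall>\<^sub>F s in ?F. norm (M s - M t) * norm (R t) < 1/2"
    by (intro order_tendstoD(2)[where y = 0]) auto
  with in_T have bound: "\<forall>\<^sub>F s in ?F. norm (R s - R t) \<le> 2 * norm (R t) * norm (M s - M t) * norm (R t)"
  proof eventually_elim
    case (elim s)
    have d: "norm (R s - R t) \<le> norm (R s) * norm (M s - M t) * norm (R t)"
      unfolding diff[OF elim(1)] norm_minus_cancel
      by (meson norm_mult_ineq order_trans mult_right_mono norm_ge_zero)
    also have "\<dots> \<le> norm (R s) * (1/2)"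
      unfolding mult.assoc using elim(2) by (intro mult_left_mono) auto
    finally have "norm (R s) \<le> norm (R t) + norm (R s) / 2"
      using norm_triangle_ineq2[of "R s" "R t"] by simp
    then have "norm (R s) \<le> 2 * norm (R t)" by simp
    then have "norm (R s) * norm (M s - M t) * norm (R t) \<le> 2 * norm (R t) * norm (M s - M t) * norm (R t)"
      by (intro mult_right_mono) auto
    with d show ?case by linarith
  qed
  have "((\<lambda>s. 2 * norm (R t) * norm (M s - M t) * norm (R t)) \<longlongrightarrow> 2 * norm (R t) * norm (M t - M t) * norm (R t)) ?F"
    by (intro tendsto_intros contM)
  then have "((\<lambda>s. 2 * norm (R t) * norm (M s - M t) * norm (R t)) \<longlongrightarrow> 0) ?F" by simp
  then have contR: "((\<lambda>s. R s - R t) \<longlongrightarrow> 0) ?F"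
    using bound by (rule Lim_null_comparison[rotated])
  define r where "r s = norm (M s - M t - (s - t) *\<^sub>R M') / norm (s - t)" for s
  have r: "(r \<longlongrightarrow> 0) ?F"
    using M unfolding has_vector_derivative_def has_derivative_iff_norm r_def by simp
  have R: "(R \<longlongrightarrow> R t) ?F" using contR Lim_null by blast
  have "((\<lambda>s. norm (R s - R t) * (norm M' * norm (R t)) + norm (R s) * r s * norm (R t))
      \<longlongrightarrow> norm (0::'b) * (norm M' * norm (R t)) + norm (R t) * 0 * norm (R t)) ?F"
    by (intro tendsto_intros contR R r)
  then have lim: "((\<lambda>s. norm (R s - R t) * (norm M' * norm (R t)) + norm (R s) * r s * norm (R t)) \<longlongrightarrow> 0) ?F"
    by simp
  have ev: "\<forall>\<^sub>F s in ?F. norm (R s - R t - (s - t) *\<^sub>R - (R t * M' * R t)) / norm (s - t)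
      \<le> norm (R s - R t) * (norm M' * norm (R t)) + norm (R s) * r s * norm (R t)"
    using in_T eventually_at_filter[of "\<lambda>s. s \<noteq> t" t T, simplified]
  proof eventually_elim
    case (elim s)
    have "R s - R t - (s - t) *\<^sub>R - (R t * M' * R t)
        = - (R s * (M s - M t) * R t) + (s - t) *\<^sub>R (R t * M' * R t)"
      by (simp add: diff[OF elim(1)])
    also have "\<dots> =
       - ((s - t) *\<^sub>R ((R s - R t) * (M' * R t)) + R s * (M s - M t - (s - t) *\<^sub>R M') * R t)"
      by (simp add: algebra_simps)
    finally have eq: "R s - R t - (s - t) *\<^sub>R - (R t * M' * R t) =
       - ((s - t) *\<^sub>R ((R s - R t) * (M' * R t)) + R s * (M s - M t - (s - t) *\<^sub>R M') * R t)" .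
    have "norm (R s - R t - (s - t) *\<^sub>R - (R t * M' * R t)) \<le>
       \<bar>s - t\<bar> * (norm (R s - R t) * (norm M' * norm (R t)))
        + norm (R s) * norm (M s - M t - (s - t) *\<^sub>R M') * norm (R t)"
    proof -
      have "norm ((s - t) *\<^sub>R ((R s - R t) * (M' * R t))) \<le> \<bar>s - t\<bar> * (norm (R s - R t) * (norm M' * norm (R t)))"
        unfolding norm_scaleR
        by (intro mult_left_mono order_trans[OF norm_mult_ineq] norm_mult_ineq) auto
      moreover have "norm (R s * (M s - M t - (s - t) *\<^sub>R M') * R t)
          \<le> norm (R s) * norm (M s - M t - (s - t) *\<^sub>R M') * norm (R t)"
        by (meson norm_mult_ineq order_trans mult_right_mono norm_ge_zero)
      ultimately show ?thesis
        unfolding eq norm_minus_cancel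
        using norm_triangle_ineq[of "(s - t) *\<^sub>R ((R s - R t) * (M' * R t))"
          "R s * (M s - M t - (s - t) *\<^sub>R M') * R t"] by linarith
    qed
    then show ?case using elim(2) by (simp add: r_def field_simps)
  qed
  show ?thesis
    unfolding has_vector_derivative_def has_derivative_iff_norm
  proof (intro conjI)
    show "((\<lambda>s. norm (R s - R t - (s - t) *\<^sub>R - (R t * M' * R t)) / norm (s - t)) \<longlongrightarrow> 0) ?F"
      by (rule tendsto_sandwich[OF _ ev tendsto_const lim]) simp
  qed (rule bounded_linear_scaleR_left)
qed

lemma injective_endo_inverse:
  assumes "\<And>x. ap M x = 0 \<Longrightarrow> x = 0"
  obtains R where "R * M = 1" "M * R = 1"
proof -
  have "inj (ap M)" using assms linear_injective_0[OF linear_ap] by blast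
  then obtain f where f: "linear f" "\<And>x. f (ap M x) = x" "\<And>x. ap M (f x) = x"
    using linear_injective_isomorphism[OF linear_ap] by blast
  have "endo_of f * M = 1" "M * endo_of f = 1" using f by (auto intro!: endo_eqI)
  then show ?thesis using that by blast
qed

section \<open>Traces\<close>

lemma some_basis: "subspace S \<Longrightarrow> independent (some_basis S) \<and> span (some_basis S) = S"
  unfolding some_basis_def
  by (rule someI_ex) (metis basis_exists span_subspace)

text \<open>
  The trace of the endomorphism \<open>x \<mapsto> \<phi>(x) u\<close> is \<open>\<phi>(u)\<close>. As every endomorphism is a sum of such, this
  computes traces without reference to the basis in their definition.
\<close>

lemma trace_on_sum_rank_one:
  assumes S: "subspace S" and f: "\<And>x. x \<in> S \<Longrightarrow> f x = (\<Sum>i\<in>I. \<phi> i x *\<^sub>R u i)"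
    and lin: "\<And>i. i \<in> I \<Longrightarrow> linear (\<phi> i)" and u: "\<And>i. i \<in> I \<Longrightarrow> u i \<in> S"
  shows "trace_on S f = (\<Sum>i\<in>I. \<phi> i (u i))"
proof -
  define B where "B = some_basis S"
  have B: "independent B" "span B = S" using some_basis[OF S] by (auto simp: B_def)
  then have fin: "finite B" using independent_imp_finite by blast
  have "trace_on S f = (\<Sum>b\<in>B. representation B (f b) b)"
    by (simp add: trace_on_def B_def Let_def)
  also have "\<dots> = (\<Sum>b\<in>B. \<Sum>i\<in>I. \<phi> i b * representation B (u i) b)"
  proof (rule sum.cong[OF refl])
    fix b assume "b \<in> B"
    then have "f b = (\<Sum>i\<in>I. \<phi> i b *\<^sub>R u i)" using f B(2) span_base by blast
    then show "representation B (f b) b = (\<Sum>i\<in>I. \<phi> i b * representation B (u i) b)"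
    proof -
      have u': "u i \<in> span B" if "i \<in> I" for i using u[OF that] B(2) by simp
      then have "representation B (\<Sum>i\<in>I. \<phi> i b *\<^sub>R u i) b = (\<Sum>i\<in>I. representation B (\<phi> i b *\<^sub>R u i) b)"
        by (subst representation_sum[OF B(1)]) (auto intro: span_scale)
      with u' show ?thesis
        using \<open>f b = _\<close> by (simp add: representation_scale[OF B(1)])
    qed
  qed
  also have "\<dots> = (\<Sum>i\<in>I. \<Sum>b\<in>B. representation B (u i) b * \<phi> i b)"
    by (subst sum.swap) (simp add: mult.commute)
  also have "\<dots> = (\<Sum>i\<in>I. \<phi> i (u i))"
  proof (rule sum.cong[OF refl])
    fix i assume i: "i \<in> I"
    have "\<phi> i (u i) = \<phi> i (\<Sum>b\<in>B. representation B (u i) b *\<^sub>R b)"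
      using sum_representation_eq[OF B(1) _ fin subset_refl] u[OF i] B(2) by simp
    then show "(\<Sum>b\<in>B. representation B (u i) b * \<phi> i b) = \<phi> i (u i)"
      by (simp add: linear_sum[OF lin[OF i]] linear_cmul[OF lin[OF i]])
  qed
  finally show ?thesis .
qed

text \<open>
  The point \<open>q\<close> of the space of inner products on \<open>S\<close> is the origin of the coordinates used below: other forms on \<open>S\<close>
  are represented by endomorphisms, with respect to \<open>q\<close>.
\<close>

locale nondegenerate_form = symmetric_form q for q :: "'a::euclidean_space form" +
  fixes S P N :: "'a set"
  assumes basis: "orthonormal_basis P N S" and nontrivial: "S \<noteq> {0}"
begin

abbreviation "Bas \<equiv> P \<union> N"

lemma finite_Bas [simp]: "finite P" "finite N" and span_Bas: "span Bas = S" and Bas_subset: "b \<in> Bas \<Longrightarrow> b \<in> S"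
  and Bas_unit: "b \<in> Bas \<Longrightarrow> q b b * q b b = 1"
  and Bas_orth: "b \<in> Bas \<Longrightarrow> c \<in> Bas \<Longrightarrow> b \<noteq> c \<Longrightarrow> q b c = 0"
  using basis orthonormal_basis_subset[OF basis] by (auto simp: orthonormal_basis_def)

lemma subspace_S: "subspace S" using span_Bas subspace_span by blast

lemma dim_S: "dim S = card Bas"
  using orthonormal_basis_independent[OF basis] span_Bas by (metis dim_span_eq_card_independent)

lemma dim_pos: "dim S > 0"
  using nontrivial subspace_0[OF subspace_S] by (metis dim_eq_0 gr0I subset_singletonD empty_iff)

lemma S_not_zero [simp]: "\<not> S \<subseteq> {0}"
  using dim_pos by (metis dim_eq_0 less_irrefl)

lemma expand: "v \<in> S \<Longrightarrow> (\<Sum>b\<in>Bas. (q b b * q v b) *\<^sub>R b) = v"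
  using orthonormal_expansion(1)[OF basis, of v] by simp

lemma nondegenerate: "v \<in> S \<Longrightarrow> (\<And>w. w \<in> S \<Longrightarrow> q v w = 0) \<Longrightarrow> v = 0"
  using nondegenerate_of_basis[OF basis] .

lemma eq_on_S: "u \<in> S \<Longrightarrow> v \<in> S \<Longrightarrow> (\<And>w. w \<in> S \<Longrightarrow> q u w = q v w) \<Longrightarrow> u = v"
  using nondegenerate[of "u - v"] subspace_S by (simp add: subspace_diff)

text \<open>
  The trace on \<open>S\<close>, in terms of the orthonormal basis; as a function of arbitrary endomorphisms of
  the whole space it is linear and continuous.
\<close>

definition \<tau> :: "'a endo \<Rightarrow> real" where "\<tau> F = (\<Sum>b\<in>Bas. q b b * q (ap F b) b)"

lemma linear_\<tau>: "linear \<tau>"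
  by (auto intro!: linearI simp: \<tau>_def algebra_simps sum.distrib sum_distrib_left)

lemmas \<tau>_simps [simp] = linear_add[OF linear_\<tau>] linear_diff[OF linear_\<tau>] linear_neg[OF linear_\<tau>]
  linear_cmul[OF linear_\<tau>] linear_0[OF linear_\<tau>]

lemma trace_eq_\<tau>:
  assumes "preserves F S" "\<And>x. x \<in> S \<Longrightarrow> f x = ap F x" shows "trace_on S f = \<tau> F"
proof -
  have "trace_on S f = (\<Sum>b\<in>Bas. q b b * q (ap F b) b)"
  proof (rule trace_on_sum_rank_one[OF subspace_S, where u = "\<lambda>b. b" and \<phi> = "\<lambda>b x. q b b * q (ap F x) b"])
    show "f x = (\<Sum>b\<in>Bas. (q b b * q (ap F x) b) *\<^sub>R b)" if "x \<in> S" for x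
      using assms that expand[of "ap F x"] by (simp add: preserves_def)
  qed (auto intro!: linearI simp: algebra_simps Bas_subset)
  then show ?thesis by (simp add: \<tau>_def)
qed

lemma \<tau>_commute:
  assumes F: "preserves F S" and G: "preserves G S" shows "\<tau> (F * G) = \<tau> (G * F)"
proof -
  have "\<tau> (F * G) = (\<Sum>b\<in>Bas. \<Sum>c\<in>Bas. q b b * q c c * q (ap G b) c * q (ap F c) b)" if "preserves G S" for F G
  proof -
    have "q (ap F (ap G b)) b = (\<Sum>c\<in>Bas. q c c * q (ap G b) c * q (ap F c) b)" if "b \<in> Bas" for b
    proof -
      have "ap G b \<in> S" using that \<open>preserves G S\<close> Bas_subset by (auto simp: preserves_def)
      then have "q (ap F (ap G b)) b = q (ap F (\<Sum>c\<in>Bas. (q c c * q (ap G b) c) *\<^sub>R c)) b" by (simp only: expand)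
      then show ?thesis by (simp add: sum_left)
    qed
    then show ?thesis by (simp add: \<tau>_def sum_distrib_left mult.assoc)
  qed
  from this[OF G] this[OF F] show ?thesis by (subst (asm) (2) sum.swap) (simp add: mult_ac)
qed

lemma \<tau>_one: "\<tau> 1 = real (dim S)"
  by (simp add: \<tau>_def dim_S Bas_unit)

section \<open>The metric in terms of endomorphisms\<close>

text \<open>
  Raising an index: on \<open>S\<close>, this is the endomorphism \<open>H\<close> with \<open>h(x, y) = q(H x, y)\<close>. It depends linearly
  on the finitely many numbers \<open>h(c, b)\<close> by its very form, so that curves of forms are differentiated
  entry by entry.
\<close>

definition raise :: "'a form \<Rightarrow> 'a endo" where
  "raise h = (\<Sum>b\<in>Bas. \<Sum>c\<in>Bas. (q b b * q c c * h c b) *\<^sub>R endo_of (\<lambda>x. q x c *\<^sub>R b))"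

lemma ap_raise: "ap (raise h) x = (\<Sum>b\<in>Bas. \<Sum>c\<in>Bas. (q b b * q c c * h c b * q x c) *\<^sub>R b)"
proof -
  have "ap (endo_of (\<lambda>x. q x c *\<^sub>R b)) x = q x c *\<^sub>R b" for c b
    by (subst ap_endo_of) (auto intro!: linearI simp: algebra_simps)
  then show ?thesis by (simp add: raise_def ap_sum)
qed

lemma raise_in_S [simp]: "ap (raise h) x \<in> S"
  unfolding ap_raise by (intro subspace_sum subspace_S subspace_scale Bas_subset)

lemma preserves_raise [simp]: "preserves (raise h) S"
  by (simp add: preserves_def)

lemma raise_add_scale: "raise (\<lambda>x y. h x y + e * k x y) = raise h + e *\<^sub>R raise k"
  by (simp add: raise_def algebra_simps sum.distrib scaleR_sum_right)

lemma sym_forms_sum: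
  assumes "h \<in> sym_forms S" "y \<in> S" "\<And>i. i \<in> I \<Longrightarrow> v i \<in> S"
  shows "h (\<Sum>i\<in>I. r i *\<^sub>R v i) y = (\<Sum>i\<in>I. r i * h (v i) y)"
proof -
  have add: "h (x + z) y = h x y + h z y" if "x \<in> S" "z \<in> S" for x z
    using assms(1,2) that by (auto simp: sym_forms_def)
  have scale: "h (r *\<^sub>R x) y = r * h x y" if "x \<in> S" for x r
    using assms(1,2) that by (auto simp: sym_forms_def)
  have zero: "h 0 y = 0" using scale[of 0 0] subspace_0[OF subspace_S] by simp
  show ?thesis
    using assms(3)
  proof (induction I rule: infinite_finite_induct)
    case (insert i I)
    then show ?case
      using add[of "r i *\<^sub>R v i" "\<Sum>i\<in>I. r i *\<^sub>R v i"]
      by (simp add: subspace_S subspace_scale subspace_sum scale)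
  qed (simp_all add: zero)
qed

lemma q_raise:
  assumes h: "h \<in> sym_forms S" and xy: "x \<in> S" "y \<in> S"
  shows "q (ap (raise h) x) y = h x y"
proof -
  have coeff: "h z w = (\<Sum>c\<in>Bas. q c c * q z c * h c w)" if "z \<in> S" "w \<in> S" for z w
    using sym_forms_sum[OF h that(2), of Bas "\<lambda>c. c" "\<lambda>c. q c c * q z c"] Bas_subset expand[OF that(1)]
    by simp
  have sym_h: "h z w = h w z" if "z \<in> S" "w \<in> S" for z w using h that by (auto simp: sym_forms_def)
  have "q (ap (raise h) x) y = (\<Sum>b\<in>Bas. q b b * q y b * (\<Sum>c\<in>Bas. q c c * q x c * h c b))"
    by (simp add: ap_raise sum_left sum_distrib_left mult_ac sym[of y])
  also have "\<dots> = (\<Sum>b\<in>Bas. q b b * q y b * h b x)"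
    using coeff[OF xy(1)] sym_h xy(1) Bas_subset by (intro sum.cong) auto
  also have "\<dots> = h y x" using coeff[OF xy(2,1)] by simp
  finally show ?thesis using sym_h xy by simp
qed

definition \<pi> :: "'a endo" where "\<pi> = raise (restrict_form q S)"

lemma restrict_q: "restrict_form q S \<in> sym_forms S"
  using restrict_form_in_sym_forms[OF subspace_S] .

lemma \<pi>_in_S [simp]: "ap \<pi> x \<in> S" by (simp add: \<pi>_def)

lemma \<pi>_id [simp]: "x \<in> S \<Longrightarrow> ap \<pi> x = x"
  using q_raise[OF restrict_q] by (intro eq_on_S) (auto simp: \<pi>_def restrict_form_def)

lemma q_\<pi>: assumes "c \<in> Bas" shows "q (ap \<pi> x) c = q x c"
proof -
  have "ap \<pi> x = (\<Sum>b\<in>Bas. (q b b * q x b) *\<^sub>R b)"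
    unfolding \<pi>_def ap_raise
  proof (rule sum.cong[OF refl])
    fix b assume b: "b \<in> Bas"
    have "(\<Sum>c\<in>Bas. (q b b * q c c * restrict_form q S c b * q x c) *\<^sub>R b)
        = (\<Sum>c\<in>Bas. if c = b then (q b b * q x b) *\<^sub>R b else 0)"
      using b Bas_orth Bas_unit Bas_subset by (intro sum.cong) (auto simp: restrict_form_def mult_ac)
    then show "(\<Sum>c\<in>Bas. (q b b * q c c * restrict_form q S c b * q x c) *\<^sub>R b) = (q b b * q x b) *\<^sub>R b"
      using b by simp
  qed
  then have "q (ap \<pi> x) c = (\<Sum>b\<in>Bas. q b b * q x b * q b c)" by (simp add: sum_left)
  also have "\<dots> = (\<Sum>b\<in>Bas. if b = c then q x c else 0)"
    using assms Bas_orth Bas_unit by (intro sum.cong) (auto simp: mult_ac)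
  finally show ?thesis using assms by simp
qed

lemma raise_\<pi>: "ap (raise h) (ap \<pi> x) = ap (raise h) x"
  unfolding ap_raise by (intro sum.cong) (auto simp: q_\<pi>)

text \<open>
  The endomorphism of \<open>p\<close> is extended by the identity on the kernel of the projection \<open>\<pi>\<close>. The result
  is invertible on the whole space if \<open>p\<close> is nondegenerate, and it is \<open>1\<close> for \<open>p = q\<close>.
\<close>

definition op_of :: "'a form \<Rightarrow> 'a endo" where "op_of p = raise p + (1 - \<pi>)"

lemma op_of_eq: "x \<in> S \<Longrightarrow> ap (op_of p) x = ap (raise p) x"
  by (simp add: op_of_def)

lemma op_of_q: "op_of (restrict_form q S) = 1"
  by (simp add: op_of_def \<pi>_def)

lemma op_of_inverse_preserves:
  assumes "op_of p * R = 1" shows "preserves R S"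
  unfolding preserves_def
proof
  fix y assume y: "y \<in> S"
  have "y = ap (op_of p) (ap R y)" using assms by (metis ap_simps(2,6))
  then have "y = ap (raise p) (ap R y) + (ap R y - ap \<pi> (ap R y))" by (simp add: op_of_def)
  then have "ap R y - ap \<pi> (ap R y) = y - ap (raise p) (ap R y)" by (simp add: algebra_simps)
  then have "ap R y = ap \<pi> (ap R y) + (y - ap (raise p) (ap R y))" by (simp add: algebra_simps)
  also have "\<dots> \<in> S" using y by (intro subspace_add subspace_diff subspace_S) auto
  finally show "ap R y \<in> S" .
qed

lemma raised_equation:
  assumes p: "p \<in> sym_forms S" and R: "R * op_of p = 1" "op_of p * R = 1"
    and "h \<in> sym_forms S" "x \<in> S" "z \<in> S"
  shows "(\<forall>y\<in>S. p z y = h x y) \<longleftrightarrow> z = ap R (ap (raise h) x)"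
proof -
  have "(\<forall>y\<in>S. p z y = h x y) \<longleftrightarrow> (\<forall>y\<in>S. q (ap (op_of p) z) y = q (ap (raise h) x) y)"
    using assms by (simp add: q_raise op_of_eq)
  also have "\<dots> \<longleftrightarrow> ap (op_of p) z = ap (raise h) x"
    using eq_on_S assms(6) by (auto simp: op_of_eq)
  also have "\<dots> \<longleftrightarrow> z = ap R (ap (raise h) x)"
    using R by (metis ap_simps(2,6))
  finally show ?thesis .
qed

lemma generator_eq:
  assumes p: "p \<in> sym_forms S" and R: "R * op_of p = 1" "op_of p * R = 1"
    and h: "h \<in> sym_forms S" and x: "x \<in> S"
  shows "generator S p h x = (1/2) *\<^sub>R ap (R * raise h) x"
proof -
  have RS: "ap R (ap (raise h) x) \<in> S"
    using op_of_inverse_preserves[OF R(2)] by (simp add: preserves_def)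
  have "(THE z. z \<in> S \<and> (\<forall>y\<in>S. p z y = h x y)) = ap R (ap (raise h) x)"
    using RS raised_equation[OF p R h x] by (intro the_equality) auto
  then show ?thesis by (simp add: generator_def)
qed

text \<open>
  The metric has the form \<open>2n tr(XY) + \<gamma> tr(X) tr(Y)\<close>: the Killing form of the traceless parts contributes
  \<open>2n tr(XY) - 2 tr(X) tr(Y)\<close>, the factor \<open>R\<^sup>+\<close> contributes the rest of \<open>\<gamma>\<close>.
\<close>

definition \<gamma> :: real where "\<gamma> = 1 / (real (dim S))\<^sup>2 - 2"

lemma metric_eq:
  assumes p: "p \<in> sym_forms S" and R: "R * op_of p = 1" "op_of p * R = 1"
    and h: "h \<in> sym_forms S" and k: "k \<in> sym_forms S"
  shows "metric S p h k = (2 * real (dim S) * \<tau> ((R * raise h) * (R * raise k))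
     + \<gamma> * (\<tau> (R * raise h) * \<tau> (R * raise k))) / 4"
proof -
  define X Y where "X = (1/2) *\<^sub>R (R * raise h)" and "Y = (1/2) *\<^sub>R (R * raise k)"
  let ?n = "real (dim S)"
  have n: "?n > 0" using dim_pos by simp
  have pres: "preserves X S" "preserves Y S"
    using op_of_inverse_preserves[OF R(2)] by (auto simp: preserves_def X_def Y_def subspace_S subspace_scale)
  have gX: "generator S p h x = ap X x" and gY: "generator S p k x = ap Y x" if "x \<in> S" for x
    using generator_eq[OF p R h that] generator_eq[OF p R k that] by (simp_all add: X_def Y_def)
  have tX: "trace_on S (generator S p h) = \<tau> X" and tY: "trace_on S (generator S p k) = \<tau> Y"
    using trace_eq_\<tau>[OF pres(1) gX] trace_eq_\<tau>[OF pres(2) gY] by auto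
  define X0 Y0 where "X0 = X - (\<tau> X / ?n) *\<^sub>R 1" and "Y0 = Y - (\<tau> Y / ?n) *\<^sub>R 1"
  have pres0: "preserves X0 S" "preserves Y0 S"
    using pres by (auto simp: X0_def Y0_def preserves_def subspace_S subspace_diff subspace_scale)
  have "trace_on S (traceless_part S (generator S p h) \<circ> traceless_part S (generator S p k)) = \<tau> (X0 * Y0)"
  proof (rule trace_eq_\<tau>)
    show "preserves (X0 * Y0) S" using pres0 by (simp add: preserves_def)
    show "(traceless_part S (generator S p h) \<circ> traceless_part S (generator S p k)) x = ap (X0 * Y0) x"
      if "x \<in> S" for x
    proof -
      have "traceless_part S (generator S p k) x = ap Y0 x"
        using that by (simp add: traceless_part_def tY gY Y0_def)
      moreover have "traceless_part S (generator S p h) (ap Y0 x) = ap X0 (ap Y0 x)"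
        using that pres0 by (simp add: traceless_part_def tX gX X0_def preserves_def del: ap_linear_simps)
      ultimately show ?thesis by simp
    qed
  qed
  also have "X0 * Y0 = X * Y - (\<tau> Y / ?n) *\<^sub>R X - (\<tau> X / ?n) *\<^sub>R Y + (\<tau> X / ?n * (\<tau> Y / ?n)) *\<^sub>R 1"
    by (simp add: X0_def Y0_def algebra_simps)
  finally have T: "trace_on S (traceless_part S (generator S p h) \<circ> traceless_part S (generator S p k))
      = \<tau> (X * Y - (\<tau> Y / ?n) *\<^sub>R X - (\<tau> X / ?n) *\<^sub>R Y + (\<tau> X / ?n * (\<tau> Y / ?n)) *\<^sub>R 1)" .
  have K: "killing_sl S (traceless_part S (generator S p h)) (traceless_part S (generator S p k))
      = 2 * ?n * (\<tau> (X * Y) - \<tau> X * \<tau> Y / ?n)"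
    unfolding killing_sl_def T using n by (simp add: \<tau>_one field_simps)
  define m where "m = real (dim S)"
  have "m \<noteq> 0" using n by (simp add: m_def)
  then have "metric S p h k = 2 * m * \<tau> (X * Y) + \<gamma> * (\<tau> X * \<tau> Y)"
    unfolding metric_def Let_def tX tY K \<gamma>_def m_def[symmetric]
    by (simp add: field_simps power2_eq_square)
  then have "metric S p h k = 2 * ?n * \<tau> (X * Y) + \<gamma> * (\<tau> X * \<tau> Y)"
    by (simp only: m_def)
  moreover have "\<tau> (X * Y) = \<tau> ((R * raise h) * (R * raise k)) / 4"
    by (simp add: X_def Y_def)
  moreover have "\<tau> X * \<tau> Y = \<tau> (R * raise h) * \<tau> (R * raise k) / 4"
    by (simp add: X_def Y_def)
  ultimately show ?thesis by (simp add: field_simps)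
qed

end

section \<open>The geodesic equation at a point\<close>

lemma derivative_unique_unit_interval:
  assumes "(f has_real_derivative D) (at t within {0..1})" "(f has_real_derivative D') (at t within {0..1})"
    and "t \<in> {0..1}"
  shows "D = D'"
  using assms vector_derivative_unique_within_closed_interval[of 0 1 t f D D']
  by (simp add: has_real_derivative_iff_has_vector_derivative)

text \<open>
  The conditions that define the symmetric forms are linear, and so are inherited by derivatives.
\<close>

lemma form_curve_deriv_sym_forms:
  assumes d: "form_curve_deriv c v" and c: "\<And>t. t \<in> {0..1} \<Longrightarrow> c t \<in> sym_forms S" and t: "t \<in> {0..1}"
    and S: "subspace S"
  shows "v t \<in> sym_forms S"
proof -
  have D: "((\<lambda>\<tau>. c \<tau> x y) has_real_derivative v t x y) (at t within {0..1})" for x y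
    using d t by (simp add: form_curve_deriv_def)
  have cong: "((\<lambda>\<tau>. c \<tau> x y) has_real_derivative D') (at t within {0..1})"
    if "(f has_real_derivative D') (at t within {0..1})" "\<And>\<tau>. \<tau> \<in> {0..1} \<Longrightarrow> f \<tau> = c \<tau> x y" for f D' x y
    by (rule has_field_derivative_transform_within[OF that(1) zero_less_one t]) (use that(2) in auto)
  note unique = derivative_unique_unit_interval[OF D cong t]
  show ?thesis
    unfolding sym_forms_def
  proof (intro CollectI conjI ballI allI impI)
    show "v t x y = v t y x" if "x \<in> S" "y \<in> S" for x y
      by (rule unique[OF D]) (use c that in \<open>auto simp: sym_forms_def\<close>)
    show "v t (x + y) z = v t x z + v t y z" if "x \<in> S" "y \<in> S" "z \<in> S" for x y z
      by (rule unique[OF DERIV_add[OF D D]]) (use c that in \<open>auto simp: sym_forms_def\<close>)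
    show "v t (r *\<^sub>R x) y = r * v t x y" if "x \<in> S" "y \<in> S" for x y r
      by (rule unique[OF DERIV_cmult[OF D]]) (use c that in \<open>auto simp: sym_forms_def\<close>)
    show "v t x y = 0" if "x \<notin> S \<or> y \<notin> S" for x y
      by (rule unique[OF DERIV_const]) (use c that in \<open>auto simp: sym_forms_def\<close>)
  qed
qed

lemma sym_forms_add_scale: "p \<in> sym_forms S \<Longrightarrow> w \<in> sym_forms S \<Longrightarrow> (\<lambda>x y. p x y + e * w x y) \<in> sym_forms S"
  by (auto simp: sym_forms_def algebra_simps)

context nondegenerate_form
begin

lemma op_of_inverse:
  assumes p: "p \<in> inner_products r s S"
  obtains R where "R * op_of p = 1" "op_of p * R = 1"
proof -
  have pS: "p \<in> sym_forms S" using p by (simp add: inner_products_def)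
  have lin: "linear (ap \<pi>)" by simp
  interpret p: symmetric_form "\<lambda>x y. p (ap \<pi> x) (ap \<pi> y)"
    using pS by unfold_locales (auto simp: sym_forms_def)
  have "restrict_form (\<lambda>x y. p (ap \<pi> x) (ap \<pi> y)) S = p"
    using pS by (auto simp: restrict_form_def sym_forms_def fun_eq_iff)
  then obtain P' N' where B: "p.orthonormal_basis P' N' S"
    using p p.inner_products_iff[OF subspace_S] by metis
  show ?thesis
  proof (rule injective_endo_inverse)
    fix x assume x: "ap (op_of p) x = 0"
    then have "ap \<pi> (ap (raise p) x + (x - ap \<pi> x)) = 0" by (simp add: op_of_def)
    then have "ap (raise p) x = 0" by simp
    with x have "x = ap \<pi> x" by (simp add: op_of_def)
    then have xS: "x \<in> S" by (metis \<pi>_in_S)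
    have "p x y = 0" if "y \<in> S" for y
      using q_raise[OF pS xS that] \<open>ap (raise p) x = 0\<close> by simp
    then show "x = 0" using p.nondegenerate_of_basis[OF B xS] xS by simp
  qed (rule that)
qed

lemma has_real_derivative_\<tau>:
  assumes "(F has_vector_derivative F') (at t within T)"
  shows "((\<lambda>t. \<tau> (F t)) has_real_derivative \<tau> F') (at t within T)"
  unfolding has_real_derivative_iff_has_vector_derivative
  using bounded_linear.has_vector_derivative[OF linear_endo_bounded[OF linear_\<tau>] assms] .

text \<open>
  The form \<open>q + e w\<close> is represented by \<open>1 + e W\<close>, which is invertible for small \<open>e\<close>; the derivative of the
  inverse at \<open>e = 0\<close> is \<open>- W\<close>.
\<close>

lemma metric_deriv_eq:
  assumes w: "w \<in> sym_forms S" and h: "h \<in> sym_forms S" and k: "k \<in> sym_forms S"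
  shows "metric_deriv S (restrict_form q S) w h k =
    (2 * real (dim S) * (- \<tau> (raise w * raise h * raise k) - \<tau> (raise h * raise w * raise k))
     + \<gamma> * (- \<tau> (raise w * raise h) * \<tau> (raise k) - \<tau> (raise h) * \<tau> (raise w * raise k))) / 4"
proof -
  define p where "p e = (\<lambda>x y. restrict_form q S x y + e * w x y)" for e
  define M where "M e = op_of (p e)" for e
  have M: "M e = 1 + e *\<^sub>R raise w" for e
    using op_of_q by (simp add: M_def p_def op_of_def raise_add_scale)
  \<comment> \<open>For \<open>e\<close> below \<open>d\<close> the norm of \<open>e W\<close> is less than \<open>1\<close>.\<close>
  define d where "d = 1 / (norm (raise w) + 1)"
  have d: "d > 0" by (simp add: d_def add_nonneg_pos)
  define T where "T = {-d<..<d}"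
  have "\<exists>R. R * M e = 1 \<and> M e * R = 1" if e: "e \<in> T" for e
  proof -
    have "\<bar>e\<bar> * norm (raise w) < 1"
    proof -
      have "\<bar>e\<bar> * norm (raise w) \<le> \<bar>e\<bar> * (norm (raise w) + 1)" by (intro mult_left_mono) auto
      also have "\<dots> < d * (norm (raise w) + 1)"
        using e by (intro mult_strict_right_mono) (auto simp: T_def add_nonneg_pos)
      also have "\<dots> = 1" by (simp add: d_def add_nonneg_eq_0_iff)
      finally show ?thesis .
    qed
    then have small: "norm (e *\<^sub>R raise w) < 1" by simp
    have "x = 0" if "ap (M e) x = 0" for x
    proof (rule ccontr)
      assume "x \<noteq> 0"
      have "x = - ap (e *\<^sub>R raise w) x" using that by (simp add: M eq_neg_iff_add_eq_0)
      then have "norm x \<le> norm (e *\<^sub>R raise w) * norm x"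
        using norm_ap[of "e *\<^sub>R raise w" x] by (metis norm_minus_cancel)
      also have "\<dots> < 1 * norm x" using small \<open>x \<noteq> 0\<close> by (intro mult_strict_right_mono) auto
      finally show False by simp
    qed
    then show ?thesis using injective_endo_inverse[of "M e"] by metis
  qed
  then obtain R where R: "\<And>e. e \<in> T \<Longrightarrow> R e * M e = 1" "\<And>e. e \<in> T \<Longrightarrow> M e * R e = 1" by metis
  have T: "0 \<in> T" "open T" using d by (auto simp: T_def)
  have R0: "R 0 = 1" using R(1)[OF T(1)] by (simp add: M)
  have "(M has_vector_derivative raise w) (at 0 within T)"
    unfolding M by (auto intro!: derivative_eq_intros)
  from has_vector_derivative_inverse_of[OF this T(1) R]
  have dR: "(R has_vector_derivative - raise w) (at 0 within T)" by (simp add: R0)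
  have dRF: "((\<lambda>e. R e * F) has_vector_derivative - (raise w * F)) (at 0 within T)" for F
    using has_vector_derivative_mult[OF dR has_vector_derivative_const[of F]] by simp
  have dRR: "((\<lambda>e. (R e * F) * (R e * G)) has_vector_derivative
      - (F * (raise w * G)) - raise w * F * G) (at 0 within T)" for F G
    using has_vector_derivative_mult[OF dRF[of F] dRF[of G]] by (simp add: R0)
  let ?f = "\<lambda>e. (2 * real (dim S) * \<tau> ((R e * raise h) * (R e * raise k))
     + \<gamma> * (\<tau> (R e * raise h) * \<tau> (R e * raise k))) / 4"
  have "(?f has_real_derivative
    (2 * real (dim S) * (- \<tau> (raise w * raise h * raise k) - \<tau> (raise h * raise w * raise k))
     + \<gamma> * (- \<tau> (raise w * raise h) * \<tau> (raise k) - \<tau> (raise h) * \<tau> (raise w * raise k))) / 4) (at 0 within T)"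
    by (rule DERIV_cong[OF DERIV_cdivide[OF DERIV_add[OF
          DERIV_cmult[OF has_real_derivative_\<tau>[OF dRR]]
          DERIV_cmult[OF DERIV_mult[OF has_real_derivative_\<tau>[OF dRF] has_real_derivative_\<tau>[OF dRF]]]]]])
      (simp add: R0 algebra_simps, simp add: field_simps)
  then have "(?f has_real_derivative
    (2 * real (dim S) * (- \<tau> (raise w * raise h * raise k) - \<tau> (raise h * raise w * raise k))
     + \<gamma> * (- \<tau> (raise w * raise h) * \<tau> (raise k) - \<tau> (raise h) * \<tau> (raise w * raise k))) / 4) (at 0)"
    by (simp only: at_within_open[OF T])
  moreover have "?f e = metric S (p e) h k" if "e \<in> T" for e
    using metric_eq[OF _ R(1)[OF that, unfolded M_def] R(2)[OF that, unfolded M_def] h k]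
      sym_forms_add_scale[OF restrict_q w] by (simp add: p_def)
  ultimately have "((\<lambda>e. metric S (p e) h k) has_real_derivative
    (2 * real (dim S) * (- \<tau> (raise w * raise h * raise k) - \<tau> (raise h * raise w * raise k))
     + \<gamma> * (- \<tau> (raise w * raise h) * \<tau> (raise k) - \<tau> (raise h) * \<tau> (raise w * raise k))) / 4) (at 0)"
    by (rule has_field_derivative_transform_within_open[OF _ T(2,1)])
  then show ?thesis unfolding metric_deriv_def p_def by (rule DERIV_imp_deriv)
qed

lemma raise_eqI:
  assumes "\<And>x y. x \<in> S \<Longrightarrow> y \<in> S \<Longrightarrow> q (ap F x) y = q (ap G x) y"
    and "\<And>x. ap F x \<in> S" "\<And>x. ap G x \<in> S" "\<And>x. ap F (ap \<pi> x) = ap F x" "\<And>x. ap G (ap \<pi> x) = ap G x"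
  shows "F = G"
proof (rule endo_eqI)
  fix x
  have "ap F (ap \<pi> x) = ap G (ap \<pi> x)" using assms(1-3) by (intro eq_on_S) auto
  then show "ap F x = ap G x" using assms(4,5) by simp
qed

text \<open>
  This is nondegeneracy of the metric. Testing with the form \<open>q\<close> itself gives \<open>\<tau> Z = 0\<close>, because
  \<open>2n + \<gamma> n = 1 / n\<close>. Testing then with the square of the linear form \<open>q(u, _)\<close> gives \<open>q(Z u, u) = 0\<close>.
\<close>

lemma trace_pairing_nondegenerate:
  assumes Z: "preserves Z S" "symmetric_on Z S"
    and eq: "\<And>w. w \<in> sym_forms S \<Longrightarrow> 2 * real (dim S) * \<tau> (Z * raise w) + \<gamma> * (\<tau> Z * \<tau> (raise w)) = 0"
    and x: "x \<in> S"
  shows "ap Z x = 0"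
proof -
  have "\<tau> (Z * \<pi>) = \<tau> Z" "\<tau> \<pi> = real (dim S)"
    using \<tau>_one by (simp_all add: \<tau>_def Bas_subset)
  then have "(2 * real (dim S) + \<gamma> * real (dim S)) * \<tau> Z = 0"
    using eq[OF restrict_q] by (simp add: \<pi>_def[symmetric] algebra_simps)
  moreover have "2 * real (dim S) + \<gamma> * real (dim S) = 1 / real (dim S)"
    using dim_pos by (simp add: \<gamma>_def field_simps power2_eq_square)
  ultimately have "\<tau> Z = 0" using dim_pos by simp
  have diag: "q (ap Z u) u = 0" if u: "u \<in> S" for u
  proof -
    define w where "w = restrict_form (\<lambda>x y. q u x * q u y) S"
    have w: "w \<in> sym_forms S"
      using subspace_S by (auto simp: w_def sym_forms_def restrict_form_def subspace_add subspace_scale algebra_simps)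
    have "\<tau> (raise w * Z) = (\<Sum>b\<in>Bas. q b b * (q u (ap Z b) * q u b))"
      unfolding \<tau>_def
    proof (rule sum.cong[OF refl])
      fix b assume "b \<in> Bas"
      then have "b \<in> S" "ap Z b \<in> S" using Bas_subset Z(1) by (auto simp: preserves_def)
      then show "q b b * q (ap (raise w * Z) b) b = q b b * (q u (ap Z b) * q u b)"
        using q_raise[OF w, of "ap Z b" b] by (simp add: w_def restrict_form_def)
    qed
    also have "\<dots> = q u (ap Z (\<Sum>b\<in>Bas. (q b b * q u b) *\<^sub>R b))"
      by (simp add: sum_right mult_ac)
    also have "\<dots> = q u (ap Z u)" by (simp only: expand[OF u])
    finally have "\<tau> (raise w * Z) = q (ap Z u) u" using sym by simp
    then show ?thesis
      using eq[OF w] \<open>\<tau> Z = 0\<close> \<tau>_commute[OF Z(1) preserves_raise, of w] dim_pos by simp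
  qed
  have "q (ap Z x) y = 0" if y: "y \<in> S" for y
  proof -
    have "q (ap Z (x + y)) (x + y) = 0" using diag subspace_add[OF subspace_S x y] by blast
    moreover have "q (ap Z y) x = q (ap Z x) y" using Z(2) x y sym by (simp add: symmetric_on_def)
    ultimately show ?thesis using diag[OF x] diag[OF y] by simp
  qed
  then show ?thesis using nondegenerate Z(1) x by (auto simp: preserves_def)
qed

text \<open>
  With \<open>V\<close>, \<open>W\<close> and \<open>A\<close> the endomorphisms of \<open>v\<close>, \<open>w\<close> and \<open>a\<close>, cyclicity of the trace turns the left-hand side
  into the pairing of \<open>Z = A - V\<^sup>2\<close> with \<open>W\<close>. So the geodesic equation is \<open>A = V\<^sup>2\<close>.
\<close>

lemma geodesic_equation_iff:
  assumes v: "v \<in> sym_forms S" and a: "a \<in> sym_forms S"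
  shows "(\<forall>w\<in>sym_forms S. metric S (restrict_form q S) a w + metric_deriv S (restrict_form q S) v v w
        - 1/2 * metric_deriv S (restrict_form q S) w v v = 0)
    \<longleftrightarrow> (\<forall>x\<in>S. \<forall>y\<in>S. a x y = v (ap (raise v) x) y)" (is "?L \<longleftrightarrow> ?R")
proof -
  define V where "V = raise v"
  define Z where "Z = raise a - V * V"
  have pV: "preserves V S" by (simp add: V_def)
  have pZ: "preserves Z S" by (auto simp: Z_def V_def preserves_def subspace_S subspace_diff)
  have symV: "q (ap V x) y = q x (ap V y)" if "x \<in> S" "y \<in> S" for x y
  proof -
    have "v x y = v y x" using v that by (simp add: sym_forms_def)
    then show ?thesis using q_raise[OF v] that sym by (simp add: V_def)
  qed
  have "a x y = a y x" if "x \<in> S" "y \<in> S" for x y using a that by (simp add: sym_forms_def)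
  then have symA: "q (ap (raise a) x) y = q x (ap (raise a) y)" if "x \<in> S" "y \<in> S" for x y
    using q_raise[OF a] that sym by simp
  have symZ: "symmetric_on Z S"
    using symA symV pV by (simp add: symmetric_on_def Z_def preserves_def)
  have lhs: "metric S (restrict_form q S) a w + metric_deriv S (restrict_form q S) v v w
        - 1/2 * metric_deriv S (restrict_form q S) w v v
      = (2 * real (dim S) * \<tau> (Z * raise w) + \<gamma> * (\<tau> Z * \<tau> (raise w))) / 4" if w: "w \<in> sym_forms S" for w
  proof -
    define W where "W = raise w"
    have pW: "preserves W S" by (simp add: W_def)
    have "preserves (V * V) S" using pV by (simp add: preserves_def)
    then have "\<tau> (W * V * V) = \<tau> (V * V * W)" using \<tau>_commute[OF pW, of "V * V"] by (simp add: mult.assoc)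
    moreover have "preserves (W * V) S" using pV pW by (simp add: preserves_def)
    then have "\<tau> (V * W * V) = \<tau> (W * V * V)" using \<tau>_commute[OF pV, of "W * V"] by (simp add: mult.assoc)
    moreover have "\<tau> (W * V) = \<tau> (V * W)" using \<tau>_commute[OF pW pV] .
    moreover have "metric S (restrict_form q S) a w
        = (2 * real (dim S) * \<tau> (raise a * W) + \<gamma> * (\<tau> (raise a) * \<tau> W)) / 4"
      using metric_eq[OF restrict_q _ _ a w, of 1] op_of_q by (simp add: W_def)
    ultimately show ?thesis
      unfolding metric_deriv_eq[OF v v w] metric_deriv_eq[OF w v v] V_def[symmetric] W_def[symmetric] Z_def
      by (simp add: algebra_simps) (simp add: field_simps)
  qed
  have "?L \<longleftrightarrow> (\<forall>x\<in>S. ap Z x = 0)"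
  proof
    assume L: ?L
    have "2 * real (dim S) * \<tau> (Z * raise w) + \<gamma> * (\<tau> Z * \<tau> (raise w)) = 0" if "w \<in> sym_forms S" for w
      using trans[OF lhs[OF that, symmetric] bspec[OF L that]] by (simp only: divide_eq_0_iff) simp
    then show "\<forall>x\<in>S. ap Z x = 0" using trace_pairing_nondegenerate[OF pZ symZ] by blast
  next
    assume Z0: "\<forall>x\<in>S. ap Z x = 0"
    then have "\<tau> Z = 0" "\<tau> (Z * raise w) = 0" for w by (simp_all add: \<tau>_def Bas_subset)
    then show ?L using lhs by simp
  qed
  also have "\<dots> \<longleftrightarrow> (\<forall>x\<in>S. ap (raise a) x = ap V (ap V x))" by (simp add: Z_def)
  also have "\<dots> \<longleftrightarrow> ?R"
  proof -
    have "ap (raise a) x = ap V (ap V x) \<longleftrightarrow> (\<forall>y\<in>S. a x y = v (ap (raise v) x) y)" if x: "x \<in> S" for x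
    proof
      assume "ap (raise a) x = ap V (ap V x)"
      then show "\<forall>y\<in>S. a x y = v (ap (raise v) x) y"
        using q_raise[OF a x] q_raise[OF v, of "ap V x"] by (auto simp: V_def)
    next
      assume "\<forall>y\<in>S. a x y = v (ap (raise v) x) y"
      then show "ap (raise a) x = ap V (ap V x)"
        using q_raise[OF a x] q_raise[OF v, of "ap V x"] by (intro eq_on_S) (auto simp: V_def)
    qed
    then show ?thesis by blast
  qed
  finally show ?thesis .
qed

end

context nondegenerate_form
begin

section \<open>Geodesics are exponential curves\<close>

text \<open>
  The preceding lemma describes the geodesic equation at the origin \<open>q\<close>. Applied with \<open>p\<close> as
  the origin, it describes the equation at \<open>p\<close>.
\<close>

lemma geodesic_equation_at:
  assumes p: "p \<in> inner_products r s S" and v: "v \<in> sym_forms S" and a: "a \<in> sym_forms S"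
    and V: "preserves V S" "\<And>x y. x \<in> S \<Longrightarrow> y \<in> S \<Longrightarrow> p (ap V x) y = v x y"
  shows "(\<forall>w\<in>sym_forms S. metric S p a w + metric_deriv S p v v w - 1/2 * metric_deriv S p w v v = 0)
    \<longleftrightarrow> (\<forall>x\<in>S. \<forall>y\<in>S. a x y = v (ap V x) y)"
proof -
  have pS: "p \<in> sym_forms S" using p by (simp add: inner_products_def)
  interpret p: symmetric_form "\<lambda>x y. p (ap \<pi> x) (ap \<pi> y)"
    using pS by unfold_locales (auto simp: sym_forms_def)
  have res: "restrict_form (\<lambda>x y. p (ap \<pi> x) (ap \<pi> y)) S = p"
    using pS by (auto simp: restrict_form_def sym_forms_def fun_eq_iff)
  then obtain P' N' where B: "p.orthonormal_basis P' N' S"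
    using p p.inner_products_iff[OF subspace_S] by metis
  interpret p: nondegenerate_form "\<lambda>x y. p (ap \<pi> x) (ap \<pi> y)" S P' N'
    using B nontrivial by unfold_locales
  have "ap (p.raise v) x = ap V x" if x: "x \<in> S" for x
  proof (rule p.eq_on_S)
    show "ap V x \<in> S" using V(1) x by (simp add: preserves_def)
    then show "p (ap \<pi> (ap (p.raise v) x)) (ap \<pi> y) = p (ap \<pi> (ap V x)) (ap \<pi> y)" if "y \<in> S" for y
      using p.q_raise[OF v x that] V(2)[OF x that] that by simp
  qed simp
  then show ?thesis using p.geodesic_equation_iff[OF v a] unfolding res by auto
qed

lemma has_vector_derivative_raise:
  assumes "form_curve_deriv c v" "t \<in> {0..1}"
  shows "((\<lambda>t. raise (c t)) has_vector_derivative raise (v t)) (at t within {0..1})"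
proof -
  have "((\<lambda>t. c t x y) has_real_derivative v t x y) (at t within {0..1})" for x y
    using assms by (simp add: form_curve_deriv_def)
  then show ?thesis
    unfolding raise_def
    by (intro has_vector_derivative_sum) (auto intro!: derivative_eq_intros)
qed

text \<open>
  Let \<open>C t\<close> be the endomorphism of \<open>c t\<close>, so that \<open>C 0 = 1\<close>. The geodesic equation reads
  \<open>C'' = C' C\<^sup>-\<^sup>1 C'\<close>, which says that \<open>C\<^sup>-\<^sup>1 C'\<close> has derivative \<open>0\<close>. Hence \<open>C' = C X\<close> with a constant \<open>X\<close>,
  and \<open>C t = exp(t X)\<close>.
\<close>

theorem geodesic_is_exponential:
  assumes geo: "geodesic_with_velocity r s S c v" and c0: "c 0 = restrict_form q S"
  defines "X \<equiv> raise (v 0)"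
  shows "preserves X S" "symmetric_on X S"
    and "t \<in> {0..1} \<Longrightarrow> c t = restrict_form (\<lambda>x y. q (ap (exp (t *\<^sub>R X)) x) y) S"
proof -
  let ?I = "{0..1::real}"
  obtain a where c: "\<And>t. t \<in> ?I \<Longrightarrow> c t \<in> inner_products r s S" and cv: "form_curve_deriv c v"
    and va: "form_curve_deriv v a"
    and eq: "\<And>t. t \<in> ?I \<Longrightarrow> \<forall>w\<in>sym_forms S. metric S (c t) (a t) w + metric_deriv S (c t) (v t) (v t) w
          - 1/2 * metric_deriv S (c t) w (v t) (v t) = 0"
    using geo unfolding geodesic_with_velocity_def by blast
  have cS: "c t \<in> sym_forms S" if "t \<in> ?I" for t using c[OF that] by (simp add: inner_products_def)
  have vS: "v t \<in> sym_forms S" if "t \<in> ?I" for t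
    using form_curve_deriv_sym_forms[OF cv cS that subspace_S] .
  have aS: "a t \<in> sym_forms S" if "t \<in> ?I" for t
    using form_curve_deriv_sym_forms[OF va vS that subspace_S] .
  define C where "C t = op_of (c t)" for t
  have "\<exists>R. R * C t = 1 \<and> C t * R = 1" if "t \<in> ?I" for t
    using op_of_inverse[OF c[OF that]] unfolding C_def by metis
  then obtain R where R: "\<And>t. t \<in> ?I \<Longrightarrow> R t * C t = 1" "\<And>t. t \<in> ?I \<Longrightarrow> C t * R t = 1" by metis
  have dC: "(C has_vector_derivative raise (v t)) (at t within ?I)" if "t \<in> ?I" for t
    unfolding C_def op_of_def
    using has_vector_derivative_add_const[of "\<lambda>t. raise (c t)"] has_vector_derivative_raise[OF cv that] by auto
  have dR: "(R has_vector_derivative - (R t * raise (v t) * R t)) (at t within ?I)" if "t \<in> ?I" for t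
    using has_vector_derivative_inverse_of[OF dC[OF that] that R] .
  have acc: "raise (a t) = raise (v t) * R t * raise (v t)" if t: "t \<in> ?I" for t
  proof -
    define V where "V = R t * raise (v t)"
    have RS: "preserves (R t) S" using op_of_inverse_preserves R(2)[OF t] by (simp add: C_def)
    then have pV: "preserves V S" by (simp add: V_def preserves_def)
    have V: "c t (ap V x) y = v t x y" if "x \<in> S" "y \<in> S" for x y
      using raised_equation[OF cS[OF t] R(1)[OF t, unfolded C_def] R(2)[OF t, unfolded C_def] vS[OF t] that(1),
          of "ap V x"] pV that by (simp add: V_def preserves_def)
    have av: "a t x y = v t (ap V x) y" if "x \<in> S" "y \<in> S" for x y
      using geodesic_equation_at[OF c[OF t] vS[OF t] aS[OF t] pV V] eq[OF t] that by blast
    show ?thesis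
    proof (rule raise_eqI)
      show "q (ap (raise (a t)) x) y = q (ap (raise (v t) * R t * raise (v t)) x) y" if "x \<in> S" "y \<in> S" for x y
        using q_raise[OF aS[OF t] that] q_raise[OF vS[OF t], of "ap V x" y] av[OF that] pV that
        by (simp add: V_def preserves_def)
    qed (simp_all add: raise_\<pi>)
  qed
  have "((\<lambda>t. R t * raise (v t)) has_vector_derivative 0) (at t within ?I)" if t: "t \<in> ?I" for t
    using has_vector_derivative_mult[OF dR[OF t] has_vector_derivative_raise[OF va t]] acc[OF t]
    by (simp add: algebra_simps mult.assoc)
  then obtain X0 where X0: "\<And>t. t \<in> ?I \<Longrightarrow> R t * raise (v t) = X0"
    using has_vector_derivative_zero_constant[of ?I "\<lambda>t. R t * raise (v t)"] by (auto simp: convex_real_interval)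
  have C0: "C 0 = 1" by (simp add: C_def c0 op_of_q)
  then have "R 0 = 1" using R(1)[of 0] by simp
  then have X0_eq: "X0 = X" using X0[of 0] by (simp add: X_def)
  have vX: "raise (v t) = C t * X" if "t \<in> ?I" for t
    using X0[OF that] R(2)[OF that] unfolding X0_eq by (metis mult.assoc mult_1)
  have "((\<lambda>t. C t * exp (t *\<^sub>R (- X))) has_vector_derivative 0) (at t within ?I)" if t: "t \<in> ?I" for t
  proof -
    have "C t * (exp (- (t *\<^sub>R X)) * X) = C t * (X * exp (- (t *\<^sub>R X)))"
      using exp_times_scaleR_commute[of t "- X"] by simp
    then show ?thesis
      using has_vector_derivative_mult[OF dC[OF t] exp_scaleR_has_vector_derivative_right[of "- X" t ?I]] vX[OF t]
      by (simp add: mult.assoc)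
  qed
  then obtain K where K: "\<And>t. t \<in> ?I \<Longrightarrow> C t * exp (t *\<^sub>R (- X)) = K"
    using has_vector_derivative_zero_constant[of ?I "\<lambda>t. C t * exp (t *\<^sub>R (- X))"]
    by (auto simp: convex_real_interval)
  have "K = 1" using K[of 0] C0 by simp
  have Ct: "C t = exp (t *\<^sub>R X)" if "t \<in> ?I" for t
  proof -
    have "exp (t *\<^sub>R (- X)) * exp (t *\<^sub>R X) = 1"
      using exp_add_commuting[of "t *\<^sub>R (- X)" "t *\<^sub>R X"] by simp
    then have "C t = C t * exp (t *\<^sub>R (- X)) * exp (t *\<^sub>R X)" by (simp add: mult.assoc)
    then show ?thesis using K[OF that] \<open>K = 1\<close> by simp
  qed
  show "preserves X S" by (simp add: X_def)
  show "symmetric_on X S"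
    unfolding symmetric_on_def
  proof (intro ballI)
    fix x y assume xy: "x \<in> S" "y \<in> S"
    have v0: "v 0 \<in> sym_forms S" using vS by simp
    have "q (ap X x) y = v 0 x y" using q_raise[OF v0 xy] by (simp add: X_def)
    also have "\<dots> = v 0 y x" using v0 xy by (simp add: sym_forms_def)
    also have "\<dots> = q (ap X y) x" using q_raise[OF v0 xy(2,1)] by (simp add: X_def)
    finally show "q (ap X x) y = q x (ap X y)" using sym by simp
  qed
  show "c t = restrict_form (\<lambda>x y. q (ap (exp (t *\<^sub>R X)) x) y) S" if t: "t \<in> ?I"
  proof (intro ext)
    fix x y
    show "c t x y = restrict_form (\<lambda>x y. q (ap (exp (t *\<^sub>R X)) x) y) S x y"
    proof (cases "x \<in> S \<and> y \<in> S")
      case True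
      then have "c t x y = q (ap (C t) x) y"
        using q_raise[OF cS[OF t]] by (simp add: C_def op_of_eq)
      then show ?thesis using True Ct[OF t] by (simp add: restrict_form_def)
    next
      case False
      then show ?thesis using cS[OF t] by (auto simp: restrict_form_def sym_forms_def)
    qed
  qed
qed

text \<open>
  Along the curve \<open>q(exp(t X) x, y)\<close> the velocity is represented by \<open>X\<close>, with respect to the moving
  point, and the second derivative by \<open>X\<^sup>2\<close>.
\<close>

theorem exponential_is_geodesic:
  assumes q: "restrict_form q S \<in> inner_products r s S" and X: "preserves X S" "symmetric_on X S"
  shows "geodesic_with_velocity r s S (\<lambda>t. restrict_form (\<lambda>x y. q (ap (exp (t *\<^sub>R X)) x) y) S)
    (\<lambda>t. restrict_form (\<lambda>x y. q (ap (exp (t *\<^sub>R X)) (ap X x)) y) S)"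
proof -
  let ?I = "{0..1::real}"
  define c where "c Y t = restrict_form (\<lambda>x y. q (ap (exp (t *\<^sub>R X)) (ap Y x)) y) S" for Y :: "'a endo" and t
  have exp_mem: "c 1 t \<in> inner_products r s S" for t
  proof -
    have "preserves (t *\<^sub>R X) S" "symmetric_on (t *\<^sub>R X) S"
      using X preserves_scaleR[OF subspace_S] by (auto simp: symmetric_on_def)
    from inner_products_exp[OF subspace_S this q] show ?thesis by (simp add: c_def)
  qed
  have d: "form_curve_deriv (c Y) (c (X * Y))" for Y
    unfolding form_curve_deriv_def
  proof (intro ballI allI)
    fix t :: real and x y :: 'a
    have "((\<lambda>t. ap (exp (t *\<^sub>R X)) (ap Y x)) has_vector_derivative ap (exp (t *\<^sub>R X)) (ap X (ap Y x))) (at t within ?I)"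
      using has_vector_derivative_ap[OF exp_scaleR_has_vector_derivative_right[of X t ?I] has_vector_derivative_const[of "ap Y x"]]
      by simp
    then have "((\<lambda>t. q (ap (exp (t *\<^sub>R X)) (ap Y x)) y) has_vector_derivative
        q (ap (exp (t *\<^sub>R X)) (ap X (ap Y x))) y) (at t within ?I)"
      using bounded_linear.has_vector_derivative[of "\<lambda>x. q x y"] linear_left
      by (simp add: linear_conv_bounded_linear)
    then have "((\<lambda>t. q (ap (exp (t *\<^sub>R X)) (ap Y x)) y) has_real_derivative
        q (ap (exp (t *\<^sub>R X)) (ap X (ap Y x))) y) (at t within ?I)"
      by (simp add: has_real_derivative_iff_has_vector_derivative)
    then show "((\<lambda>t. c Y t x y) has_real_derivative c (X * Y) t x y) (at t within ?I)"
      by (cases "x \<in> S"; cases "y \<in> S") (simp_all add: c_def restrict_form_def)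
  qed
  have c1: "c 1 t \<in> sym_forms S" for t using exp_mem by (simp add: inner_products_def)
  have cX: "c X t \<in> sym_forms S" if "t \<in> ?I" for t
    using form_curve_deriv_sym_forms[OF d[of 1] c1 that subspace_S] by simp
  have cXX: "c (X * X) t \<in> sym_forms S" if "t \<in> ?I" for t
    using form_curve_deriv_sym_forms[OF d[of X] cX that subspace_S] by simp
  have "geodesic_with_velocity r s S (c 1) (c X)"
    unfolding geodesic_with_velocity_def
  proof (intro conjI exI[of _ "c (X * X)"] ballI)
    fix t w assume t: "t \<in> ?I" and w: "w \<in> sym_forms S"
    have "c 1 t (ap X x) y = c X t x y" "c (X * X) t x y = c X t (ap X x) y" if "x \<in> S" "y \<in> S" for x y
      using that X(1) by (auto simp: c_def restrict_form_def preserves_def)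
    then show "metric S (c 1 t) (c (X * X) t) w + metric_deriv S (c 1 t) (c X t) (c X t) w
          - 1/2 * metric_deriv S (c 1 t) w (c X t) (c X t) = 0"
      using geodesic_equation_at[OF exp_mem cX[OF t] cXX[OF t] X(1)] w by simp
  qed (use exp_mem d[of 1] d[of X] in simp_all)
  then show ?thesis by (simp add: c_def[abs_def])
qed

definition geodesic_of :: "'a endo \<Rightarrow> real \<Rightarrow> 'a form" where
  "geodesic_of X t = restrict_form (\<lambda>x y. q (ap (exp (t *\<^sub>R X)) x) y) S"

lemma geodesic_of_log:
  assumes q: "restrict_form q S \<in> inner_products r s S" and X: "log_on X A S"
    and g: "\<And>x y. x \<in> S \<Longrightarrow> y \<in> S \<Longrightarrow> g x y = q (ap A x) y"
  shows "geodesic_from_to r s S (restrict_form q S) (restrict_form g S) (geodesic_of X)"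
  unfolding geodesic_from_to_def
proof (intro conjI)
  show "\<exists>v. geodesic_with_velocity r s S (geodesic_of X) v"
    using exponential_is_geodesic[OF q, of X] X unfolding geodesic_of_def[abs_def] log_on_def by blast
  show "geodesic_of X 0 = restrict_form q S" by (simp add: geodesic_of_def)
  show "geodesic_of X 1 = restrict_form g S"
    using X g by (auto simp: geodesic_of_def restrict_form_def fun_eq_iff log_on_def)
qed

lemma log_of_geodesic:
  assumes A: "preserves A S" and g: "\<And>x y. x \<in> S \<Longrightarrow> y \<in> S \<Longrightarrow> g x y = q (ap A x) y"
    and c: "geodesic_from_to r s S (restrict_form q S) (restrict_form g S) c"
  obtains X where "log_on X A S" "\<And>t. t \<in> {0..1} \<Longrightarrow> c t = geodesic_of X t"
proof -
  obtain v where v: "geodesic_with_velocity r s S c v" "c 0 = restrict_form q S" "c 1 = restrict_form g S"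
    using c unfolding geodesic_from_to_def by blast
  define X where "X = raise (v 0)"
  note X = geodesic_is_exponential[OF v(1,2), folded X_def]
  have "ap (exp X) x = ap A x" if x: "x \<in> S" for x
  proof (rule eq_on_S)
    show "ap (exp X) x \<in> S" "ap A x \<in> S"
      using preserves_exp[OF subspace_S X(1)] A x by (auto simp: preserves_def)
    show "q (ap (exp X) x) y = q (ap A x) y" if "y \<in> S" for y
      using fun_cong[OF fun_cong[OF trans[OF X(3)[of 1, symmetric] v(3)]], of x y] g x that
      by (simp add: restrict_form_def)
  qed
  then show ?thesis
    using that[of X] X by (simp add: log_on_def geodesic_of_def)
qed

text \<open>
  The geodesic determines its initial velocity, which is represented by \<open>X\<close>.
\<close>

lemma geodesic_of_eq_iff:
  assumes X: "preserves X S" "symmetric_on X S" and Y: "preserves Y S" "symmetric_on Y S"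
  shows "(\<forall>t\<in>{0..1}. geodesic_of X t = geodesic_of Y t) \<longleftrightarrow> (\<forall>x\<in>S. ap X x = ap Y x)"
proof
  assume XY: "\<forall>x\<in>S. ap X x = ap Y x"
  have "ap (exp (t *\<^sub>R X)) x = ap (exp (t *\<^sub>R Y)) x" if "x \<in> S" for t x
    using XY that preserves_scaleR[OF subspace_S Y(1)] by (intro exp_ap_cong[where V = S]) auto
  then show "\<forall>t\<in>{0..1}. geodesic_of X t = geodesic_of Y t"
    by (auto simp: geodesic_of_def restrict_form_def fun_eq_iff)
next
  assume eq: "\<forall>t\<in>{0..1}. geodesic_of X t = geodesic_of Y t"
  have D: "((\<lambda>t. q (ap (exp (t *\<^sub>R Z)) x) y) has_real_derivative q (ap Z x) y) (at 0 within {0..1})" for Z x y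
  proof -
    have "((\<lambda>t. ap (exp (t *\<^sub>R Z)) x) has_vector_derivative ap Z x) (at 0 within {0..1})"
      using has_vector_derivative_ap[OF exp_scaleR_has_vector_derivative_right[of Z 0 "{0..1}"] has_vector_derivative_const[of x]]
      by simp
    then show ?thesis
      unfolding has_real_derivative_iff_has_vector_derivative
      using bounded_linear.has_vector_derivative[of "\<lambda>x. q x y"] linear_left
      by (simp add: linear_conv_bounded_linear)
  qed
  show "\<forall>x\<in>S. ap X x = ap Y x"
  proof
    fix x assume x: "x \<in> S"
    show "ap X x = ap Y x"
    proof (rule eq_on_S)
      show "ap X x \<in> S" "ap Y x \<in> S" using X Y x by (auto simp: preserves_def)
      fix y assume y: "y \<in> S"
      have "q (ap (exp (t *\<^sub>R X)) x) y = q (ap (exp (t *\<^sub>R Y)) x) y" if "t \<in> {0..1}" for t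
        using fun_cong[OF fun_cong[OF bspec[OF eq that]], of x y] x y
        by (simp add: geodesic_of_def restrict_form_def)
      then have "((\<lambda>t. q (ap (exp (t *\<^sub>R X)) x) y) has_real_derivative q (ap Y x) y) (at 0 within {0..1})"
        by (intro has_field_derivative_transform_within[OF D[of Y x y] zero_less_one]) auto
      from derivative_unique_unit_interval[OF D this] show "q (ap X x) y = q (ap Y x) y" by simp
    qed
  qed
qed

theorem geodesic_exists_iff:
  assumes q: "restrict_form q S \<in> inner_products r s S" and A: "preserves A S"
    and g: "\<And>x y. x \<in> S \<Longrightarrow> y \<in> S \<Longrightarrow> g x y = q (ap A x) y"
  shows "geodesic_exists r s S (restrict_form q S) (restrict_form g S) \<longleftrightarrow> (\<exists>X. log_on X A S)"
proof
  assume "geodesic_exists r s S (restrict_form q S) (restrict_form g S)"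
  then obtain c where "geodesic_from_to r s S (restrict_form q S) (restrict_form g S) c"
    unfolding geodesic_exists_def by blast
  from log_of_geodesic[OF A g this] show "\<exists>X. log_on X A S" by blast
next
  assume "\<exists>X. log_on X A S"
  then obtain X where X: "log_on X A S" by blast
  show "geodesic_exists r s S (restrict_form q S) (restrict_form g S)"
    using geodesic_of_log[OF q X g] unfolding geodesic_exists_def by blast
qed

theorem is_unique_geodesic_iff:
  assumes q: "restrict_form q S \<in> inner_products r s S" and A: "preserves A S"
    and g: "\<And>x y. x \<in> S \<Longrightarrow> y \<in> S \<Longrightarrow> g x y = q (ap A x) y" and X: "log_on X A S"
  shows "is_unique_geodesic r s S (restrict_form q S) (restrict_form g S) (geodesic_of X) \<longleftrightarrow>
    (\<forall>Y. log_on Y A S \<longrightarrow> (\<forall>x\<in>S. ap Y x = ap X x))" (is "?L \<longleftrightarrow> ?R")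
proof
  assume L: ?L
  show ?R
  proof (intro allI impI)
    fix Y assume Y: "log_on Y A S"
    have "\<forall>t\<in>{0..1}. geodesic_of Y t = geodesic_of X t"
      using L geodesic_of_log[OF q Y g] unfolding is_unique_geodesic_def by blast
    then show "\<forall>x\<in>S. ap Y x = ap X x"
      using X Y geodesic_of_eq_iff[of Y X] by (simp add: log_on_def)
  qed
next
  assume R: ?R
  show ?L
    unfolding is_unique_geodesic_def
  proof (intro conjI allI impI)
    show "geodesic_from_to r s S (restrict_form q S) (restrict_form g S) (geodesic_of X)"
      using geodesic_of_log[OF q X g] .
    fix c assume "geodesic_from_to r s S (restrict_form q S) (restrict_form g S) c"
    from log_of_geodesic[OF A g this] obtain Y where Y: "log_on Y A S" "\<And>t. t \<in> {0..1} \<Longrightarrow> c t = geodesic_of Y t"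
      by metis
    have "\<forall>t\<in>{0..1}. geodesic_of Y t = geodesic_of X t"
      using R Y(1) X geodesic_of_eq_iff[of Y X] unfolding log_on_def by blast
    then show "\<forall>t\<in>{0..1}. c t = geodesic_of X t" using Y(2) by simp
  qed
qed

theorem exactly_one_geodesic_iff:
  assumes q: "restrict_form q S \<in> inner_products r s S" and A: "preserves A S"
    and g: "\<And>x y. x \<in> S \<Longrightarrow> y \<in> S \<Longrightarrow> g x y = q (ap A x) y"
  shows "exactly_one_geodesic r s S (restrict_form q S) (restrict_form g S) \<longleftrightarrow>
    (\<exists>X. log_on X A S \<and> (\<forall>Y. log_on Y A S \<longrightarrow> (\<forall>x\<in>S. ap Y x = ap X x)))" (is "?L \<longleftrightarrow> ?R")
proof
  assume ?L
  then obtain c where c: "is_unique_geodesic r s S (restrict_form q S) (restrict_form g S) c"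
    unfolding exactly_one_geodesic_def by blast
  then have "geodesic_from_to r s S (restrict_form q S) (restrict_form g S) c"
    by (simp add: is_unique_geodesic_def)
  from log_of_geodesic[OF A g this] obtain X where X: "log_on X A S" "\<And>t. t \<in> {0..1} \<Longrightarrow> c t = geodesic_of X t"
    by metis
  have "is_unique_geodesic r s S (restrict_form q S) (restrict_form g S) (geodesic_of X)"
    unfolding is_unique_geodesic_def
  proof (intro conjI allI impI)
    fix c' assume "geodesic_from_to r s S (restrict_form q S) (restrict_form g S) c'"
    then have "\<forall>t\<in>{0..1}. c' t = c t" using c unfolding is_unique_geodesic_def by blast
    then show "\<forall>t\<in>{0..1}. c' t = geodesic_of X t" using X(2) by simp
  qed (rule geodesic_of_log[OF q X(1) g])
  then show ?R using is_unique_geodesic_iff[OF q A g X(1)] X(1) by blast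
next
  assume ?R
  then obtain X where X: "log_on X A S" "\<forall>Y. log_on Y A S \<longrightarrow> (\<forall>x\<in>S. ap Y x = ap X x)" by blast
  from is_unique_geodesic_iff[OF q A g X(1)] X(2) show ?L
    unfolding exactly_one_geodesic_def by blast
qed

end

section \<open>Product submanifolds are totally geodesic\<close>

text \<open>
  A continuous map from the space of forms, with the topology of pointwise convergence, to the normed space of
  endomorphisms. It carries questions of openness from the former to the latter.
\<close>

definition form_endo :: "'a::euclidean_space form \<Rightarrow> 'a endo" where
  "form_endo h = (\<Sum>i\<in>Basis. \<Sum>j\<in>Basis. h i j *\<^sub>R endo_of (\<lambda>x. (x \<bullet> i) *\<^sub>R j))"

lemma form_endo_inner:
  assumes "h \<in> sym_forms UNIV" shows "ap (form_endo h) x \<bullet> x = h x x"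
proof -
  interpret h: symmetric_form h using assms by unfold_locales
  have E: "ap (endo_of (\<lambda>x. (x \<bullet> i) *\<^sub>R j)) x = (x \<bullet> i) *\<^sub>R j" for i j :: 'a
    by (subst ap_endo_of) (auto intro!: linearI simp: algebra_simps)
  have "h x x = h (\<Sum>i\<in>Basis. (x \<bullet> i) *\<^sub>R i) (\<Sum>j\<in>Basis. (x \<bullet> j) *\<^sub>R j)"
    by (simp only: euclidean_representation)
  also have "\<dots> = (\<Sum>i\<in>Basis. \<Sum>j\<in>Basis. (x \<bullet> i) * ((x \<bullet> j) * h i j))"
    by (simp add: h.sum_left h.sum_right sum_distrib_left) (intro sum.cong refl, metis h.sym)
  also have "\<dots> = ap (form_endo h) x \<bullet> x"
    by (simp add: form_endo_def ap_sum E inner_sum_left inner_commute[of x] mult_ac)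
  finally show ?thesis by simp
qed

lemma continuous_on_evaluation [continuous_intros]:
  "continuous_on UNIV (\<lambda>h::'a form. h x y)" for x y :: "'a::euclidean_space"
  by (rule continuous_on_product_then_coordinatewise[OF continuous_on_product_coordinates])

lemma continuous_on_form_endo: "continuous_on UNIV (form_endo :: 'a::euclidean_space form \<Rightarrow> 'a endo)"
  unfolding form_endo_def[abs_def] by (intro continuous_intros)

text \<open>
  The quadratic form of \<open>F\<close> is bounded below by some \<open>m > 0\<close> on the compact unit sphere of \<open>T\<close>; the ball
  of radius \<open>m\<close> around \<open>F\<close> will do.
\<close>

lemma open_positive_endos:
  assumes T: "subspace T"
  shows "open {F::'a::euclidean_space endo. \<forall>x\<in>T. x \<noteq> 0 \<longrightarrow> ap F x \<bullet> x > 0}"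
  unfolding open_dist
proof (intro ballI)
  fix F assume "F \<in> {F::'a endo. \<forall>x\<in>T. x \<noteq> 0 \<longrightarrow> ap F x \<bullet> x > 0}"
  then have F: "\<And>x. x \<in> T \<Longrightarrow> x \<noteq> 0 \<Longrightarrow> ap F x \<bullet> x > 0" by blast
  let ?K = "T \<inter> sphere 0 1"
  obtain m where m: "m > 0" "\<And>x. x \<in> ?K \<Longrightarrow> ap F x \<bullet> x \<ge> m"
  proof (cases "?K = {}")
    case True
    then show ?thesis using that[of 1] by auto
  next
    case False
    have "compact ?K" using closed_Int_compact[OF closed_subspace[OF T] compact_sphere] .
    moreover have "continuous_on ?K (\<lambda>x. ap F x \<bullet> x)"
      using linear_continuous_on[of "ap F" ?K] linear_ap[of F]
      by (intro continuous_on_inner continuous_on_id) (simp add: linear_conv_bounded_linear)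
    ultimately obtain x where x: "x \<in> ?K" "\<And>y. y \<in> ?K \<Longrightarrow> ap F x \<bullet> x \<le> ap F y \<bullet> y"
      using continuous_attains_inf[OF _ False] by blast
    have "x \<noteq> 0" using x(1) by auto
    then show ?thesis using that[of "ap F x \<bullet> x"] x F by auto
  qed
  have "G \<in> {F. \<forall>x\<in>T. x \<noteq> 0 \<longrightarrow> ap F x \<bullet> x > 0}" if G: "dist G F < m" for G
  proof (intro CollectI ballI impI)
    fix x assume x: "x \<in> T" "x \<noteq> 0"
    define y where "y = (1 / norm x) *\<^sub>R x"
    have y: "y \<in> ?K" using x T by (simp add: y_def subspace_scale)
    have "\<bar>ap (G - F) y \<bullet> y\<bar> \<le> norm (ap (G - F) y) * norm y" by (rule Cauchy_Schwarz_ineq2)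
    also have "\<dots> \<le> norm (G - F)" using norm_ap[of "G - F" y] y by simp
    also have "\<dots> < m" using G by (simp add: dist_norm)
    finally have "ap G y \<bullet> y > 0" using m(2)[OF y] by (simp add: inner_diff_left)
    moreover have "ap G x \<bullet> x = (norm x)\<^sup>2 * (ap G y \<bullet> y)"
      using x(2) by (simp add: y_def power2_eq_square)
    ultimately show "ap G x \<bullet> x > 0" using x(2) by simp
  qed
  then show "\<exists>e>0. \<forall>G. dist G F < e \<longrightarrow> G \<in> {F. \<forall>x\<in>T. x \<noteq> 0 \<longrightarrow> ap F x \<bullet> x > 0}"
    using m(1) by blast
qed

definition positive_forms :: "'a::euclidean_space set \<Rightarrow> 'a form set" where
  "positive_forms T = form_endo -` {F. \<forall>x\<in>T. x \<noteq> 0 \<longrightarrow> ap F x \<bullet> x > 0}"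

lemma open_positive_forms: "subspace T \<Longrightarrow> open (positive_forms T)"
  unfolding positive_forms_def
  by (rule open_vimage[OF open_positive_endos continuous_on_form_endo])

lemma positive_forms_iff: "h \<in> sym_forms UNIV \<Longrightarrow> h \<in> positive_forms T \<longleftrightarrow> symmetric_form.posdef h T"
  by (simp add: positive_forms_def form_endo_inner symmetric_form.posdef_def symmetric_form_def)

text \<open>
  For timelike \<open>e\<close> this is a positive multiple of the form that arises from \<open>h\<close> by changing its sign on the line spanned by \<open>e\<close>.
  It turns a Lorentzian form into a definite one, and reduces openness of the first property to
  openness of the second.
\<close>

definition flip_form :: "'a \<Rightarrow> 'a::euclidean_space form \<Rightarrow> 'a form" where
  "flip_form e h = (\<lambda>x y. - h e e * h x y + 2 * (h e x * h e y))"

lemma flip_form_sym: "h \<in> sym_forms UNIV \<Longrightarrow> flip_form e h \<in> sym_forms UNIV"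
proof -
  assume "h \<in> sym_forms UNIV"
  then interpret h: symmetric_form h by unfold_locales
  show ?thesis by (auto simp: sym_forms_def flip_form_def h.sym algebra_simps)
qed

lemma continuous_on_flip_form: "continuous_on UNIV (flip_form e :: 'a::euclidean_space form \<Rightarrow> 'a form)"
  unfolding flip_form_def[abs_def]
  by (intro continuous_on_coordinatewise_then_product continuous_intros)

context symmetric_form
begin

lemma flip_form_posdef_iff:
  assumes S: "subspace S" "e \<in> S" "q e e < 0"
  shows "symmetric_form.posdef (flip_form e q) S \<longleftrightarrow> posdef {v\<in>S. q e v = 0}"
proof -
  interpret f: symmetric_form "flip_form e q" using flip_form_sym[OF form] by unfold_locales
  show ?thesis
  proof
    assume pos: "f.posdef S"
    show "posdef {v\<in>S. q e v = 0}"
      unfolding posdef_def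
    proof (intro ballI impI)
      fix v assume v: "v \<in> {v\<in>S. q e v = 0}" "v \<noteq> 0"
      have "flip_form e q v v > 0" using pos v unfolding f.posdef_def by blast
      then have "- q e e * q v v > 0" using v by (simp add: flip_form_def)
      then show "q v v > 0" using S(3) by (simp add: mult_less_0_iff)
    qed
  next
    assume pos: "posdef {v\<in>S. q e v = 0}"
    show "f.posdef S"
      unfolding f.posdef_def
    proof (intro ballI impI)
      fix x assume x: "x \<in> S" "x \<noteq> 0"
      define a v where "a = q e x / q e e" and "v = x - a *\<^sub>R e"
      have v: "v \<in> {v\<in>S. q e v = 0}"
        using x S by (simp add: v_def a_def subspace_diff subspace_scale)
      have xe: "x = a *\<^sub>R e + v" by (simp add: v_def)
      have ve: "q e v = 0" "q v e = 0" using v sym by auto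
      have "flip_form e q x x = (a * q e e)\<^sup>2 + (- q e e) * q v v"
        by (simp add: flip_form_def xe ve power2_eq_square algebra_simps)
      moreover have "q v v \<ge> 0" using posdef_nonneg[OF pos v] .
      moreover have "a \<noteq> 0 \<or> v \<noteq> 0" using x(2) xe by auto
      moreover have "v \<noteq> 0 \<Longrightarrow> q v v > 0" using pos v by (simp add: posdef_def)
      moreover have "a \<noteq> 0 \<Longrightarrow> (a * q e e)\<^sup>2 > 0" using S(3) by simp
      ultimately show "flip_form e q x x > 0"
        using S(3) by (smt (verit) mult_nonneg_nonneg mult_pos_pos zero_le_power2)
    qed
  qed
qed

end

lemma direct_sum_dim:
  fixes S T :: "'a::euclidean_space set"
  assumes "direct_sum S T" shows "dim S + dim T = DIM('a)"
proof -
  have "dim {x + y |x y. x \<in> S \<and> y \<in> T} + dim (S \<inter> T) = dim S + dim T"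
    using assms by (intro dim_sums_Int) (auto simp: direct_sum_def)
  then show ?thesis using assms by (simp add: direct_sum_def dim_UNIV)
qed

text \<open>
  The product is open in the linear space \<open>L\<close> of the forms for which \<open>S\<close> and \<open>T\<close> are orthogonal. If the
  initial velocity is in \<open>L\<close>, then the endomorphism \<open>X\<close> of the geodesic preserves \<open>S\<close> and \<open>T\<close>, and
  so does \<open>exp(t X)\<close>.
\<close>

lemma totally_geodesic_product:
  fixes S T :: "'a::euclidean_space set"
  assumes ST: "direct_sum S T"
  shows "totally_geodesic (r + m) 1 UNIV (product_submanifold r 1 S m 0 T)"
proof -
  define N where "N = product_submanifold r 1 S m 0 T"
  have S: "subspace S" and T: "subspace T" and UN: "UNIV = {x + y |x y. x \<in> S \<and> y \<in> T}"
    using ST by (auto simp: direct_sum_def)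
  define L where "L = {h \<in> sym_forms UNIV. \<forall>x\<in>S. \<forall>y\<in>T. h x y = 0}"
  have N_iff: "h \<in> N \<longleftrightarrow> h \<in> L \<and> restrict_form h S \<in> inner_products r 1 S \<and> restrict_form h T \<in> inner_products m 0 T" for h
    by (auto simp: N_def product_submanifold_def L_def)
  have "N \<subseteq> inner_products (r + m) 1 UNIV"
  proof
    fix h assume h: "h \<in> N"
    then interpret h: symmetric_form h by unfold_locales (simp add: N_iff L_def)
    have "restrict_form h UNIV \<in> inner_products (r + m) (1 + 0) UNIV"
      using h S T UN by (intro h.inner_products_orthogonal_sum[of S T]) (auto simp: N_iff L_def)
    then show "h \<in> inner_products (r + m) 1 UNIV" by (simp add: restrict_form_def)
  qed
  moreover have "form_subspace UNIV L"
    by (auto simp: form_subspace_def L_def sym_forms_def algebra_simps)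
  moreover have "openin (top_of_set L) N"
  proof (subst openin_subopen, intro ballI)
    fix h assume h: "h \<in> N"
    then have hL: "h \<in> L" "h \<in> sym_forms UNIV" by (auto simp: N_iff L_def)
    interpret h: symmetric_form h using hL by unfold_locales
    have dims: "dim S = r + 1" "dim T = m"
      using h.dim_inner_products[OF S] h.dim_inner_products[OF T] h by (auto simp: N_iff)
    have "h.lorentzian S" using h.lorentzian_of_inner_products[OF S] h unfolding N_iff by blast
    then obtain e where e: "e \<in> S" "h e e < 0" "h.posdef {v\<in>S. h e v = 0}"
      by (auto simp: h.lorentzian_def)
    have hT: "h.posdef T" using h.posdef_of_inner_products[OF T] h unfolding N_iff by blast
    define U where "U = ((\<lambda>k. k e e) -` {..<0}) \<inter> (flip_form e -` positive_forms S) \<inter> positive_forms T"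
    have "open U"
      unfolding U_def using S T
      by (intro open_Int open_vimage open_positive_forms continuous_on_flip_form continuous_on_evaluation) auto
    moreover have "h \<in> U"
      using e hT hL h.flip_form_posdef_iff[OF S e(1,2)]
      by (simp add: U_def positive_forms_iff flip_form_sym)
    moreover have "L \<inter> U \<subseteq> N"
    proof
      fix k assume k: "k \<in> L \<inter> U"
      then have kL: "k \<in> L" "k \<in> sym_forms UNIV" by (auto simp: L_def)
      interpret k: symmetric_form k using kL by unfold_locales
      have "k e e < 0" "k.posdef {v\<in>S. k e v = 0}" "k.posdef T"
        using k kL k.flip_form_posdef_iff[OF S e(1)]
        by (auto simp: U_def positive_forms_iff flip_form_sym)
      then have "k.lorentzian S" "k.posdef T" using e(1) by (auto simp: k.lorentzian_def)
      then show "k \<in> N"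
        using kL k.lorentzian_inner_products[OF S] k.posdef_inner_products[OF T] dims by (simp add: N_iff)
    qed
    ultimately show "\<exists>V. openin (top_of_set L) V \<and> h \<in> V \<and> V \<subseteq> N"
      using hL(1) by (intro exI[of _ "L \<inter> U"]) auto
  qed
  moreover have "c t \<in> N"
    if geo: "geodesic_with_velocity (r + m) 1 UNIV c v" and c0: "c 0 \<in> N" and v0: "v 0 \<in> L" and t: "t \<in> {0..1}" for c v t
  proof -
    define h where "h = c 0"
    have hL: "h \<in> L" using c0 by (simp add: N_iff h_def)
    interpret h: symmetric_form h using hL by unfold_locales (simp add: L_def)
    have "restrict_form h UNIV \<in> inner_products (r + m) 1 UNIV"
      using geo by (simp add: geodesic_with_velocity_def h_def restrict_form_def)
    then obtain P N where "h.orthonormal_basis P N UNIV"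
      using h.inner_products_iff[OF subspace_UNIV] by blast
    then interpret h: nondegenerate_form h UNIV P N
      using UNIV_not_singleton by unfold_locales auto
    define X where "X = h.raise (v 0)"
    have c0h: "c 0 = restrict_form h UNIV" by (simp add: h_def restrict_form_def)
    note X = h.geodesic_is_exponential[OF geo c0h, folded X_def]
    have Xv: "h (ap X x) y = v 0 x y" for x y
      using h.q_raise[of "v 0" x y] v0 by (simp add: X_def L_def)
    obtain P1 N1 where B1: "h.orthonormal_basis P1 N1 S"
      using h.inner_products_iff[OF S, of r 1] c0 by (auto simp: N_iff h_def)
    obtain P2 N2 where B2: "h.orthonormal_basis P2 N2 T"
      using h.inner_products_iff[OF T, of m 0] c0 by (auto simp: N_iff h_def)
    have orth: "h x y = 0" "h y x = 0" "v 0 x y = 0" "v 0 y x = 0" if "x \<in> S" "y \<in> T" for x y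
      using that hL v0 by (auto simp: L_def sym_forms_def)
    have pS: "preserves X S"
      unfolding preserves_def
    proof
      fix x assume x: "x \<in> S"
      obtain s u where su: "ap X x = s + u" "s \<in> S" "u \<in> T" using UN by blast
      have "h u y = 0" if "y \<in> T" for y
        using Xv[of x y] orth(3)[OF x that] orth(1)[OF su(2) that] by (simp add: su(1))
      then have "u = 0" using h.nondegenerate_of_basis[OF B2 su(3)] by blast
      then show "ap X x \<in> S" using su by simp
    qed
    have pT: "preserves X T"
      unfolding preserves_def
    proof
      fix x assume x: "x \<in> T"
      obtain s u where su: "ap X x = s + u" "s \<in> S" "u \<in> T" using UN by blast
      have "h s y = 0" if "y \<in> S" for y
        using Xv[of x y] orth(4)[OF that x] orth(2)[OF that su(3)] by (simp add: su(1))
      then have "s = 0" using h.nondegenerate_of_basis[OF B1 su(2)] by blast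
      then show "ap X x \<in> T" using su by simp
    qed
    have ct: "c t x y = h (ap (exp (t *\<^sub>R X)) x) y" for x y
      using X(3)[OF t] by (simp add: restrict_form_def)
    have tX: "preserves (t *\<^sub>R X) S" "preserves (t *\<^sub>R X) T" "h.symmetric_on (t *\<^sub>R X) S" "h.symmetric_on (t *\<^sub>R X) T"
      using pS pT preserves_scaleR S T X(2) by (auto simp: h.symmetric_on_def)
    have "c t x y = 0" if "x \<in> S" "y \<in> T" for x y
      using preserves_exp[OF S tX(1)] that orth by (simp add: ct preserves_def)
    moreover have "c t \<in> sym_forms UNIV"
      using geo t by (auto simp: geodesic_with_velocity_def inner_products_def)
    moreover have "c t = (\<lambda>x y. h (ap (exp (t *\<^sub>R X)) x) y)" using ct by blast
    ultimately show ?thesis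
      using h.inner_products_exp[OF S tX(1,3)] h.inner_products_exp[OF T tX(2,4)] c0
      by (simp add: N_iff L_def h_def)
  qed
  ultimately show ?thesis unfolding totally_geodesic_def N_def by blast
qed

section \<open>Extension of endomorphisms and independence of chains\<close>

lemma endo_with_values:
  assumes "independent B" obtains X where "\<And>b. b \<in> B \<Longrightarrow> ap X b = f b"
proof -
  obtain h where "linear h" "\<forall>b\<in>B. h b = f b" using linear_independent_extend[OF assms, of f] by blast
  then show ?thesis using that[of "endo_of h"] by simp
qed

lemma ap_eq_on_span: "(\<And>b. b \<in> B \<Longrightarrow> ap X b = ap Y b) \<Longrightarrow> x \<in> span B \<Longrightarrow> ap X x = ap Y x"
  by (rule linear_eq_on_span[OF linear_ap linear_ap])

lemma chain_independent:
  assumes "ap N (ap N (ap N s)) = 0" "ap N (ap N s) \<noteq> 0"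
  shows "independent {ap N (ap N s), ap N s, s}" and "dim {ap N (ap N s), ap N s, s} = 3"
proof -
  let ?a = "ap N (ap N s)" and ?b = "ap N s"
  have b: "?b \<notin> span {?a}"
  proof
    assume "?b \<in> span {?a}"
    then obtain k where "?b = k *\<^sub>R ?a" by (auto simp: span_singleton)
    then have "?a = k *\<^sub>R ap N ?a" by (metis ap_linear_simps(5))
    then show False using assms by simp
  qed
  have s: "s \<notin> span {?b, ?a}"
  proof
    assume "s \<in> span {?b, ?a}"
    then obtain k l where "s = k *\<^sub>R ?b + l *\<^sub>R ?a" by (rule in_span_pairE[OF _])
    then have "?a = ap N (ap N (k *\<^sub>R ?b + l *\<^sub>R ?a))" by metis
    then show False using assms by simp
  qed
  have "independent {s, ?b, ?a}"
    using assms(2) b s by (auto simp: independent_insert)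
  moreover have "{s, ?b, ?a} = {?a, ?b, s}" by auto
  ultimately show "independent {?a, ?b, s}" by simp
  moreover have "card {?a, ?b, s} = 3"
  proof -
    have "?a \<noteq> ?b" using b span_base[of ?b "{?a}"] by auto
    moreover have "s \<noteq> ?a" "s \<noteq> ?b" using s span_base[of s "{?b, ?a}"] by auto
    ultimately show ?thesis by auto
  qed
  ultimately show "dim {?a, ?b, s} = 3" by (metis dim_eq_card_independent)
qed

lemma endo_exp_ap: "endo_exp (ap F) u = ap (exp F) u"
proof -
  have "(ap F ^^ k) u = ap (F ^ k) u" for k by (induction k) auto
  then show ?thesis unfolding endo_exp_def using sums_unique[OF exp_ap_sums[of F u]] by simp
qed

section \<open>Trace and determinant on a plane\<close>

lemma trace_on_plane:
  assumes ind: "independent {a, b}" "a \<noteq> b"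
    and f: "\<And>x y. x \<in> span {a, b} \<Longrightarrow> y \<in> span {a, b} \<Longrightarrow> f (x + y) = f x + f y"
      "\<And>x c. x \<in> span {a, b} \<Longrightarrow> f (c *\<^sub>R x) = c *\<^sub>R f x"
    and fa: "f a = p *\<^sub>R a + r *\<^sub>R b" and fb: "f b = s *\<^sub>R a + t *\<^sub>R b"
  shows "trace_on (span {a, b}) f = p + t"
proof -
  obtain \<phi> :: "'a \<Rightarrow> real" where \<phi>: "linear \<phi>" "\<phi> a = 1" "\<phi> b = 0"
    using linear_independent_extend[OF ind(1), of "\<lambda>x. if x = a then 1 else 0"] ind(2) by auto
  obtain \<psi> :: "'a \<Rightarrow> real" where \<psi>: "linear \<psi>" "\<psi> a = 0" "\<psi> b = 1"
    using linear_independent_extend[OF ind(1), of "\<lambda>x. if x = a then 0 else 1"] ind(2) by auto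
  note lin = linear_add[OF \<phi>(1)] linear_cmul[OF \<phi>(1)] linear_add[OF \<psi>(1)] linear_cmul[OF \<psi>(1)]
  define \<xi> where "\<xi> i = (if i then \<phi> else \<psi>)" for i
  define u where "u i = f (if i then a else b)" for i
  have "trace_on (span {a, b}) f = (\<Sum>i\<in>UNIV. \<xi> i (u i))"
  proof (rule trace_on_sum_rank_one)
    fix x assume "x \<in> span {a, b}"
    then obtain k l where x: "x = k *\<^sub>R a + l *\<^sub>R b" by (rule in_span_pairE)
    have ab: "a \<in> span {a, b}" "b \<in> span {a, b}" by (auto intro: span_base)
    have "f x = f (k *\<^sub>R a) + f (l *\<^sub>R b)"
      unfolding x by (intro f(1) span_scale ab)
    then have "f x = k *\<^sub>R f a + l *\<^sub>R f b" by (simp only: f(2)[OF ab(1)] f(2)[OF ab(2)])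
    moreover have "\<phi> x = k" "\<psi> x = l" using \<phi> \<psi> by (simp_all add: x lin)
    ultimately show "f x = (\<Sum>i\<in>UNIV. \<xi> i x *\<^sub>R u i)" by (simp add: UNIV_bool \<xi>_def u_def)
  next
    show "u i \<in> span {a, b}" for i using in_span_pair(3) by (auto simp: u_def fa fb)
  qed (use \<phi> \<psi> in \<open>auto simp: \<xi>_def\<close>)
  also have "\<dots> = p + t" using \<phi> \<psi> by (simp add: UNIV_bool \<xi>_def u_def fa fb lin)
  finally show ?thesis .
qed

text \<open>
  In dimension two, \<open>2 det A = (tr A)\<^sup>2 - tr(A\<^sup>2)\<close>. The formula holds for the coefficients in either of
  the bases \<open>a, b\<close> and \<open>c, d\<close>, and the traces do not depend on the basis.
\<close>

lemma det_on_plane: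
  assumes ind: "independent {a, b}" "a \<noteq> b" and Aa: "ap A a = p *\<^sub>R a + r *\<^sub>R b" and Ab: "ap A b = s *\<^sub>R a + t *\<^sub>R b"
  shows "det_on (span {a, b}) (ap A) = p * t - r * s"
proof -
  let ?S = "span {a, b}"
  define B where "B = some_basis ?S"
  have B: "independent B" "span B = ?S" using some_basis[of ?S] by (auto simp: B_def)
  have "card {a, b} = dim ?S" using ind dim_eq_card_independent[OF ind(1)] by simp
  moreover have "card B = dim ?S" using B by (metis dim_span_eq_card_independent)
  ultimately have "card B = 2" using ind(2) by simp
  then obtain c d where cd: "B = {c, d}" "c \<noteq> d" by (auto simp: card_2_iff)
  have pres: "preserves A ?S"
    using in_span_pair(3) by (intro preserves_span) (auto simp: Aa Ab)
  obtain p' r' where Ac: "ap A c = p' *\<^sub>R c + r' *\<^sub>R d"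
  proof -
    have "c \<in> span B" by (simp add: cd span_base)
    then have "ap A c \<in> span {c, d}" using pres B cd(1) by (auto simp: preserves_def)
    then show ?thesis using that by (rule in_span_pairE)
  qed
  obtain s' t' where Ad: "ap A d = s' *\<^sub>R c + t' *\<^sub>R d"
  proof -
    have "d \<in> span B" by (simp add: cd span_base)
    then have "ap A d \<in> span {c, d}" using pres B cd(1) by (auto simp: preserves_def)
    then show ?thesis using that by (rule in_span_pairE)
  qed
  have ind': "independent {c, d}" using B cd by simp
  have S: "?S = span {c, d}" using B cd by simp
  have rep: "representation B (k *\<^sub>R c + l *\<^sub>R d) = (\<lambda>b. k * representation B c b + l * representation B d b)" for k l
    using B(1) cd(1) by (simp add: representation_add representation_scale span_base span_scale)
  have basis: "representation B c c = 1" "representation B c d = 0" "representation B d c = 0" "representation B d d = 1"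
    using representation_basis[OF B(1)] cd by auto
  have perms: "{\<sigma>. \<sigma> permutes B} = {id, Transposition.transpose c d}"
    unfolding cd(1) by (auto simp: permutes_doubleton_iff)
  have "id \<noteq> Transposition.transpose c d"
    using cd(2) by (metis id_apply transpose_apply_first)
  then have "det_on ?S (ap A) = p' * t' - r' * s'"
    unfolding det_on_def Let_def B_def[symmetric] perms
    using cd(2)
    by (simp add: cd(1) sign_swap_id sign_id Ac Ad rep[unfolded cd(1)] basis[unfolded cd(1)])
  moreover have "trace_on ?S (ap A) = p + t" "trace_on ?S (ap A) = p' + t'"
    using trace_on_plane[OF ind _ _ Aa Ab] trace_on_plane[OF ind' cd(2) _ _ Ac Ad] S by auto
  moreover have "trace_on ?S (ap (A * A)) = (p\<^sup>2 + r * s) + (t\<^sup>2 + r * s)"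
    by (rule trace_on_plane[OF ind, where r = "p * r + r * t" and s = "s * p + t * s"])
      (simp_all add: Aa Ab algebra_simps power2_eq_square)
  moreover have "trace_on ?S (ap (A * A)) = (p'\<^sup>2 + r' * s') + (t'\<^sup>2 + r' * s')"
    unfolding S by (rule trace_on_plane[OF ind' cd(2), where r = "p' * r' + r' * t'" and s = "s' * p' + t' * s'"])
      (simp_all add: Ac Ad algebra_simps power2_eq_square)
  ultimately have "p + t = p' + t'" "p\<^sup>2 + t\<^sup>2 + 2 * (r * s) = p'\<^sup>2 + t'\<^sup>2 + 2 * (r' * s')"
    "det_on ?S (ap A) = p' * t' - r' * s'" by linarith+
  moreover have "2 * (p * t - r * s) = (p + t)\<^sup>2 - (p\<^sup>2 + t\<^sup>2 + 2 * (r * s))"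
    "2 * (p' * t' - r' * s') = (p' + t')\<^sup>2 - (p'\<^sup>2 + t'\<^sup>2 + 2 * (r' * s'))"
    by (simp_all add: power2_eq_square algebra_simps)
  ultimately show ?thesis by simp
qed

section \<open>Existence of logarithms\<close>

context symmetric_form
begin

lemma symmetric_on_span:
  assumes "\<And>x y. x \<in> B \<Longrightarrow> y \<in> B \<Longrightarrow> q (ap X x) y = q x (ap X y)" shows "symmetric_on X (span B)"
proof -
  have lin: "linear (\<lambda>y. q (ap X x) y)" "linear (\<lambda>y. q x (ap X y))" "linear (\<lambda>x. q (ap X x) y)" "linear (\<lambda>x. q x (ap X y))" for x y
    by (auto intro!: linearI)
  have "q (ap X x) y = q x (ap X y)" if "x \<in> B" "y \<in> span B" for x y
    using linear_eq_on_span[OF lin(1,2) _ that(2), of x x] assms that(1) by blast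
  then show ?thesis
    unfolding symmetric_on_def using linear_eq_on_span[OF lin(3,4)] by blast
qed

lemma log_on_span:
  assumes "\<And>b. b \<in> B \<Longrightarrow> ap X b \<in> span B" "\<And>x y. x \<in> B \<Longrightarrow> y \<in> B \<Longrightarrow> q (ap X x) y = q x (ap X y)"
    and "\<And>b. b \<in> B \<Longrightarrow> ap (exp X) b = ap A b"
  shows "log_on X A (span B)"
  using preserves_span[OF assms(1)] symmetric_on_span[OF assms(2)] ap_eq_on_span[OF assms(3)]
  by (auto simp: log_on_def)

text \<open>
  In an orthogonal basis of eigenvectors of \<open>A\<close> all eigenvalues are positive, and one takes their logarithms.
\<close>

lemma positive_log:
  assumes T: "subspace T" "posdef T" and A: "preserves A T" "symmetric_on A T"
    and pos: "\<And>x. x \<in> T \<Longrightarrow> x \<noteq> 0 \<Longrightarrow> q (ap A x) x > 0"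
  obtains X where "log_on X A T"
proof -
  obtain F where F: "finite F" "span F = T" "0 \<notin> F" "\<And>f g. f \<in> F \<Longrightarrow> g \<in> F \<Longrightarrow> f \<noteq> g \<Longrightarrow> q f g = 0"
    "\<And>f. f \<in> F \<Longrightarrow> \<exists>\<mu>. ap A f = \<mu> *\<^sub>R f"
    using posdef_eigenbasis[OF T A] by metis
  then obtain \<mu> where \<mu>: "\<And>f. f \<in> F \<Longrightarrow> ap A f = \<mu> f *\<^sub>R f" by metis
  have FT: "f \<in> T" "f \<noteq> 0" if "f \<in> F" for f using F span_base that by auto
  then have qf: "q f f > 0" if "f \<in> F" for f using T(2) that by (auto simp: posdef_def)
  have \<mu>pos: "\<mu> f > 0" if "f \<in> F" for f
  proof -
    have "\<mu> f * q f f > 0" using pos[OF FT[OF that]] \<mu>[OF that] by simp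
    then show ?thesis using qf[OF that] by (simp add: zero_less_mult_iff)
  qed
  have ind: "independent F" using F qf by (intro orthogonal_independent) force+
  obtain X where X: "\<And>f. f \<in> F \<Longrightarrow> ap X f = ln (\<mu> f) *\<^sub>R f"
    using endo_with_values[OF ind, of "\<lambda>f. ln (\<mu> f) *\<^sub>R f"] by blast
  have "log_on X A (span F)"
  proof (rule log_on_span)
    show "ap X f \<in> span F" if "f \<in> F" for f using X[OF that] that by (simp add: span_scale span_base)
    show "q (ap X f) g = q f (ap X g)" if "f \<in> F" "g \<in> F" for f g
      using X that F(4)[OF that] by (cases "f = g") auto
    show "ap (exp X) f = ap A f" if "f \<in> F" for f
      using exp_on_eigenvector[OF X[OF that], of 1] \<mu>[OF that] \<mu>pos[OF that] by simp
  qed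
  then show ?thesis using that F(2) by simp
qed

lemma log_on_rotation:
  assumes X: "ap X a = \<alpha> *\<^sub>R a + \<beta> *\<^sub>R b" "ap X b = \<alpha> *\<^sub>R b - \<beta> *\<^sub>R a" and "q b b = - q a a"
    and A: "ap A a = exp \<alpha> *\<^sub>R (cos \<beta> *\<^sub>R a + sin \<beta> *\<^sub>R b)" "ap A b = exp \<alpha> *\<^sub>R (cos \<beta> *\<^sub>R b - sin \<beta> *\<^sub>R a)"
  shows "log_on X A (span {a, b})"
proof (rule log_on_span)
  show "ap X c \<in> span {a, b}" if "c \<in> {a, b}" for c
    using that in_span_pair(3)[of \<alpha> a \<beta> b] in_span_pair(3)[of "- \<beta>" a \<alpha> b] X by auto
  show "q (ap X c) d = q c (ap X d)" if "c \<in> {a, b}" "d \<in> {a, b}" for c d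
    using that assms(3) by (auto simp: X algebra_simps sym)
  show "ap (exp X) c = ap A c" if "c \<in> {a, b}" for c
    using that exp_on_rotation[OF X, of 1] exp_on_rotation[of X b \<alpha> \<beta> "- a" 1] X A by auto
qed

end

context nondegenerate_form
begin

lemma \<pi>_complement: "x \<in> complement S UNIV \<Longrightarrow> ap \<pi> x = 0"
proof -
  assume x: "x \<in> complement S UNIV"
  have "ap \<pi> x = (\<Sum>b\<in>Bas. (q b b * q (ap \<pi> x) b) *\<^sub>R b)" using expand[of "ap \<pi> x"] by simp
  also have "\<dots> = 0"
    using x q_\<pi> Bas_subset sym by (intro sum.neutral) (auto simp: complement_def)
  finally show ?thesis .
qed

text \<open>
  The projection \<open>\<pi>\<close> vanishes on the complement, so \<open>X \<pi> + Y (1 - \<pi>)\<close> is \<open>X\<close> on one summand and \<open>Y\<close> on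
  the other.
\<close>

lemma log_extend:
  assumes X: "log_on X A S" and Y: "log_on Y A (complement S UNIV)"
  obtains Z where "log_on Z A UNIV" "\<And>x. x \<in> S \<Longrightarrow> ap Z x = ap X x"
proof -
  let ?T = "complement S UNIV"
  define Z where "Z = X * \<pi> + Y * (1 - \<pi>)"
  have "restrict_form q S \<in> inner_products (card P) (card N) S"
    using inner_products_iff[OF subspace_S] basis by blast
  then have UN: "\<exists>s t. x = s + t \<and> s \<in> S \<and> t \<in> ?T" for x
    using complement_split(1)[OF subspace_S subset_UNIV subspace_UNIV] by blast
  have ZS: "ap Z x = ap X x" if "x \<in> S" for x using that by (simp add: Z_def)
  have ZT: "ap Z x = ap Y x" if "x \<in> ?T" for x using \<pi>_complement[OF that] by (simp add: Z_def)
  have X': "preserves X S" "symmetric_on X S" "\<And>x. x \<in> S \<Longrightarrow> ap (exp X) x = ap A x"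
    and Y': "preserves Y ?T" "symmetric_on Y ?T" "\<And>x. x \<in> ?T \<Longrightarrow> ap (exp Y) x = ap A x"
    using X Y by (auto simp: log_on_def)
  have orth: "q s t = 0" "q t s = 0" if "s \<in> S" "t \<in> ?T" for s t
    using that sym by (auto simp: complement_def)
  have "log_on Z A UNIV"
    unfolding log_on_def
  proof (intro conjI ballI)
    show "symmetric_on Z UNIV"
      unfolding symmetric_on_def
    proof (intro ballI)
      fix x y
      obtain s t where x: "x = s + t" "s \<in> S" "t \<in> ?T" using UN by blast
      obtain s' t' where y: "y = s' + t'" "s' \<in> S" "t' \<in> ?T" using UN by blast
      have mem: "ap X s \<in> S" "ap X s' \<in> S" "ap Y t \<in> ?T" "ap Y t' \<in> ?T"
        using X'(1) Y'(1) x y by (auto simp: preserves_def)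
      show "q (ap Z x) y = q x (ap Z y)"
        using X'(2) Y'(2) x(2,3) y(2,3) mem orth
        by (simp add: x(1) y(1) ZS ZT symmetric_on_def)
    qed
    fix x
    obtain s t where x: "x = s + t" "s \<in> S" "t \<in> ?T" using UN by blast
    show "ap (exp Z) x = ap A x"
      using exp_ap_cong[OF X'(1) ZS x(2)] exp_ap_cong[OF Y'(1) ZT x(3)] X'(3) Y'(3) x by simp
  qed (simp add: preserves_def)
  then show ?thesis using that ZS by blast
qed

end

section \<open>Pairs of Lorentzian forms\<close>

definition plane_alternative :: "'a::euclidean_space form \<Rightarrow> 'a form \<Rightarrow> bool" where
  "plane_alternative g0 g \<longleftrightarrow> (\<exists>S T B Bh.
     common_splitting g0 g 1 1 S (DIM('a) - 2) 0 T \<and>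
     g0 \<in> product_submanifold 1 1 S (DIM('a) - 2) 0 T \<and>
     g \<in> product_submanifold 1 1 S (DIM('a) - 2) 0 T \<and>
     totally_geodesic (DIM('a) - 1) 1 UNIV (product_submanifold 1 1 S (DIM('a) - 2) 0 T) \<and>
     (geodesic_exists (DIM('a) - 1) 1 UNIV g0 g \<longleftrightarrow>
        geodesic_exists 1 1 S (restrict_form g0 S) (restrict_form g S)) \<and>
     (exactly_one_geodesic (DIM('a) - 1) 1 UNIV g0 g \<longleftrightarrow>
        exactly_one_geodesic 1 1 S (restrict_form g0 S) (restrict_form g S)) \<and>
     related_by g0 g S B \<and>
     det_on S B > 0 \<and> Bh = (\<lambda>u. (1 / sqrt (det_on S B)) *\<^sub>R B u) \<and>
     (geodesic_exists 1 1 S (restrict_form g0 S) (restrict_form g S) \<longleftrightarrow>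
        trace_on S Bh > - 2 \<or> (\<forall>u\<in>S. Bh u = - u)))"

definition three_step_alternative :: "'a::euclidean_space form \<Rightarrow> 'a form \<Rightarrow> bool" where
  "three_step_alternative g0 g \<longleftrightarrow> (\<exists>S T B k x.
     common_splitting g0 g 2 1 S (DIM('a) - 3) 0 T \<and>
     g0 \<in> product_submanifold 2 1 S (DIM('a) - 3) 0 T \<and>
     g \<in> product_submanifold 2 1 S (DIM('a) - 3) 0 T \<and>
     totally_geodesic (DIM('a) - 1) 1 UNIV (product_submanifold 2 1 S (DIM('a) - 3) 0 T) \<and>
     related_by g0 g S B \<and> scaled_three_step_unipotent S B k x \<and>
     (\<exists>c. is_unique_geodesic (DIM('a) - 1) 1 UNIV g0 g c \<and>
        (\<forall>t\<in>{0..1}. \<exists>Bt.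
           (\<forall>u\<in>S. \<forall>w\<in>S. c t u w = g0 (Bt u) w) \<and>
           (\<forall>u\<in>S. Bt u =
              (k powr t) *\<^sub>R endo_exp (\<lambda>y. t *\<^sub>R (x y - (1/2) *\<^sub>R x (x y))) u) \<and>
           (\<forall>u\<in>S. Bt u =
              (k powr t) *\<^sub>R (u + t *\<^sub>R x u + (t * (t - 1) / 2) *\<^sub>R x (x u))))))"

text \<open>
  The endomorphism \<open>A\<close> relates the two forms. It is symmetric for both of them, so the normal form
  theorem and its ingredients can be used with either.
\<close>

locale lorentzian_pair = q: symmetric_form q + g: symmetric_form g for q g :: "'a::euclidean_space form" +
  fixes A :: "'a endo"
  assumes q_lorentzian: "q.lorentzian UNIV" and g_lorentzian: "g.lorentzian UNIV"
    and g_eq: "g x y = q (ap A x) y"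
begin

lemma A_symmetric: "q (ap A x) y = q x (ap A y)"
  by (metis g_eq g.sym q.sym)

lemma A_symmetric_on: "q.symmetric_on A V" and A_symmetric_on_g: "g.symmetric_on A V"
  by (auto simp: q.symmetric_on_def g.symmetric_on_def g_eq A_symmetric)

lemma A_injective: "ap A x = 0 \<Longrightarrow> x = 0"
  using g.lorentzian_nondegenerate[OF g_lorentzian, of x] by (simp add: g_eq)

lemma eigenvalue_nonzero: "ap A e = \<kappa> *\<^sub>R e \<Longrightarrow> e \<noteq> 0 \<Longrightarrow> \<kappa> \<noteq> 0"
  using A_injective[of e] by auto

lemma lorentzian_basis:
  assumes "subspace S" "q.lorentzian S"
  obtains P N where "nondegenerate_form q S P N"
proof -
  obtain P N where "q.orthonormal_basis P N S"
    using q.lorentzian_inner_products[OF assms] q.inner_products_iff[OF assms(1)] by blast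
  moreover have "S \<noteq> {0}" using assms(2) by (auto simp: q.lorentzian_def)
  ultimately have "nondegenerate_form q S P N"
    by (intro nondegenerate_form.intro nondegenerate_form_axioms.intro q.symmetric_form_axioms)
  then show ?thesis using that by blast
qed

lemma geodesic_iff_log:
  assumes S: "subspace S" "q.lorentzian S" "preserves A S"
  shows "geodesic_exists (dim S - 1) 1 S (restrict_form q S) (restrict_form g S) \<longleftrightarrow> (\<exists>X. q.log_on X A S)"
    and "exactly_one_geodesic (dim S - 1) 1 S (restrict_form q S) (restrict_form g S) \<longleftrightarrow>
      (\<exists>X. q.log_on X A S \<and> (\<forall>Y. q.log_on Y A S \<longrightarrow> (\<forall>x\<in>S. ap Y x = ap X x)))"
proof -
  obtain P N where "nondegenerate_form q S P N" using lorentzian_basis[OF S(1,2)] .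
  then interpret nondegenerate_form q S P N .
  show "geodesic_exists (dim S - 1) 1 S (restrict_form q S) (restrict_form g S) \<longleftrightarrow> (\<exists>X. q.log_on X A S)"
    using geodesic_exists_iff[OF q.lorentzian_inner_products[OF S(1,2)] S(3) g_eq] .
  show "exactly_one_geodesic (dim S - 1) 1 S (restrict_form q S) (restrict_form g S) \<longleftrightarrow>
      (\<exists>X. q.log_on X A S \<and> (\<forall>Y. q.log_on Y A S \<longrightarrow> (\<forall>x\<in>S. ap Y x = ap X x)))"
    using exactly_one_geodesic_iff[OF q.lorentzian_inner_products[OF S(1,2)] S(3) g_eq] .
qed

text \<open>
  An \<open>A\<close>-invariant subspace has the same orthogonal complement for \<open>q\<close> and for \<open>g\<close>. If it contains a
  timelike vector of each form, then both forms are definite on the complement, and \<open>A\<close> has a logarithm there.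
\<close>

lemma adapted_splitting:
  assumes S: "subspace S" "preserves A S" "dim S = k + 1"
    and t: "t \<in> S" "q t t < 0" and u: "u \<in> S" "g u u < 0"
  defines "T \<equiv> q.complement S UNIV"
  shows "common_splitting q g k 1 S (DIM('a) - (k + 1)) 0 T"
    and "q \<in> product_submanifold k 1 S (DIM('a) - (k + 1)) 0 T"
    and "g \<in> product_submanifold k 1 S (DIM('a) - (k + 1)) 0 T"
    and "totally_geodesic (DIM('a) - 1) 1 UNIV (product_submanifold k 1 S (DIM('a) - (k + 1)) 0 T)"
    and "related_by q g S (ap A)"
    and "\<exists>Y. q.log_on Y A T"
proof -
  have Sq: "q.lorentzian S" using q.lorentzian_subspace[OF subspace_UNIV q_lorentzian subset_UNIV t] .
  have Sg: "g.lorentzian S" using g.lorentzian_subspace[OF subspace_UNIV g_lorentzian subset_UNIV u] .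
  have rq: "restrict_form q S \<in> inner_products k 1 S" using q.lorentzian_inner_products[OF S(1) Sq] S(3) by simp
  have rg: "restrict_form g S \<in> inner_products k 1 S" using g.lorentzian_inner_products[OF S(1) Sg] S(3) by simp
  note split = q.complement_split[OF S(1) subset_UNIV subspace_UNIV rq, folded T_def]
  have T: "subspace T" unfolding T_def by (rule q.subspace_complement) simp
  have direct: "direct_sum S T"
    using S(1) T split unfolding direct_sum_def by blast
  have dimT: "dim T = DIM('a) - (k + 1)" using direct_sum_dim[OF direct] S(3) by simp
  have posT: "q.posdef T" unfolding T_def using q.posdef_complement[OF subspace_UNIV q_lorentzian subset_UNIV t] .
  have orth: "q x y = 0" "g x y = 0" if "x \<in> S" "y \<in> T" for x y
    using that S(2) by (auto simp: T_def q.complement_def g_eq preserves_def)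
  have posTg: "g.posdef T"
    using g.posdef_timelike_complement[OF subspace_UNIV g_lorentzian _ u(2)] orth(2)[OF u(1)]
    by (auto simp: g.posdef_def)
  have rT: "restrict_form q T \<in> inner_products (DIM('a) - (k + 1)) 0 T"
    "restrict_form g T \<in> inner_products (DIM('a) - (k + 1)) 0 T"
    using q.posdef_inner_products[OF T posT] g.posdef_inner_products[OF T posTg] dimT by auto
  show "common_splitting q g k 1 S (DIM('a) - (k + 1)) 0 T"
    using direct orth rq rg rT by (simp add: common_splitting_def)
  show "q \<in> product_submanifold k 1 S (DIM('a) - (k + 1)) 0 T"
    "g \<in> product_submanifold k 1 S (DIM('a) - (k + 1)) 0 T"
    using orth rq rg rT q.form g.form by (simp_all add: product_submanifold_def)
  have "k + 1 \<le> DIM('a)" using S(3) dim_subset_UNIV[of S] by simp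
  then show "totally_geodesic (DIM('a) - 1) 1 UNIV (product_submanifold k 1 S (DIM('a) - (k + 1)) 0 T)"
    using totally_geodesic_product[OF direct, of k "DIM('a) - (k + 1)"] by simp
  have AS: "ap A ` S = S"
  proof (rule subspace_dim_equal)
    show "subspace (ap A ` S)" using linear_subspace_image[OF linear_ap S(1)] .
    show "ap A ` S \<subseteq> S" using S(2) by (auto simp: preserves_def)
    have "inj (ap A)" using A_injective linear_injective_0[OF linear_ap] by blast
    then show "dim S \<le> dim (ap A ` S)" using dim_image_eq[OF linear_ap, of A S] by (simp add: inj_on_subset)
  qed (rule S(1))
  then show "related_by q g S (ap A)"
    using A_injective linear_injective_0[OF linear_ap, of A]
    by (auto simp: related_by_def automorphism_on_def endomorphism_on_def bij_betw_def g_eq intro: inj_on_subset)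
  have "preserves A T"
    unfolding T_def using q.preserves_complement[OF _ A_symmetric_on S(2) subset_UNIV] by (simp add: preserves_def)
  then show "\<exists>Y. q.log_on Y A T"
    using q.positive_log[OF T posT _ A_symmetric_on] posTg by (metis g.posdef_def g_eq)
qed

text \<open>
  Geodesics correspond to logarithms of \<open>A\<close>, on the plane and on the whole space, and a logarithm on the
  plane extends to the whole space. This leaves three possibilities, which settle existence and
  uniqueness on the plane and on the whole space at once: the logarithm exists and is unique on
  both; there are different ones on the plane, which extend; or there is none on either.
\<close>

lemma plane_alternativeI:
  assumes ab: "independent {a, b}" "a \<noteq> b" and Aa: "ap A a = p *\<^sub>R a + r *\<^sub>R b" and Ab: "ap A b = s *\<^sub>R a + w *\<^sub>R b"
    and t: "t \<in> span {a, b}" "q t t < 0" and u: "u \<in> span {a, b}" "g u u < 0"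
    and d: "d = p * w - r * s" "d > 0"
    and logs: "((\<exists>X. q.log_on X A (span {a, b})) \<and>
        (\<forall>X Y x. q.log_on X A (span {a, b}) \<longrightarrow> q.log_on Y A (span {a, b}) \<longrightarrow> x \<in> span {a, b} \<longrightarrow> ap X x = ap Y x) \<and>
        (\<forall>X Y x. q.log_on X A UNIV \<longrightarrow> q.log_on Y A UNIV \<longrightarrow> ap X x = ap Y x) \<and> p + w > - 2 * sqrt d)
      \<or> ((\<exists>X Y. q.log_on X A (span {a, b}) \<and> q.log_on Y A (span {a, b}) \<and> (\<exists>x\<in>span {a, b}. ap X x \<noteq> ap Y x)) \<and>
          (p + w > - 2 * sqrt d \<or> ap A a = - sqrt d *\<^sub>R a \<and> ap A b = - sqrt d *\<^sub>R b))
      \<or> ((\<forall>X. \<not> q.log_on X A (span {a, b})) \<and> (\<forall>X. \<not> q.log_on X A UNIV) \<and> p + w \<le> - 2 * sqrt d \<and>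
          (ap A a \<noteq> - sqrt d *\<^sub>R a \<or> ap A b \<noteq> - sqrt d *\<^sub>R b))"
  shows "plane_alternative q g"
proof -
  define S where "S = span {a, b}"
  define T where "T = q.complement S UNIV"
  define Bh where "Bh = (\<lambda>u. (1 / sqrt (det_on S (ap A))) *\<^sub>R ap A u)"
  have det: "det_on S (ap A) = d" using det_on_plane[OF ab Aa Ab] by (simp add: S_def d)
  have S: "subspace S" "preserves A S" "dim S = 1 + 1"
  proof -
    show "preserves A S" unfolding S_def using in_span_pair(3) by (intro preserves_span_pair) (simp_all add: Aa Ab)
    show "dim S = 1 + 1" using dim_eq_card_independent[OF ab(1)] ab(2) by (simp add: S_def)
  qed (simp add: S_def)
  note split = adapted_splitting[OF S t[folded S_def] u[folded S_def], folded T_def, simplified]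
  have L: "q.lorentzian S" using q.lorentzian_subspace[OF subspace_UNIV q_lorentzian subset_UNIV t] by (simp add: S_def)
  note iffS = geodesic_iff_log[OF S(1) L S(2), unfolded S(3) add_diff_cancel_right']
  have U: "preserves A UNIV" by (simp add: preserves_def)
  have res: "restrict_form h UNIV = h" for h :: "'a form" by (simp add: restrict_form_def)
  note iffU = geodesic_iff_log[OF subspace_UNIV q_lorentzian U, unfolded res dim_UNIV]
  obtain Y where Y: "q.log_on Y A T" using split(6) by blast
  have extend: "\<exists>Z. q.log_on Z A UNIV \<and> (\<forall>x\<in>S. ap Z x = ap X x)" if X: "q.log_on X A S" for X
  proof -
    obtain P N where "nondegenerate_form q S P N" using lorentzian_basis[OF S(1) L] .
    then interpret S: nondegenerate_form q S P N .
    obtain Z where "q.log_on Z A UNIV" "\<And>x. x \<in> S \<Longrightarrow> ap Z x = ap X x"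
      by (rule S.log_extend[OF X Y[unfolded T_def]]) (rule that)
    then show ?thesis by blast
  qed
  have trace: "trace_on S Bh = (p + w) / sqrt d"
  proof -
    have "trace_on S Bh = p / sqrt d + w / sqrt d"
      unfolding S_def
      by (rule trace_on_plane[OF ab, where r = "r / sqrt d" and s = "s / sqrt d"])
        (simp_all add: Bh_def det Aa Ab algebra_simps)
    then show ?thesis by (simp add: add_divide_distrib)
  qed
  have sq: "sqrt d > 0" using d(2) by simp
  have minus_id: "(\<forall>u\<in>S. Bh u = - u) \<longleftrightarrow> ap A a = - sqrt d *\<^sub>R a \<and> ap A b = - sqrt d *\<^sub>R b"
  proof
    assume B: "\<forall>u\<in>S. Bh u = - u"
    have "ap A x = - sqrt d *\<^sub>R x" if "x \<in> S" for x
    proof -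
      have "sqrt d *\<^sub>R Bh x = sqrt d *\<^sub>R (- x)" using B that by simp
      then show ?thesis using sq by (simp add: Bh_def det)
    qed
    then show "ap A a = - sqrt d *\<^sub>R a \<and> ap A b = - sqrt d *\<^sub>R b"
      by (simp add: S_def span_base)
  next
    assume *: "ap A a = - sqrt d *\<^sub>R a \<and> ap A b = - sqrt d *\<^sub>R b"
    have "ap A x = ap (- sqrt d *\<^sub>R 1) x" if "x \<in> S" for x
    proof (rule ap_eq_on_span)
      show "ap A c = ap (- sqrt d *\<^sub>R 1) c" if "c \<in> {a, b}" for c using * that by (elim insertE) auto
      show "x \<in> span {a, b}" using that by (simp add: S_def)
    qed
    then show "\<forall>u\<in>S. Bh u = - u" using sq by (simp add: Bh_def det)
  qed
  have trace_iff: "trace_on S Bh > - 2 \<longleftrightarrow> p + w > - 2 * sqrt d"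
    using sq by (simp add: trace field_simps)
  consider (unique) X where "q.log_on X A S" "\<And>X Y x. q.log_on X A S \<Longrightarrow> q.log_on Y A S \<Longrightarrow> x \<in> S \<Longrightarrow> ap X x = ap Y x"
      "\<And>X Y x. q.log_on X A UNIV \<Longrightarrow> q.log_on Y A UNIV \<Longrightarrow> ap X x = ap Y x" "p + w > - 2 * sqrt d"
    | (many) X Y x where "q.log_on X A S" "q.log_on Y A S" "x \<in> S" "ap X x \<noteq> ap Y x"
      "p + w > - 2 * sqrt d \<or> ap A a = - sqrt d *\<^sub>R a \<and> ap A b = - sqrt d *\<^sub>R b"
    | (none) "\<And>X. \<not> q.log_on X A S" "\<And>X. \<not> q.log_on X A UNIV" "\<not> p + w > - 2 * sqrt d"
      "\<not> (ap A a = - sqrt d *\<^sub>R a \<and> ap A b = - sqrt d *\<^sub>R b)"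
    using logs unfolding S_def[symmetric] not_less by blast
  then have "((\<exists>X. q.log_on X A S) \<longleftrightarrow> p + w > - 2 * sqrt d \<or> ap A a = - sqrt d *\<^sub>R a \<and> ap A b = - sqrt d *\<^sub>R b) \<and>
      ((\<exists>X. q.log_on X A UNIV) \<longleftrightarrow> (\<exists>X. q.log_on X A S)) \<and>
      ((\<exists>X. q.log_on X A UNIV \<and> (\<forall>Y. q.log_on Y A UNIV \<longrightarrow> (\<forall>x\<in>UNIV. ap Y x = ap X x))) \<longleftrightarrow>
       (\<exists>X. q.log_on X A S \<and> (\<forall>Y. q.log_on Y A S \<longrightarrow> (\<forall>x\<in>S. ap Y x = ap X x))))" (is ?G)
  proof cases
    case (unique X)
    obtain Z where Z: "q.log_on Z A UNIV" using extend[OF unique(1)] by blast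
    have "\<exists>X. q.log_on X A S \<and> (\<forall>Y. q.log_on Y A S \<longrightarrow> (\<forall>x\<in>S. ap Y x = ap X x))"
      using unique(1,2) by blast
    moreover have "\<exists>X. q.log_on X A UNIV \<and> (\<forall>Y. q.log_on Y A UNIV \<longrightarrow> (\<forall>x\<in>UNIV. ap Y x = ap X x))"
      using Z unique(3) by blast
    ultimately show ?G
      using unique(4) by blast
  next
    case (many X Y x)
    obtain X' where X': "q.log_on X' A UNIV" "\<And>x. x \<in> S \<Longrightarrow> ap X' x = ap X x" using extend[OF many(1)] by blast
    obtain Y' where Y': "q.log_on Y' A UNIV" "\<And>x. x \<in> S \<Longrightarrow> ap Y' x = ap Y x" using extend[OF many(2)] by blast
    have "\<not> (\<exists>X. q.log_on X A S \<and> (\<forall>Y. q.log_on Y A S \<longrightarrow> (\<forall>x\<in>S. ap Y x = ap X x)))"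
    proof (intro notI, elim exE conjE)
      fix Z assume "\<forall>Y. q.log_on Y A S \<longrightarrow> (\<forall>x\<in>S. ap Y x = ap Z x)"
      then have "ap X x = ap Z x" "ap Y x = ap Z x" using many(1-3) by blast+
      then show False using many(4) by simp
    qed
    moreover have "\<not> (\<exists>X. q.log_on X A UNIV \<and> (\<forall>Y. q.log_on Y A UNIV \<longrightarrow> (\<forall>x\<in>UNIV. ap Y x = ap X x)))"
    proof (intro notI, elim exE conjE)
      fix Z assume "\<forall>Y. q.log_on Y A UNIV \<longrightarrow> (\<forall>x\<in>UNIV. ap Y x = ap Z x)"
      then have "ap X' x = ap Z x" "ap Y' x = ap Z x" using X'(1) Y'(1) by blast+
      then show False using many(4) X'(2)[OF many(3)] Y'(2)[OF many(3)] by simp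
    qed
    ultimately show ?G
      using many(1,5) X'(1) by blast
  next
    case none
    then show ?G
      by blast
  qed
  then have "(geodesic_exists 1 1 S (restrict_form q S) (restrict_form g S) \<longleftrightarrow>
        trace_on S Bh > - 2 \<or> (\<forall>u\<in>S. Bh u = - u)) \<and>
      (geodesic_exists (DIM('a) - 1) 1 UNIV q g \<longleftrightarrow>
        geodesic_exists 1 1 S (restrict_form q S) (restrict_form g S)) \<and>
      (exactly_one_geodesic (DIM('a) - 1) 1 UNIV q g \<longleftrightarrow>
        exactly_one_geodesic 1 1 S (restrict_form q S) (restrict_form g S))"
    unfolding iffS iffU trace_iff minus_id .
  then show ?thesis
    unfolding plane_alternative_def
    using split(1-5) d(2) det Bh_def
    by (intro exI[of _ S] exI[of _ T] exI[of _ "ap A"] exI[of _ Bh]) (simp add: numeral_2_eq_2)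
qed

end

context lorentzian_pair
begin

lemma lorentzian_of_timelike: "t \<in> S \<Longrightarrow> q t t < 0 \<Longrightarrow> q.lorentzian S"
  using q.lorentzian_subspace[OF subspace_UNIV q_lorentzian subset_UNIV] .

text \<open>
  The angle of the rotation can be changed by \<open>2\<pi>\<close>.
\<close>

lemma many_logs:
  assumes ab: "independent {a, b}" "a \<noteq> b" and "q b b = - q a a" and "\<rho> > 0"
    and A: "ap A a = \<rho> *\<^sub>R (cos \<theta> *\<^sub>R a + sin \<theta> *\<^sub>R b)" "ap A b = \<rho> *\<^sub>R (cos \<theta> *\<^sub>R b - sin \<theta> *\<^sub>R a)"
  shows "\<exists>X Y. q.log_on X A (span {a, b}) \<and> q.log_on Y A (span {a, b}) \<and> (\<exists>x\<in>span {a, b}. ap X x \<noteq> ap Y x)"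
proof -
  have "\<exists>X. q.log_on X A (span {a, b}) \<and> ap X a = ln \<rho> *\<^sub>R a + \<phi> *\<^sub>R b"
    if \<phi>: "cos \<phi> = cos \<theta>" "sin \<phi> = sin \<theta>" for \<phi>
  proof -
    obtain X where X: "\<And>c. c \<in> {a, b} \<Longrightarrow> ap X c = (if c = a then ln \<rho> *\<^sub>R a + \<phi> *\<^sub>R b else ln \<rho> *\<^sub>R b - \<phi> *\<^sub>R a)"
      using endo_with_values[OF ab(1), of "\<lambda>c. if c = a then ln \<rho> *\<^sub>R a + \<phi> *\<^sub>R b else ln \<rho> *\<^sub>R b - \<phi> *\<^sub>R a"] by blast
    have Xab: "ap X a = ln \<rho> *\<^sub>R a + \<phi> *\<^sub>R b" "ap X b = ln \<rho> *\<^sub>R b - \<phi> *\<^sub>R a"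
      using X[of a] X[of b] ab(2) by auto
    have "q.log_on X A (span {a, b})"
      using A \<open>\<rho> > 0\<close> by (intro q.log_on_rotation[OF Xab assms(3)]) (simp_all add: \<phi>)
    with Xab(1) show ?thesis by blast
  qed
  from this[of \<theta>] this[of "\<theta> + 2 * pi"]
  obtain X Y where XY: "q.log_on X A (span {a, b})" "ap X a = ln \<rho> *\<^sub>R a + \<theta> *\<^sub>R b"
    "q.log_on Y A (span {a, b})" "ap Y a = ln \<rho> *\<^sub>R a + (\<theta> + 2 * pi) *\<^sub>R b"
    by auto
  have "b \<noteq> 0" using ab(1) dependent_zero[of "{a, b}"] by auto
  then have "ap X a \<noteq> ap Y a" using XY(2,4) by simp
  with XY show ?thesis using in_span_pair(1)[of a b] by blast
qed

text \<open>
  On the plane of \<open>e\<close> and \<open>f\<close> the endomorphism is a multiple of the identity, that is, a rotation by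
  the angle \<open>0\<close> or \<open>\<pi>\<close>, stretched by \<open>|\<kappa>|\<close>.
\<close>

lemma multiple_eigenvalue_case:
  assumes ef: "q e e = -1" "q f f = 1" "q e f = 0" and A: "ap A e = \<kappa> *\<^sub>R e" "ap A f = \<kappa> *\<^sub>R f"
  shows "plane_alternative q g"
proof -
  have ne: "e \<noteq> f" using ef by auto
  have ind: "independent {e, f}"
    using ef q.sym[of f e] by (intro q.orthogonal_independent) auto
  have "e \<noteq> 0" using ef by auto
  then have \<kappa>: "\<kappa> \<noteq> 0" using eigenvalue_nonzero[OF A(1)] by simp
  define \<theta> where "\<theta> = (if \<kappa> > 0 then 0 else pi)"
  have \<theta>: "\<bar>\<kappa>\<bar> * cos \<theta> = \<kappa>" "sin \<theta> = 0" by (auto simp: \<theta>_def)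
  have many: "\<exists>X Y. q.log_on X A (span {e, f}) \<and> q.log_on Y A (span {e, f}) \<and> (\<exists>x\<in>span {e, f}. ap X x \<noteq> ap Y x)"
    using ind ne ef \<kappa> \<theta> A by (intro many_logs[where \<rho> = "\<bar>\<kappa>\<bar>" and \<theta> = \<theta>]) simp_all
  have u: "\<exists>u\<in>span {e, f}. g u u < 0"
  proof (cases "\<kappa> > 0")
    case True
    then have "g e e < 0" by (simp add: g_eq A ef)
    then show ?thesis using in_span_pair(1)[of e f] by blast
  next
    case False
    then have "g f f < 0" using \<kappa> by (simp add: g_eq A ef)
    then show ?thesis using in_span_pair(2)[of f e] by blast
  qed
  then obtain u where u: "u \<in> span {e, f}" "g u u < 0" by blast
  have cond: "\<kappa> + \<kappa> > - 2 * sqrt (\<kappa>\<^sup>2) \<or> ap A e = - sqrt (\<kappa>\<^sup>2) *\<^sub>R e \<and> ap A f = - sqrt (\<kappa>\<^sup>2) *\<^sub>R f"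
    using \<kappa> A by (cases "\<kappa> > 0") auto
  show ?thesis
  proof (rule plane_alternativeI[OF ind ne _ _ in_span_pair(1) _ u])
    show "ap A e = \<kappa> *\<^sub>R e + 0 *\<^sub>R f" "ap A f = 0 *\<^sub>R e + \<kappa> *\<^sub>R f" using A by simp_all
    show "q e e < 0" using ef by simp
    show "\<kappa>\<^sup>2 = \<kappa> * \<kappa> - 0 * 0" by (simp add: power2_eq_square)
    show "0 < \<kappa>\<^sup>2" using \<kappa> by simp
  qed (use many cond in blast)
qed

text \<open>
  The endomorphism acts as multiplication by \<open>\<alpha> + i \<beta> = \<rho> exp(i \<theta>)\<close>.
\<close>

lemma complex_case:
  assumes "\<beta> \<noteq> 0" and Aw: "ap A w = \<alpha> *\<^sub>R w + \<beta> *\<^sub>R u" and Au: "ap A u = \<alpha> *\<^sub>R u - \<beta> *\<^sub>R w"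
    and t: "t \<in> span {w, u}" "q t t < 0"
  shows "plane_alternative q g"
proof -
  have no_real: "x = 0" if "x \<in> span {w, u}" "ap A x = c *\<^sub>R x" for x c
    using q.complex_plane_no_real_eigenvector[OF assms(1) Aw Au that] .
  have u0: "u \<noteq> 0"
  proof
    assume "u = 0"
    then have "w = 0" using no_real[OF in_span_pair(1), of \<alpha>] Aw by simp
    then show False using t \<open>u = 0\<close> by simp
  qed
  have wu: "w \<notin> span {u}"
  proof
    assume "w \<in> span {u}"
    then obtain c where "w = c *\<^sub>R u" by (auto simp: span_singleton)
    then have "ap A u = (\<alpha> - \<beta> * c) *\<^sub>R u" using Au by (simp add: algebra_simps)
    then show False using no_real[OF in_span_pair(2)] u0 by blast
  qed
  then have ind: "independent {w, u}" and ne: "w \<noteq> u"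
    using u0 by (auto simp: independent_insert intro: span_base)
  then have "w \<noteq> 0" using dependent_zero[of "{w, u}"] by auto
  then obtain u' where u': "u' \<in> span {w, u}" "g u' u' < 0"
    using g.timelike_in_complex_plane[OF subspace_UNIV g_lorentzian A_symmetric_on_g _ _ _ assms(1) Aw Au] by blast
  define \<rho> where "\<rho> = sqrt (\<alpha>\<^sup>2 + \<beta>\<^sup>2)"
  have pos: "\<alpha>\<^sup>2 + \<beta>\<^sup>2 > 0" using assms(1) by (simp add: add_nonneg_pos)
  then have \<rho>: "\<rho> > 0" by (simp add: \<rho>_def)
  have \<rho>2: "\<rho>\<^sup>2 = \<alpha>\<^sup>2 + \<beta>\<^sup>2" using pos by (simp add: \<rho>_def)
  have "(\<alpha> / \<rho>)\<^sup>2 + (\<beta> / \<rho>)\<^sup>2 = (\<alpha>\<^sup>2 + \<beta>\<^sup>2) / \<rho>\<^sup>2" by (simp add: power_divide add_divide_distrib)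
  also have "\<dots> = 1" unfolding \<rho>2 using pos by (intro divide_self) linarith
  finally obtain \<theta> where \<theta>: "\<alpha> / \<rho> = cos \<theta>" "\<beta> / \<rho> = sin \<theta>" using sincos_total_2pi by metis
  then have \<theta>': "\<alpha> = \<rho> * cos \<theta>" "\<beta> = \<rho> * sin \<theta>" using \<rho> by (simp_all add: field_simps)
  have "q (ap A w) u = q w (ap A u)" by (rule A_symmetric)
  then have "\<beta> * (q u u + q w w) = 0" by (simp add: Aw Au algebra_simps)
  then have uu: "q u u = - q w w" using assms(1) by simp
  have many: "\<exists>X Y. q.log_on X A (span {w, u}) \<and> q.log_on Y A (span {w, u}) \<and> (\<exists>x\<in>span {w, u}. ap X x \<noteq> ap Y x)"
    using Aw Au by (intro many_logs[OF ind ne uu \<rho>, of \<theta>]) (simp_all add: \<theta>' algebra_simps)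
  have "\<bar>\<alpha>\<bar> < \<rho>"
    unfolding \<rho>_def using assms(1) by (intro real_less_rsqrt) simp
  then have cond: "\<alpha> + \<alpha> > - 2 * sqrt (\<alpha>\<^sup>2 + \<beta>\<^sup>2)" by (simp add: \<rho>_def)
  show ?thesis
  proof (rule plane_alternativeI[OF ind ne Aw _ t u'])
    show "ap A u = (- \<beta>) *\<^sub>R w + \<alpha> *\<^sub>R u" using Au by simp
    show "\<alpha>\<^sup>2 + \<beta>\<^sup>2 = \<alpha> * \<alpha> - \<beta> * - \<beta>" by (simp add: power2_eq_square)
  qed (use many cond pos in blast)+
qed

lemma negative_vector:
  assumes "g e e = 0" "g e f \<noteq> 0" shows "\<exists>c. g (f + c *\<^sub>R e) (f + c *\<^sub>R e) < 0"
proof -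
  define c where "c = - (g f f + 1) / (2 * g e f)"
  have "g (f + c *\<^sub>R e) (f + c *\<^sub>R e) = g f f + 2 * c * g e f"
    using assms(1) by (simp add: g.sym[of f e] algebra_simps)
  also have "\<dots> < 0" using assms(2) by (simp add: c_def field_simps)
  finally show ?thesis by blast
qed

text \<open>
  The null vector \<open>e\<close> lies in the kernel and in the image of \<open>A - \<kappa>\<close> and makes \<open>A\<close> rigid. The logarithm
  of the Jordan block exists precisely for \<open>\<kappa> > 0\<close>.
\<close>

lemma two_step_case:
  assumes e: "e \<noteq> 0" and Ae: "ap A e = \<kappa> *\<^sub>R e" and Af: "ap A f = \<kappa> *\<^sub>R f + e"
    and t: "t \<in> span {e, f}" "q t t < 0"
  shows "plane_alternative q g"
proof -
  let ?S = "span {e, f}"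
  have S: "subspace ?S" by simp
  have L: "q.lorentzian ?S" using lorentzian_of_timelike[OF t] .
  have f: "f \<notin> span {e}"
  proof
    assume "f \<in> span {e}"
    then obtain c where "f = c *\<^sub>R e" by (auto simp: span_singleton)
    then show False using Af Ae e by (simp add: mult.commute)
  qed
  then have ind: "independent {e, f}" and ne: "e \<noteq> f"
    using e independent_insert[of f "{e}"] by (auto simp: insert_commute intro: span_base)
  have \<kappa>: "\<kappa> \<noteq> 0" using eigenvalue_nonzero[OF Ae e] .
  have "q (ap A f) e = q f (ap A e)" by (rule A_symmetric)
  then have ee: "q e e = 0" by (simp add: Af Ae)
  have ef: "q e f \<noteq> 0"
  proof
    assume "q e f = 0"
    then have "q e x = 0" if "x \<in> ?S" for x using that ee by (auto elim!: in_span_pairE)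
    then show False using q.lorentzian_nondegenerate[OF L in_span_pair(1)] e by blast
  qed
  have "g e e = 0" "g e f \<noteq> 0" using \<kappa> ee ef by (simp_all add: g_eq Ae)
  then obtain c where u: "g (f + c *\<^sub>R e) (f + c *\<^sub>R e) < 0" using negative_vector by blast
  have uS: "f + c *\<^sub>R e \<in> ?S" using in_span_pair(3)[of c e 1 f] by (simp add: add.commute)
  have rigid: "q.rigid e A ?S" "q.rigid e A UNIV"
    using q.rigid_chain[OF S L A_symmetric_on in_span_pair(1) e Ae _ Af] in_span_pair(2)[of f e]
      q.rigid_chain[OF subspace_UNIV q_lorentzian A_symmetric_on UNIV_I e Ae UNIV_I Af] by auto
  have agree: "ap X x = ap Y x" if "q.log_on X A ?S" "q.log_on Y A ?S" "x \<in> ?S" for X Y x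
    using q.rigid_log_unique[OF S L rigid(1) in_span_pair(1) e _ Ae that] ee by simp
  have agree': "ap X x = ap Y x" if "q.log_on X A UNIV" "q.log_on Y A UNIV" for X Y x
    using q.rigid_log_unique[OF subspace_UNIV q_lorentzian rigid(2) UNIV_I e _ Ae that UNIV_I] ee by simp
  have log: "\<exists>X. q.log_on X A ?S" if \<kappa>: "\<kappa> > 0"
  proof -
    define N where "N = (1 / \<kappa>) *\<^sub>R (A - \<kappa> *\<^sub>R 1)"
    define X where "X = ln \<kappa> *\<^sub>R 1 + N"
    have N: "ap N e = 0" "ap N f = (1 / \<kappa>) *\<^sub>R e" by (simp_all add: N_def Ae Af)
    have X: "ap X y = ln \<kappa> *\<^sub>R y + ap N y" for y by (simp add: X_def)
    have "q.log_on X A ?S"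
    proof (rule q.log_on_span)
      show "ap X b \<in> ?S" if "b \<in> {e, f}" for b
        using that in_span_pair(3)[of "ln \<kappa>" e 0 f] in_span_pair(3)[of "1 / \<kappa>" e "ln \<kappa>" f]
        by (auto simp: X N add.commute)
      show "q (ap X x) y = q x (ap X y)" for x y
        by (simp add: X N_def A_symmetric algebra_simps)
      show "ap (exp X) b = ap A b" if "b \<in> {e, f}" for b
        using that exp_on_jordan_chain[OF X, of b 1] \<kappa> N
        by (auto simp: Ae Af scaleR_add_right)
    qed
    then show ?thesis by blast
  qed
  have no_log: "\<not> q.log_on X A ?S \<and> \<not> q.log_on X A UNIV" if "\<not> \<kappa> > 0" for X
    using q.rigid_log[OF rigid(1) _ in_span_pair(1) e Ae] q.rigid_log[OF rigid(2) _ UNIV_I e Ae] that by blast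
  have trace: "\<kappa> > 0 \<Longrightarrow> \<kappa> + \<kappa> > - 2 * sqrt (\<kappa>\<^sup>2)" "\<not> \<kappa> > 0 \<Longrightarrow> \<kappa> + \<kappa> \<le> - 2 * sqrt (\<kappa>\<^sup>2)"
    "\<not> \<kappa> > 0 \<Longrightarrow> ap A f \<noteq> - sqrt (\<kappa>\<^sup>2) *\<^sub>R f"
    using e by (simp_all add: Af)
  show ?thesis
  proof (rule plane_alternativeI[OF ind ne _ _ t uS u])
    show "ap A e = \<kappa> *\<^sub>R e + 0 *\<^sub>R f" "ap A f = 1 *\<^sub>R e + \<kappa> *\<^sub>R f" using Ae Af by simp_all
    show "\<kappa>\<^sup>2 = \<kappa> * \<kappa> - 0 * 1" by (simp add: power2_eq_square)
    show "0 < \<kappa>\<^sup>2" using \<kappa> by simp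
  qed (use log no_log trace agree agree' in \<open>cases "\<kappa> > 0"; blast\<close>)
qed

text \<open>
  As the eigenvalue \<open>\<kappa>\<close> of \<open>e\<close> is simple, \<open>A\<close> is rigid. If \<open>\<kappa>\<close> and \<open>\<mu>\<close> are negative, they are
  different, so \<open>e\<close> would be an eigenvector of any logarithm, which is impossible; and the trace
  condition fails, by the inequality of the arithmetic and the geometric mean.
\<close>

lemma eigenpair_case:
  assumes e: "q e e < 0" "ap A e = \<kappa> *\<^sub>R e" and f: "q e f = 0" "f \<noteq> 0" "ap A f = \<mu> *\<^sub>R f" and pos: "\<kappa> * \<mu> > 0"
    and simple: "\<And>v. ap A v = \<kappa> *\<^sub>R v \<Longrightarrow> v \<in> span {e}"
  shows "plane_alternative q g"
proof -
  let ?S = "span {e, f}"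
  have S: "subspace ?S" by simp
  have ff: "q f f > 0"
    using q.posdef_timelike_complement[OF subspace_UNIV q_lorentzian UNIV_I e(1)] f by (auto simp: q.posdef_def)
  have ne: "e \<noteq> f" and e0: "e \<noteq> 0" using e(1) ff by auto
  have ind: "independent {e, f}"
    using e f ff q.sym[of f e] by (intro q.orthogonal_independent) auto
  have L: "q.lorentzian ?S" using lorentzian_of_timelike[OF in_span_pair(1) e(1)] .
  have u: "\<exists>u\<in>?S. g u u < 0"
  proof (cases "\<kappa> > 0")
    case True
    then have "g e e < 0" using e by (simp add: g_eq mult_pos_neg)
    then show ?thesis using in_span_pair(1)[of e f] by blast
  next
    case False
    then have "\<mu> < 0" using pos by (auto simp: zero_less_mult_iff)
    then have "g f f < 0" using f ff by (simp add: g_eq mult_neg_pos)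
    then show ?thesis using in_span_pair(2)[of f e] by blast
  qed
  then obtain u where u: "u \<in> ?S" "g u u < 0" by blast
  have rigid: "q.rigid e A ?S" "q.rigid e A UNIV"
    using q.rigid_simple[OF in_span_pair(1) e(2) simple] q.rigid_simple[OF UNIV_I e(2) simple] by auto
  have agree: "ap X x = ap Y x" if "q.log_on X A ?S" "q.log_on Y A ?S" "x \<in> ?S" for X Y x
    using q.rigid_log_unique[OF S L rigid(1) in_span_pair(1) e0 _ e(2) that] e(1) by simp
  have agree': "ap X x = ap Y x" if "q.log_on X A UNIV" "q.log_on Y A UNIV" for X Y x
    using q.rigid_log_unique[OF subspace_UNIV q_lorentzian rigid(2) UNIV_I e0 _ e(2) that UNIV_I] e(1) by simp
  have log: "\<exists>X. q.log_on X A ?S" if \<kappa>: "\<kappa> > 0"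
  proof -
    have \<mu>: "\<mu> > 0" using pos \<kappa> by (simp add: zero_less_mult_iff)
    obtain X where X: "\<And>c. c \<in> {e, f} \<Longrightarrow> ap X c = (if c = e then ln \<kappa> *\<^sub>R e else ln \<mu> *\<^sub>R f)"
      using endo_with_values[OF ind, of "\<lambda>c. if c = e then ln \<kappa> *\<^sub>R e else ln \<mu> *\<^sub>R f"] by blast
    have Xe: "ap X e = ln \<kappa> *\<^sub>R e" and Xf: "ap X f = ln \<mu> *\<^sub>R f" using X[of e] X[of f] ne by auto
    have "q.log_on X A ?S"
    proof (rule q.log_on_span)
      show "ap X b \<in> ?S" if "b \<in> {e, f}" for b
        using that by (auto simp: Xe Xf intro!: span_scale in_span_pair(1) in_span_pair(2))
      show "q (ap X x) y = q x (ap X y)" if "x \<in> {e, f}" "y \<in> {e, f}" for x y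
        using that f(1) q.sym[of f e] by (auto simp: Xe Xf)
      show "ap (exp X) b = ap A b" if "b \<in> {e, f}" for b
        using that exp_on_eigenvector[OF Xe, of 1] exp_on_eigenvector[OF Xf, of 1] \<kappa> \<mu> e f by auto
    qed
    then show ?thesis by blast
  qed
  have no_log: "\<not> q.log_on X A ?S \<and> \<not> q.log_on X A UNIV" if "\<not> \<kappa> > 0" for X
    using q.rigid_log[OF rigid(1) _ in_span_pair(1) e0 e(2)] q.rigid_log[OF rigid(2) _ UNIV_I e0 e(2)] that by blast
  have trace: "\<kappa> + \<mu> > - 2 * sqrt (\<kappa> * \<mu>)" if "\<kappa> > 0"
  proof -
    have "\<mu> > 0" "sqrt (\<kappa> * \<mu>) \<ge> 0" using pos that by (auto simp: zero_less_mult_iff)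
    then show ?thesis using that by linarith
  qed
  have trace': "\<kappa> + \<mu> \<le> - 2 * sqrt (\<kappa> * \<mu>)" if "\<not> \<kappa> > 0"
  proof -
    have "\<kappa> < 0" "\<mu> < 0" using pos that by (auto simp: zero_less_mult_iff)
    then show ?thesis using arith_geo_mean_sqrt[of "- \<kappa>" "- \<mu>"] by simp
  qed
  have distinct: "\<not> (ap A e = - sqrt (\<kappa> * \<mu>) *\<^sub>R e \<and> ap A f = - sqrt (\<kappa> * \<mu>) *\<^sub>R f)"
  proof
    assume *: "ap A e = - sqrt (\<kappa> * \<mu>) *\<^sub>R e \<and> ap A f = - sqrt (\<kappa> * \<mu>) *\<^sub>R f"
    then have "\<kappa> *\<^sub>R e = (- sqrt (\<kappa> * \<mu>)) *\<^sub>R e" using e(2) by simp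
    then have "\<kappa> = - sqrt (\<kappa> * \<mu>)" using e0 by (simp only: scaleR_cancel_right) blast
    then have "f \<in> span {e}" using simple[of f] * by simp
    then obtain c where "f = c *\<^sub>R e" by (auto simp: span_singleton)
    then show False using f(1,2) e(1) by auto
  qed
  show ?thesis
  proof (rule plane_alternativeI[OF ind ne _ _ in_span_pair(1) e(1) u])
    show "ap A e = \<kappa> *\<^sub>R e + 0 *\<^sub>R f" "ap A f = 0 *\<^sub>R e + \<mu> *\<^sub>R f" using e f by simp_all
    show "\<kappa> * \<mu> = \<kappa> * \<mu> - 0 * 0" "\<kappa> * \<mu> > 0" using pos by simp_all
  qed (use log no_log trace trace' distinct agree agree' in \<open>cases "\<kappa> > 0"; blast\<close>)
qed

text \<open>
  The second vector of the plane is an eigenvector \<open>f\<close> orthogonal to \<open>e\<close>, whose eigenvalue has to have the sign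
  of \<open>\<kappa>\<close>. If \<open>\<kappa> > 0\<close> then \<open>e\<close> is timelike for \<open>g\<close> as well, and all orthogonal eigenvalues are
  positive. If \<open>\<kappa> < 0\<close> then \<open>e\<close> is spacelike for \<open>g\<close>, and \<open>g\<close> must be negative somewhere on the
  complement of \<open>e\<close>.
\<close>

lemma simple_eigenvalue_case:
  assumes dim: "DIM('a) \<ge> 2" and e: "q e e < 0" "ap A e = \<kappa> *\<^sub>R e"
    and simple: "\<And>v. ap A v = \<kappa> *\<^sub>R v \<Longrightarrow> v \<in> span {e}"
  shows "plane_alternative q g"
proof -
  define T where "T = {v\<in>UNIV. q e v = 0}"
  have T: "subspace T" "q.posdef T" "preserves A T" "q.symmetric_on A T"
    unfolding T_def using q.subspace_orthogonal[OF subspace_UNIV]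
      q.posdef_timelike_complement[OF subspace_UNIV q_lorentzian UNIV_I e(1)]
      q.preserves_orthogonal[OF _ A_symmetric_on UNIV_I e(2)] A_symmetric_on
    by (auto simp: preserves_def)
  have e0: "e \<noteq> 0" using e by auto
  have \<kappa>: "\<kappa> \<noteq> 0" using eigenvalue_nonzero[OF e(2) e0] .
  have "\<exists>f \<mu>. q e f = 0 \<and> f \<noteq> 0 \<and> ap A f = \<mu> *\<^sub>R f \<and> \<kappa> * \<mu> > 0"
  proof (cases "\<kappa> > 0")
    case True
    have "DIM('a) = Suc (dim T)" using q.dim_complement[OF subspace_UNIV UNIV_I, of e] e by (simp add: T_def dim_UNIV)
    then have "T \<noteq> {0}" using dim by auto
    then obtain f \<mu> where f: "f \<in> T" "f \<noteq> 0" "ap A f = \<mu> *\<^sub>R f" using q.posdef_eigenvector[OF T] by metis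
    have "g e e < 0" using e True by (simp add: g_eq mult_pos_neg)
    moreover have "g e f = 0" using f(1) e by (simp add: g_eq T_def)
    ultimately have "g f f > 0"
      using g.posdef_timelike_complement[OF subspace_UNIV g_lorentzian UNIV_I] f(2) by (auto simp: g.posdef_def)
    then have "\<mu> * q f f > 0" by (simp add: g_eq f)
    moreover have "q f f > 0" using T(2) f by (auto simp: q.posdef_def)
    ultimately have "\<mu> > 0" by (simp add: zero_less_mult_iff)
    then show ?thesis using f True by (auto simp: T_def)
  next
    case False
    then have neg: "\<kappa> < 0" using \<kappa> by simp
    obtain F where F: "finite F" "span F = T" "0 \<notin> F" "\<And>f h. f \<in> F \<Longrightarrow> h \<in> F \<Longrightarrow> f \<noteq> h \<Longrightarrow> q f h = 0"
      "\<And>f. f \<in> F \<Longrightarrow> \<exists>\<mu>. ap A f = \<mu> *\<^sub>R f"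
      using q.posdef_eigenbasis[OF T] by metis
    then obtain \<mu> where \<mu>: "\<And>f. f \<in> F \<Longrightarrow> ap A f = \<mu> f *\<^sub>R f" by metis
    have FT: "f \<in> T" if "f \<in> F" for f using F(2) span_base[OF that] by simp
    have "\<exists>f\<in>F. \<mu> f < 0"
    proof (rule ccontr)
      assume "\<not> (\<exists>f\<in>F. \<mu> f < 0)"
      then have nonneg: "\<mu> f \<ge> 0" if "f \<in> F" for f using that by force
      obtain x where x: "g x x < 0" using g_lorentzian by (auto simp: g.lorentzian_def)
      obtain a y where xy: "x = a + y" "a \<in> span {e}" "y \<in> T"
        using q.split_along[OF subspace_UNIV UNIV_I, of e] e unfolding T_def by force
      obtain k where k: "a = k *\<^sub>R e" using xy(2) by (auto simp: span_singleton)
      obtain c where c: "y = (\<Sum>f\<in>F. c f *\<^sub>R f)" using xy(3) F(1,2) by (auto simp: span_finite)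
      have "g y y = (\<Sum>f\<in>F. \<Sum>h\<in>F. c f * (c h * (\<mu> f * q f h)))"
        by (simp add: c g.sum_left g.sum_right sum_distrib_left g_eq \<mu> q.sum_left q.sum_right mult_ac)
          (subst sum.swap, simp add: mult_ac)
      also have "\<dots> \<ge> 0"
      proof (intro sum_nonneg)
        fix f h assume fh: "f \<in> F" "h \<in> F"
        show "c f * (c h * (\<mu> f * q f h)) \<ge> 0"
        proof (cases "f = h")
          case True
          have "q f f \<ge> 0" using q.posdef_nonneg[OF T(2) FT[OF fh(1)]] .
          then have "(c f * c f) * (\<mu> f * q f f) \<ge> 0" using nonneg[OF fh(1)] by simp
          then show ?thesis using True by (simp add: mult_ac)
        qed (simp add: F(4)[OF fh])
      qed
      finally have "g y y \<ge> 0" .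
      moreover have "g e y = 0" using xy(3) e by (simp add: g_eq T_def)
      then have "g x x = k\<^sup>2 * (\<kappa> * q e e) + g y y"
        by (simp add: xy(1) k g.sym[of y e]) (simp add: g_eq e power2_eq_square)
      moreover have "\<kappa> * q e e > 0" using neg e by (simp add: mult_neg_neg)
      then have "k\<^sup>2 * (\<kappa> * q e e) \<ge> 0" by simp
      ultimately show False using x by linarith
    qed
    then obtain f where f: "f \<in> F" "\<mu> f < 0" by blast
    then have "f \<in> T" "f \<noteq> 0" using F FT by auto
    then show ?thesis
      using \<mu>[OF f(1)] mult_neg_neg[OF neg f(2)] by (auto simp: T_def)
  qed
  then obtain f \<mu> where "q e f = 0" "f \<noteq> 0" "ap A f = \<mu> *\<^sub>R f" "\<kappa> * \<mu> > 0" by blast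
  then show ?thesis using eigenpair_case[OF e] simple by blast
qed

text \<open>
  The plane must be chosen with care: when the eigenvalue \<open>\<kappa>\<close> of \<open>e\<close> is multiple, there are several
  geodesics on the whole space, and the second vector of the plane has to be another eigenvector for \<open>\<kappa>\<close>, so that
  there are several on the plane, too.
\<close>

lemma timelike_eigenvector_case:
  assumes dim: "DIM('a) \<ge> 2" and e: "q e e < 0" "ap A e = \<kappa> *\<^sub>R e"
  shows "plane_alternative q g"
proof (cases "\<exists>f. ap A f = \<kappa> *\<^sub>R f \<and> f \<notin> span {e}")
  case False
  then show ?thesis using simple_eigenvalue_case[OF dim e] by blast
next
  case True
  then obtain f where f: "ap A f = \<kappa> *\<^sub>R f" "f \<notin> span {e}" by blast
  define f' where "f' = f - (q e f / q e e) *\<^sub>R e"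
  have Af': "ap A f' = \<kappa> *\<^sub>R f'" by (simp add: f'_def f e algebra_simps)
  have orth: "q e f' = 0" using e by (simp add: f'_def)
  have "f' \<noteq> 0" using f(2) by (auto simp: f'_def span_singleton)
  then have pos: "q f' f' > 0"
    using q.posdef_timelike_complement[OF subspace_UNIV q_lorentzian UNIV_I e(1)] orth by (auto simp: q.posdef_def)
  define e1 f1 where "e1 = (1 / sqrt (- q e e)) *\<^sub>R e" and "f1 = (1 / sqrt (q f' f')) *\<^sub>R f'"
  show ?thesis
  proof (rule multiple_eigenvalue_case)
    show "q e1 e1 = -1" using e(1) by (simp add: e1_def field_simps)
    show "q f1 f1 = 1" using pos by (simp add: f1_def field_simps)
    show "q e1 f1 = 0" using orth by (simp add: e1_def f1_def)
    show "ap A e1 = \<kappa> *\<^sub>R e1" "ap A f1 = \<kappa> *\<^sub>R f1" using e(2) Af' by (simp_all add: e1_def f1_def)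
  qed
qed

end

context lorentzian_pair
begin

text \<open>
  If \<open>\<kappa>\<close> were negative, \<open>g\<close> would be nonpositive on the plane of \<open>e\<close> and \<open>w\<close>, too much for a Lorentzian
  form. With \<open>x = (A - \<kappa>) / \<kappa>\<close> the endomorphism \<open>A\<close> is \<open>\<kappa> (1 + x)\<close> on the block, whose logarithm is
  \<open>ln \<kappa> + (x - x\<^sup>2 / 2)\<close>. It is unique on the whole space because \<open>e\<close> makes \<open>A\<close> rigid.
\<close>

lemma three_step_case:
  assumes e: "e \<noteq> 0" and Ae: "ap A e = \<kappa> *\<^sub>R e" and Aw: "ap A w = \<kappa> *\<^sub>R w + e" and Af: "ap A f = \<kappa> *\<^sub>R f + w"
    and t: "t \<in> span {e, w, f}" "q t t < 0"
  shows "three_step_alternative q g"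
proof -
  define S where "S = span {e, w, f}"
  define T where "T = q.complement S UNIV"
  define x where "x = (1 / \<kappa>) *\<^sub>R (A - \<kappa> *\<^sub>R 1)"
  define D where "D = x - (1/2) *\<^sub>R (x * x)"
  define X where "X = ln \<kappa> *\<^sub>R 1 + D"
  have \<kappa>0: "\<kappa> \<noteq> 0" using eigenvalue_nonzero[OF Ae e] .
  have x: "ap x e = 0" "ap x w = (1 / \<kappa>) *\<^sub>R e" "ap x f = (1 / \<kappa>) *\<^sub>R w"
    by (simp_all add: x_def Ae Aw Af)
  define M where "M = A - \<kappa> *\<^sub>R 1"
  have M: "ap M f = w" "ap M w = e" "ap M e = 0" by (simp_all add: M_def Ae Aw Af)
  have indep: "independent {e, w, f}" and dim3: "dim {e, w, f} = 3"
    using chain_independent[of M f] e by (simp_all add: M)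
  have dimS: "dim S = 2 + 1" using dim3 by (simp add: S_def)
  have mem: "e \<in> S" "w \<in> S" "f \<in> S" by (auto simp: S_def intro: span_base)
  have subS: "subspace S" by (simp add: S_def)
  have AS: "preserves A S"
    unfolding S_def by (rule preserves_span)
      (use mem subS in \<open>auto simp: Ae Aw Af S_def[symmetric] subspace_add subspace_scale\<close>)
  have L: "q.lorentzian S" using lorentzian_of_timelike t by (simp add: S_def)
  have "q (ap A w) e = q w (ap A e)" "q (ap A f) e = q f (ap A e)" "q (ap A f) w = q f (ap A w)"
    by (rule A_symmetric)+
  then have ee: "q e e = 0" and we: "q w e = 0" and ww: "q w w = q f e" by (simp_all add: Ae Aw Af)
  have w_e: "w \<notin> span {e}"
  proof
    assume "w \<in> span {e}"
    then obtain c where "w = c *\<^sub>R e" by (auto simp: span_singleton)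
    then show False using M e by simp
  qed
  have ww_pos: "q w w > 0"
    using q.null_complement_positive[OF subspace_UNIV q_lorentzian UNIV_I e ee UNIV_I _ w_e] we q.sym by simp
  have \<kappa>: "\<kappa> > 0"
  proof (rule ccontr)
    assume "\<not> \<kappa> > 0"
    then have "g w w \<le> 0" using ww_pos we q.sym[of e w] by (simp add: g_eq Aw mult_nonpos_nonneg)
    moreover have "g e e = 0" "g e w = 0" using ee we q.sym[of e w] by (simp_all add: g_eq Ae)
    ultimately obtain c where "w = c *\<^sub>R e"
      using g.nonspacelike_orthogonal_dependent[OF subspace_UNIV g_lorentzian UNIV_I UNIV_I _ _ _ e, of w] by auto
    then show False using w_e by (auto simp: span_singleton)
  qed
  have "g e e = 0" "g e f \<noteq> 0" using ee ww ww_pos \<kappa> q.sym[of e f] by (simp_all add: g_eq Ae)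
  then obtain c where u: "g (f + c *\<^sub>R e) (f + c *\<^sub>R e) < 0" using negative_vector by blast
  have uS: "f + c *\<^sub>R e \<in> S" using mem subS by (simp add: subspace_add subspace_scale)
  note split = adapted_splitting[OF subS AS dimS t(1)[folded S_def] t(2) uS u, folded T_def, simplified]
  have x3: "ap x (ap x (ap x v)) = 0" if "v \<in> S" for v
  proof -
    have "ap (x * x * x) v = ap 0 v"
      by (rule ap_eq_on_span[of "{e, w, f}"]) (use that in \<open>auto simp: x S_def\<close>)
    then show ?thesis by simp
  qed
  have xS: "preserves x S"
    using AS subS by (auto simp: x_def preserves_def subspace_diff subspace_scale)
  have D2: "ap D (ap D v) = ap x (ap x v)" "ap D (ap D (ap D v)) = 0" if "v \<in> S" for v
  proof -
    show D2: "ap D (ap D v) = ap x (ap x v)" using x3 that xS by (simp add: D_def preserves_def)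
    show "ap D (ap D (ap D v)) = 0" unfolding D2 using x3 that xS by (simp add: D_def preserves_def)
  qed
  have X: "ap X y = ln \<kappa> *\<^sub>R y + ap D y" for y by (simp add: X_def)
  have powr: "\<kappa> powr t = exp (t * ln \<kappa>)" for t using \<kappa> by (simp add: powr_def)
  have D_poly: "v + t *\<^sub>R ap D v + (t\<^sup>2 / 2) *\<^sub>R ap D (ap D v) = v + t *\<^sub>R ap x v + (t * (t - 1) / 2) *\<^sub>R ap x (ap x v)"
    if "v \<in> S" for v t
  proof -
    have "(t * (t - 1) / 2) = t\<^sup>2 / 2 - t * (1/2)" by (simp add: power2_eq_square field_simps)
    then show ?thesis unfolding D2[OF that] by (simp only: scaleR_diff_left) (simp add: D_def algebra_simps)
  qed
  have exp_tX: "ap (exp (t *\<^sub>R X)) v = (\<kappa> powr t) *\<^sub>R (v + t *\<^sub>R ap x v + (t * (t - 1) / 2) *\<^sub>R ap x (ap x v))"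
    if "v \<in> S" for v t
    using exp_on_jordan_chain[OF X D2(2)[OF that], of t] D_poly[OF that] by (simp add: powr)
  have exp_tD: "endo_exp (\<lambda>y. t *\<^sub>R (ap x y - (1/2) *\<^sub>R ap x (ap x y))) v
      = v + t *\<^sub>R ap x v + (t * (t - 1) / 2) *\<^sub>R ap x (ap x v)" if "v \<in> S" for v t
  proof -
    have "(\<lambda>y. t *\<^sub>R (ap x y - (1/2) *\<^sub>R ap x (ap x y))) = ap (t *\<^sub>R D)"
      by (auto simp: D_def)
    then have "endo_exp (\<lambda>y. t *\<^sub>R (ap x y - (1/2) *\<^sub>R ap x (ap x y))) v = ap (exp (t *\<^sub>R D)) v"
      by (simp only: endo_exp_ap)
    also have "\<dots> = v + t *\<^sub>R ap D v + (t\<^sup>2 / 2) *\<^sub>R ap D (ap D v)"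
      using exp_on_jordan_chain[of D 0 D v t] D2(2)[OF that] by simp
    finally show ?thesis using D_poly[OF that] by simp
  qed
  have x_sym: "q (ap x y) z = q y (ap x z)" for y z by (simp add: x_def A_symmetric)
  have logX: "q.log_on X A S"
    unfolding q.log_on_def q.symmetric_on_def
  proof (intro conjI ballI)
    show "preserves X S" using xS subS
      by (auto simp: X_def D_def preserves_def subspace_add subspace_diff subspace_scale)
    show "q (ap X y) z = q y (ap X z)" for y z by (simp add: X_def D_def x_sym)
    show "ap (exp X) v = ap A v" if "v \<in> S" for v
    proof -
      have "ap (exp X) v = \<kappa> *\<^sub>R (v + ap x v)" using exp_tX[OF that, of 1] \<kappa> by simp
      then show ?thesis using \<kappa>0 by (simp add: x_def algebra_simps)
    qed
  qed
  obtain Y where Y: "q.log_on Y A T" using split(6) by blast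
  obtain P N where "nondegenerate_form q S P N" using lorentzian_basis[OF subS L] .
  then interpret S: nondegenerate_form q S P N .
  obtain Z where Z: "q.log_on Z A UNIV" "\<And>v. v \<in> S \<Longrightarrow> ap Z v = ap X v"
    by (rule S.log_extend[OF logX Y[unfolded T_def]]) (rule that)
  obtain P' N' where "nondegenerate_form q UNIV P' N'" using lorentzian_basis[OF subspace_UNIV q_lorentzian] .
  then interpret E: nondegenerate_form q UNIV P' N' .
  have rigid: "q.rigid e A UNIV"
    using q.rigid_chain[OF subspace_UNIV q_lorentzian A_symmetric_on UNIV_I e Ae UNIV_I Aw] .
  have res: "restrict_form h UNIV = h" for h :: "'a form" by (simp add: restrict_form_def)
  have qE: "restrict_form q UNIV \<in> inner_products (DIM('a) - 1) 1 UNIV"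
    using q.lorentzian_inner_products[OF subspace_UNIV q_lorentzian] by (simp add: dim_UNIV)
  have "ap Z' v = ap Z v" if "q.log_on Z' A UNIV" for Z' v
    using q.rigid_log_unique[OF subspace_UNIV q_lorentzian rigid UNIV_I e _ Ae that Z(1) UNIV_I] ee by simp
  then have unique: "is_unique_geodesic (DIM('a) - 1) 1 UNIV q g (E.geodesic_of Z)"
    using E.is_unique_geodesic_iff[OF qE _ g_eq Z(1)] unfolding res by (simp add: preserves_def)
  have exp_Z: "ap (exp (t *\<^sub>R Z)) v = ap (exp (t *\<^sub>R X)) v" if "v \<in> S" for t v
    using logX Z(2) that preserves_scaleR[OF subS, of X]
    by (intro exp_ap_cong[where V = S]) (auto simp: q.log_on_def)
  have Bt: "\<exists>Bt. (\<forall>u\<in>S. \<forall>w\<in>S. E.geodesic_of Z t u w = q (Bt u) w) \<and>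
      (\<forall>u\<in>S. Bt u = (\<kappa> powr t) *\<^sub>R endo_exp (\<lambda>y. t *\<^sub>R (ap x y - (1/2) *\<^sub>R ap x (ap x y))) u) \<and>
      (\<forall>u\<in>S. Bt u = (\<kappa> powr t) *\<^sub>R (u + t *\<^sub>R ap x u + (t * (t - 1) / 2) *\<^sub>R ap x (ap x u)))" for t
  proof (intro exI[of _ "ap (exp (t *\<^sub>R Z))"] conjI ballI)
    fix u assume u: "u \<in> S"
    show "E.geodesic_of Z t u w = q (ap (exp (t *\<^sub>R Z)) u) w" for w by (simp add: E.geodesic_of_def res)
    show poly: "ap (exp (t *\<^sub>R Z)) u = (\<kappa> powr t) *\<^sub>R (u + t *\<^sub>R ap x u + (t * (t - 1) / 2) *\<^sub>R ap x (ap x u))"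
      unfolding exp_Z[OF u] exp_tX[OF u] ..
    show "ap (exp (t *\<^sub>R Z)) u = (\<kappa> powr t) *\<^sub>R endo_exp (\<lambda>y. t *\<^sub>R (ap x y - (1/2) *\<^sub>R ap x (ap x y))) u"
      unfolding poly exp_tD[OF u] ..
  qed
  have "ap x (ap x f) \<noteq> 0" using e \<kappa>0 by (simp add: x)
  then have "scaled_three_step_unipotent S (ap A) \<kappa> (ap x)"
    unfolding scaled_three_step_unipotent_def endomorphism_on_def
    using \<kappa> xS x3 mem(3) by (auto simp: preserves_def x_def algebra_simps)
  then show ?thesis
    unfolding three_step_alternative_def
    using split(1-5) unique Bt
    by (intro exI[of _ S] exI[of _ T] exI[of _ "ap A"] exI[of _ \<kappa>] exI[of _ "ap x"] conjI exI[of _ "E.geodesic_of Z"])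
      (simp_all only: numeral_2_eq_2 numeral_3_eq_3, auto)
qed

text \<open>
  With \<open>M = A - k\<close>, the second alternative provides a vector \<open>u\<close> with \<open>M\<^sup>3 u = 0\<close> and \<open>M\<^sup>2 u \<noteq> 0\<close>. Its
  component in the definite summand of the first alternative is killed by \<open>M\<^sup>2\<close>, as \<open>M\<close> is symmetric;
  but a plane is too small for a chain of length three.
\<close>

lemma alternatives_exclusive:
  assumes one: "common_splitting q g 1 1 S m 0 T"
    and two: "common_splitting q g 2 1 S' m' 0 T'" "related_by q g S' B" "scaled_three_step_unipotent S' B k x"
  shows False
proof -
  have S: "subspace S" "subspace T" "S \<inter> T = {0}" "\<And>v. \<exists>s t. v = s + t \<and> s \<in> S \<and> t \<in> T"
    and orth: "\<And>s t. s \<in> S \<Longrightarrow> t \<in> T \<Longrightarrow> q s t = 0 \<and> g s t = 0"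
    and rS: "restrict_form q S \<in> inner_products 1 1 S" and rT: "restrict_form q T \<in> inner_products m 0 T"
    using one unfolding common_splitting_def direct_sum_def by blast+
  have S': "\<And>v. \<exists>s t. v = s + t \<and> s \<in> S' \<and> t \<in> T'"
    and orth': "\<And>s t. s \<in> S' \<Longrightarrow> t \<in> T' \<Longrightarrow> q s t = 0 \<and> g s t = 0"
    using two(1) unfolding common_splitting_def direct_sum_def by blast+
  have B: "B u \<in> S'" "g u v = q (B u) v" if "u \<in> S'" "v \<in> S'" for u v
    using two(2) that by (auto simp: related_by_def automorphism_on_def endomorphism_on_def)
  have AB: "ap A u = B u" if u: "u \<in> S'" for u
  proof -
    have "q (ap A u - B u) v = 0" for v
    proof -
      obtain s t where v: "v = s + t" "s \<in> S'" "t \<in> T'" using S' by blast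
      have "q (ap A u) s = q (B u) s" "q (ap A u) t = 0" "q (B u) t = 0"
        using B[OF u v(2)] orth'[OF u v(3)] orth'[OF B(1)[OF u u] v(3)] by (simp_all flip: g_eq)
      then show ?thesis by (simp add: v(1))
    qed
    then have "ap A u - B u = 0" using q.lorentzian_nondegenerate[OF q_lorentzian UNIV_I] by blast
    then show ?thesis by simp
  qed
  define M where "M = A - k *\<^sub>R 1"
  have k: "k > 0" and x: "\<And>u. u \<in> S' \<Longrightarrow> x u \<in> S'" "\<And>u r. u \<in> S' \<Longrightarrow> x (r *\<^sub>R u) = r *\<^sub>R x u"
    "\<And>u. u \<in> S' \<Longrightarrow> B u = k *\<^sub>R (u + x u)" "\<And>u. u \<in> S' \<Longrightarrow> x (x (x u)) = 0"
    using two(3) by (auto simp: scaled_three_step_unipotent_def endomorphism_on_def)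
  obtain u where u: "u \<in> S'" "x (x u) \<noteq> 0" using two(3) by (auto simp: scaled_three_step_unipotent_def)
  have Mx: "ap M v = k *\<^sub>R x v" if "v \<in> S'" for v
    using AB[OF that] x(3)[OF that] by (simp add: M_def algebra_simps)
  have Mu: "ap M (ap M u) = (k * k) *\<^sub>R x (x u)" "ap M (ap M (ap M u)) = 0"
    using u x by (simp_all add: Mx)
  obtain P N where basis: "q.orthonormal_basis P N S" using q.inner_products_iff[OF S(1)] rS by blast
  have posT: "q.posdef T" using q.posdef_of_inner_products[OF S(2) rT] .
  have AS: "preserves A S"
    unfolding preserves_def
  proof
    fix v assume v: "v \<in> S"
    obtain s t where st: "ap A v = s + t" "s \<in> S" "t \<in> T" using S(4) by blast
    have "q (ap A v) t = 0" using orth[OF v st(3)] by (simp flip: g_eq)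
    then have "q t t = 0" using orth[OF st(2,3)] by (simp add: st(1))
    then have "t = 0" using posT st(3) by (force simp: q.posdef_def)
    then show "ap A v \<in> S" using st by simp
  qed
  have AT: "preserves A T"
    unfolding preserves_def
  proof
    fix v assume v: "v \<in> T"
    obtain s t where st: "ap A v = s + t" "s \<in> S" "t \<in> T" using S(4) by blast
    have "q s y = 0" if y: "y \<in> S" for y
    proof -
      have "q (ap A v) y = 0" using orth[OF y v] g.sym[of y v] by (simp flip: g_eq)
      then show ?thesis using orth[OF y st(3)] q.sym[of y t] by (simp add: st(1))
    qed
    then have "s = 0" using q.nondegenerate_of_basis[OF basis st(2)] by blast
    then show "ap A v \<in> T" using st by simp
  qed
  have MS: "preserves M S" "preserves M T"
    using AS AT S(1,2) by (auto simp: M_def preserves_def subspace_diff subspace_scale)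
  have M_sym: "q (ap M y) z = q y (ap M z)" for y z by (simp add: M_def A_symmetric)
  obtain s t where st: "u = s + t" "s \<in> S" "t \<in> T" using S(4) by blast
  have "ap M (ap M (ap M s)) \<in> S" "ap M (ap M (ap M t)) \<in> T" using MS st by (auto simp: preserves_def)
  moreover have sum0: "ap M (ap M (ap M s)) = - ap M (ap M (ap M t))"
    using Mu(2) by (simp add: st(1) eq_neg_iff_add_eq_0)
  moreover have "- ap M (ap M (ap M t)) \<in> T" using MS st S(2) by (simp add: preserves_def subspace_neg)
  ultimately have "ap M (ap M (ap M s)) \<in> S \<inter> T" by (simp only: Int_iff)
  then have s3: "ap M (ap M (ap M s)) = 0" unfolding S(3) by simp
  then have t3: "ap M (ap M (ap M t)) = 0" using sum0 by simp
  have definite: "y = 0" if "y \<in> T" "q y y = 0" for y using posT that by (force simp: q.posdef_def)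
  have "q (ap M (ap M t)) (ap M (ap M t)) = 0" using M_sym[of "ap M t" "ap M (ap M t)"] t3 by simp
  then have "ap M (ap M t) = 0" using MS st by (intro definite) (auto simp: preserves_def)
  then have "ap M (ap M s) \<noteq> 0" using Mu(1) u(2) k by (simp add: st(1))
  from chain_independent(2)[OF s3 this] have "3 \<le> dim S"
    using dim_subset[of "{ap M (ap M s), ap M s, s}" S] MS(1) st(2) by (simp add: preserves_def)
  moreover have "dim S = 2" using q.dim_inner_products[OF S(1) rS] by simp
  ultimately show False by simp
qed

end

section \<open>The theorem\<close>

theorem proposition9p2:
  fixes g0 g :: "'a::euclidean_space \<Rightarrow> 'a \<Rightarrow> real" and n :: nat
  assumes dim_E: "DIM('a) = n" and n_ge_2: "n \<ge> 2"
    and g0: "g0 \<in> inner_products (n - 1) 1 UNIV"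
    and g: "g \<in> inner_products (n - 1) 1 UNIV"
    and distinct: "g0 \<noteq> g"
  shows
    "((\<exists>S T B Bh.
         common_splitting g0 g 1 1 S (n - 2) 0 T \<and>
         g0 \<in> product_submanifold 1 1 S (n - 2) 0 T \<and>
         g \<in> product_submanifold 1 1 S (n - 2) 0 T \<and>
         totally_geodesic (n - 1) 1 UNIV (product_submanifold 1 1 S (n - 2) 0 T) \<and>
         (geodesic_exists (n - 1) 1 UNIV g0 g \<longleftrightarrow>
            geodesic_exists 1 1 S (restrict_form g0 S) (restrict_form g S)) \<and>
         (exactly_one_geodesic (n - 1) 1 UNIV g0 g \<longleftrightarrow>
            exactly_one_geodesic 1 1 S (restrict_form g0 S) (restrict_form g S)) \<and>
         related_by g0 g S B \<and>
         det_on S B > 0 \<and> Bh = (\<lambda>u. (1 / sqrt (det_on S B)) *\<^sub>R B u) \<and>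
         (geodesic_exists 1 1 S (restrict_form g0 S) (restrict_form g S) \<longleftrightarrow>
            trace_on S Bh > - 2 \<or> (\<forall>u\<in>S. Bh u = - u)))
      \<or>
      (\<exists>S T B k x.
         common_splitting g0 g 2 1 S (n - 3) 0 T \<and>
         g0 \<in> product_submanifold 2 1 S (n - 3) 0 T \<and>
         g \<in> product_submanifold 2 1 S (n - 3) 0 T \<and>
         totally_geodesic (n - 1) 1 UNIV (product_submanifold 2 1 S (n - 3) 0 T) \<and>
         related_by g0 g S B \<and> scaled_three_step_unipotent S B k x \<and>
         (\<exists>c. is_unique_geodesic (n - 1) 1 UNIV g0 g c \<and>
            (\<forall>t\<in>{0..1}. \<exists>Bt.
               (\<forall>u\<in>S. \<forall>w\<in>S. c t u w = g0 (Bt u) w) \<and>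
               (\<forall>u\<in>S. Bt u =
                  (k powr t) *\<^sub>R endo_exp (\<lambda>y. t *\<^sub>R (x y - (1/2) *\<^sub>R x (x y))) u) \<and>
               (\<forall>u\<in>S. Bt u =
                  (k powr t) *\<^sub>R (u + t *\<^sub>R x u + (t * (t - 1) / 2) *\<^sub>R x (x u)))))))
     \<and>
     \<not> ((\<exists>S T. common_splitting g0 g 1 1 S (n - 2) 0 T) \<and>
        (\<exists>S T B k x. common_splitting g0 g 2 1 S (n - 3) 0 T \<and>
           related_by g0 g S B \<and> scaled_three_step_unipotent S B k x))"
proof -
  have sym: "g0 \<in> sym_forms UNIV" "g \<in> sym_forms UNIV" using g0 g by (auto simp: inner_products_def)
  interpret q: symmetric_form g0 using sym by unfold_locales
  interpret g: symmetric_form g using sym by unfold_locales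
  have res: "restrict_form h UNIV = h" for h :: "'a form" by (simp add: restrict_form_def)
  have lor: "q.lorentzian UNIV" "g.lorentzian UNIV"
    using q.lorentzian_of_inner_products[OF subspace_UNIV] g.lorentzian_of_inner_products[OF subspace_UNIV] g0 g
    unfolding res by blast+
  obtain P N where "q.orthonormal_basis P N UNIV"
    using q.inner_products_iff[OF subspace_UNIV] g0 unfolding res by blast
  then interpret E: nondegenerate_form g0 UNIV P N
    using UNIV_not_singleton by unfold_locales auto
  interpret lorentzian_pair g0 g "E.raise g"
    by unfold_locales (use lor E.q_raise[OF sym(2)] in auto)
  have "preserves (E.raise g) UNIV" by (simp add: preserves_def)
  note hyps = subspace_UNIV lor(1) this A_symmetric_on
  from hyps have "plane_alternative g0 g \<or> three_step_alternative g0 g"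
  proof (cases rule: q.lorentzian_normal_form)
    case (timelike e \<mu>)
    then show ?thesis using timelike_eigenvector_case n_ge_2 dim_E by blast
  next
    case (complex w u \<alpha> \<beta> t)
    then show ?thesis using complex_case by blast
  next
    case (two_step e f \<kappa> t)
    then show ?thesis using two_step_case by blast
  next
    case (three_step e w f \<kappa> t)
    then show ?thesis using three_step_case by blast
  qed
  moreover have "\<not> ((\<exists>S T. common_splitting g0 g 1 1 S (n - 2) 0 T) \<and>
        (\<exists>S T B k x. common_splitting g0 g 2 1 S (n - 3) 0 T \<and>
           related_by g0 g S B \<and> scaled_three_step_unipotent S B k x))"
    using alternatives_exclusive by blast
  ultimately show ?thesis
    unfolding plane_alternative_def three_step_alternative_def dim_E by (rule conjI)
qed

end
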